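(* Let $N=2W$ with $W\ge1$ fixed, and let $\mathcal I_{\mathrm{exp},\mathrm{AIII}}$ be the space of exponentially local chiral insulators in dimension one (defined in the context), with the operator norm topology. Then the path components of $\mathcal I_{\mathrm{exp},\mathrm{AIII}}$ are labeled by $\mathbb Z$ through the norm continuous map $$\mathcal I_{\mathrm{exp},\mathrm{AIII}}\ni\begin{bmatrix}0&S^*\\S&0\end{bmatrix}\longmapsto\mathrm{ind}\,(\Lambda S\Lambda+\mathbb 1-\Lambda)\in\mathbb Z,$$ i.e. this map is norm continuous and induces a bijection $\pi_0(\mathcal I_{\mathrm{exp},\mathrm{AIII}})\to\mathbb Z$.
   Context: $\mathcal H=\ell^2(\mathbb Z)\otimes\mathbb C^N$ with $N=2W$. For a bounded operator $A$ and $x,y\in\mathbb Z$, $A_{xy}$ is the $N\times N$ matrix with entries $\langle\delta_x\otimes e_i,A\,\delta_y\otimes e_j\rangle$. $A$ is exponentially local iff there exist $c<\infty$, $\mu>0$ with $\|A_{xy}\|\le c\,e^{-\mu|x-y|}$ for all $x,y\in\mathbb Z$. An exponentially local insulator is a bounded self-adjoint exponentially local $H$ on $\mathcal H$ with $0\notin\sigma(H)$. The chiral symmetry operator is $\Pi=\mathbb 1\otimes(\mathbb 1_W\oplus(-\mathbb 1_W))$; $\mathcal I_{\mathrm{exp},\mathrm{AIII}}$ is the set of exponentially local insulators with $H\Pi=-\Pi H$, with the subspace topology from the operator norm. In the grading $\mathcal H=(\ell^2(\mathbb Z)\otimes\mathbb C^W)\oplus(\ell^2(\mathbb Z)\otimes\mathbb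 C^W)$ of $\Pi$, such $H$ has the form $\begin{bmatrix}0&S^*\\S&0\end{bmatrix}$ with $S$ an invertible exponentially local operator on $\ell^2(\mathbb Z)\otimes\mathbb C^W$. In the formula for the index, $\Lambda=\chi_{\mathbb N}(X)\otimes\mathbb 1_W$ with $X$ the position operator on $\ell^2(\mathbb Z)$; $\Lambda S\Lambda+\mathbb 1-\Lambda$ is Fredholm and $\mathrm{ind}$ is the Fredholm index. *)

theory Defs
  imports "HOL-Analysis.Analysis"
begin

section \<open>The complex Hilbert space of square-summable functions on an index type\<close>

typedef 'i ell2 = "{f :: 'i \<Rightarrow> complex. (\<lambda>i. (cmod (f i))\<^sup>2) summable_on UNIV}"
  morphisms ell2_apply Abs_ell2
  by (rule exI[of _ "\<lambda>_. 0"]) simp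

setup_lifting type_definition_ell2

lemma ell2_eqI: "(\<And>i. ell2_apply x i = ell2_apply y i) \<Longrightarrow> x = y"
  by (metis ell2_apply_inject ext)

lemma ell2_summable: "(\<lambda>i. (cmod (ell2_apply x i))\<^sup>2) summable_on UNIV"
  using ell2_apply[of x] by simp

lemma ell2_add_summable:
  assumes "(\<lambda>i. (cmod (f i))\<^sup>2) summable_on UNIV" "(\<lambda>i. (cmod (g i))\<^sup>2) summable_on UNIV"
  shows "(\<lambda>i. (cmod (f i + g i))\<^sup>2) summable_on UNIV"
proof (rule summable_on_comparison_test)
  show "(\<lambda>i. 2 * (cmod (f i))\<^sup>2 + 2 * (cmod (g i))\<^sup>2) summable_on UNIV"
    using assms by (intro summable_on_add summable_on_cmult_right)
  fix i
  have "(cmod (f i + g i))\<^sup>2 \<le> (cmod (f i) + cmod (g i))\<^sup>2"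
    by (intro power_mono norm_triangle_ineq) simp
  also have "\<dots> \<le> 2 * (cmod (f i))\<^sup>2 + 2 * (cmod (g i))\<^sup>2"
    using sum_squares_bound[of "cmod (f i)" "cmod (g i)"] by (simp add: power2_sum)
  finally show "(cmod (f i + g i))\<^sup>2 \<le> 2 * (cmod (f i))\<^sup>2 + 2 * (cmod (g i))\<^sup>2" .
qed simp

lemma ell2_scale_summable:
  assumes "(\<lambda>i. (cmod (f i))\<^sup>2) summable_on UNIV"
  shows "(\<lambda>i. (cmod (c * f i))\<^sup>2) summable_on UNIV"
  unfolding norm_mult power_mult_distrib using assms by (rule summable_on_cmult_right)

lemma ell2_mult_abs_summable:
  assumes "(\<lambda>i. (cmod (f i))\<^sup>2) summable_on UNIV" "(\<lambda>i. (cmod (g i))\<^sup>2) summable_on UNIV"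
  shows "(\<lambda>i. norm (cnj (f i) * g i)) summable_on UNIV"
proof (rule Infinite_Sum.abs_summable_on_comparison_test')
  show "(\<lambda>i. (cmod (f i))\<^sup>2 + (cmod (g i))\<^sup>2) summable_on UNIV"
    using assms by (rule summable_on_add)
  fix i
  have "2 * (cmod (f i) * cmod (g i)) \<le> (cmod (f i))\<^sup>2 + (cmod (g i))\<^sup>2"
    using sum_squares_bound[of "cmod (f i)" "cmod (g i)"] by simp
  moreover have "0 \<le> cmod (f i) * cmod (g i)" by simp
  ultimately show "norm (cnj (f i) * g i) \<le> (cmod (f i))\<^sup>2 + (cmod (g i))\<^sup>2"
    unfolding norm_mult complex_mod_cnj by linarith
qed

lemma ell2_mult_summable:
  "(\<lambda>i. cnj (ell2_apply x i) * ell2_apply y i) summable_on UNIV"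
  by (rule Infinite_Sum.abs_summable_summable[OF ell2_mult_abs_summable[OF ell2_summable ell2_summable]])

instantiation ell2 :: (type) real_vector
begin

lift_definition zero_ell2 :: "'a ell2" is "\<lambda>_. 0" by simp
lift_definition plus_ell2 :: "'a ell2 \<Rightarrow> 'a ell2 \<Rightarrow> 'a ell2" is "\<lambda>f g i. f i + g i"
  by (rule ell2_add_summable)
lift_definition uminus_ell2 :: "'a ell2 \<Rightarrow> 'a ell2" is "\<lambda>f i. - f i" by simp
lift_definition minus_ell2 :: "'a ell2 \<Rightarrow> 'a ell2 \<Rightarrow> 'a ell2" is "\<lambda>f g i. f i - g i"
  subgoal for f g using ell2_add_summable[of f "\<lambda>i. - g i"] by simp
  done
lift_definition scaleR_ell2 :: "real \<Rightarrow> 'a ell2 \<Rightarrow> 'a ell2" is "\<lambda>r f i. of_real r * f i"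
  by (rule ell2_scale_summable)

instance
  by standard (rule ell2_eqI; simp add: zero_ell2.rep_eq plus_ell2.rep_eq uminus_ell2.rep_eq
      minus_ell2.rep_eq scaleR_ell2.rep_eq algebra_simps)+

end

text \<open>The inner product is antilinear in its first argument.\<close>

definition cinner :: "'i ell2 \<Rightarrow> 'i ell2 \<Rightarrow> complex" where
  "cinner x y = (\<Sum>\<^sub>\<infinity>i. cnj (ell2_apply x i) * ell2_apply y i)"

lemma cinner_add_left: "cinner (x + y) z = cinner x z + cinner y z"
  unfolding cinner_def plus_ell2.rep_eq
  by (simp add: distrib_right infsum_add[OF ell2_mult_summable ell2_mult_summable])

lemma cinner_add_right: "cinner z (x + y) = cinner z x + cinner z y"
  unfolding cinner_def plus_ell2.rep_eq
  by (simp add: distrib_left infsum_add[OF ell2_mult_summable ell2_mult_summable])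

lemma cinner_commute: "cinner y x = cnj (cinner x y)"
  unfolding cinner_def by (simp flip: infsum_cnj add: mult.commute)

lemma cinner_self: "cinner x x = of_real (\<Sum>\<^sub>\<infinity>i. (cmod (ell2_apply x i))\<^sup>2)"
proof -
  have "cinner x x = (\<Sum>\<^sub>\<infinity>i. of_real ((cmod (ell2_apply x i))\<^sup>2))"
    unfolding cinner_def by (intro infsum_cong) (simp add: complex_norm_square mult.commute del: of_real_power)
  also have "\<dots> = of_real (\<Sum>\<^sub>\<infinity>i. (cmod (ell2_apply x i))\<^sup>2)"
    using has_sum_of_real[OF has_sum_infsum[OF ell2_summable]] infsumI by blast
  finally show ?thesis .
qed

instantiation ell2 :: (type) real_inner
begin

definition inner_ell2 :: "'a ell2 \<Rightarrow> 'a ell2 \<Rightarrow> real" where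
  "inner_ell2 x y = Re (cinner x y)"
definition norm_ell2 :: "'a ell2 \<Rightarrow> real" where
  "norm_ell2 x = sqrt (\<Sum>\<^sub>\<infinity>i. (cmod (ell2_apply x i))\<^sup>2)"
definition sgn_ell2 :: "'a ell2 \<Rightarrow> 'a ell2" where
  "sgn_ell2 x = x /\<^sub>R norm x"
definition dist_ell2 :: "'a ell2 \<Rightarrow> 'a ell2 \<Rightarrow> real" where
  "dist_ell2 x y = norm (x - y)"
definition uniformity_ell2 :: "('a ell2 \<times> 'a ell2) filter" where
  "uniformity_ell2 = (INF e\<in>{0<..}. principal {(x, y). dist x y < e})"
definition open_ell2 :: "'a ell2 set \<Rightarrow> bool" where
  "open_ell2 U = (\<forall>x\<in>U. \<forall>\<^sub>F (x', y) in uniformity. x' = x \<longrightarrow> y \<in> U)"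

instance
proof
  fix x y z :: "'a ell2" and r :: real
  show "inner x y = inner y x"
    unfolding inner_ell2_def by (subst cinner_commute) simp
  show "inner (x + y) z = inner x z + inner y z"
    unfolding inner_ell2_def by (simp add: cinner_add_left)
  show "inner (r *\<^sub>R x) y = r * inner x y"
    unfolding inner_ell2_def cinner_def scaleR_ell2.rep_eq
    by (simp add: mult.assoc infsum_cmult_right')
  show "0 \<le> inner x x"
    unfolding inner_ell2_def cinner_self by (simp add: infsum_nonneg)
  show "inner x x = 0 \<longleftrightarrow> x = 0"
  proof
    assume "inner x x = 0"
    then have "(\<Sum>\<^sub>\<infinity>i. (cmod (ell2_apply x i))\<^sup>2) = 0"
      unfolding inner_ell2_def cinner_self by simp
    then have "(cmod (ell2_apply x i))\<^sup>2 = 0" for i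
      using nonneg_infsum_le_0D[of "\<lambda>i. (cmod (ell2_apply x i))\<^sup>2" UNIV i] ell2_summable[of x]
      by simp
    then show "x = 0" by (intro ell2_eqI) (simp add: zero_ell2.rep_eq)
  qed (simp add: inner_ell2_def cinner_def zero_ell2.rep_eq)
  show "norm x = sqrt (inner x x)"
    unfolding inner_ell2_def cinner_self norm_ell2_def by simp
qed (simp_all add: sgn_ell2_def dist_ell2_def uniformity_ell2_def open_ell2_def)

end

lift_definition scaleC :: "complex \<Rightarrow> 'i ell2 \<Rightarrow> 'i ell2" (infixr "*\<^sub>C" 75) is "\<lambda>c f i. c * f i"
  by (rule ell2_scale_summable)

global_interpretation ell2: vector_space "scaleC :: complex \<Rightarrow> 'i ell2 \<Rightarrow> 'i ell2"
  by unfold_locales (rule ell2_eqI; simp add: plus_ell2.rep_eq scaleC.rep_eq algebra_simps)+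

lemma scaleR_eq_scaleC: "r *\<^sub>R x = of_real r *\<^sub>C x"
  by (rule ell2_eqI) (simp add: scaleR_ell2.rep_eq scaleC.rep_eq)

lemma cinner_scaleC_right: "cinner x (c *\<^sub>C y) = c * cinner x y"
  unfolding cinner_def scaleC.rep_eq by (simp add: mult.left_commute infsum_cmult_right')

lemma cinner_scaleC_left: "cinner (c *\<^sub>C x) y = cnj c * cinner x y"
  by (metis cinner_commute cinner_scaleC_right complex_cnj_mult)

lemma norm_scaleC: "norm (c *\<^sub>C (x :: 'i ell2)) = cmod c * norm x"
  unfolding norm_ell2_def scaleC.rep_eq norm_mult power_mult_distrib
  by (subst infsum_cmult_right') (simp add: real_sqrt_mult)

lemma norm_ell2_sq: "(norm (x :: 'i ell2))\<^sup>2 = (\<Sum>\<^sub>\<infinity>i. (cmod (ell2_apply x i))\<^sup>2)"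
  unfolding norm_ell2_def by (simp add: infsum_nonneg)

lemma cinner_self_norm: "cinner x x = of_real ((norm x)\<^sup>2)"
  by (simp only: cinner_self norm_ell2_sq)

lemma cinner_Cauchy_Schwarz: "cmod (cinner x y) \<le> norm x * norm y"
proof (cases "cinner x y = 0")
  case False
  define c where "c = cnj (cinner x y) / cmod (cinner x y)"
  have c1: "cmod c = 1" using False by (simp add: c_def norm_divide)
  have "cinner x (c *\<^sub>C y) = of_real (cmod (cinner x y))"
    unfolding cinner_scaleC_right c_def using False complex_norm_square[of "cinner x y"]
    by (simp add: divide_eq_eq power2_eq_square mult.commute)
  then have "cmod (cinner x y) = inner x (c *\<^sub>C y)"
    unfolding inner_ell2_def by simp
  also have "\<dots> \<le> norm x * norm (c *\<^sub>C y)" by (rule norm_cauchy_schwarz)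
  finally show ?thesis by (simp add: norm_scaleC c1)
qed simp

lift_definition ket :: "'i \<Rightarrow> 'i ell2" is "\<lambda>i j. if j = i then 1 else 0"
  by (rule finite_nonzero_values_imp_summable_on) simp


lemma ell2_apply_sum: "ell2_apply (sum f F) i = (\<Sum>j\<in>F. ell2_apply (f j) i)"
  by (induction F rule: infinite_finite_induct) (auto simp: zero_ell2.rep_eq plus_ell2.rep_eq)

lemma cinner_zero_right [simp]: "cinner x 0 = 0"
  by (simp add: cinner_def zero_ell2.rep_eq)

lemma cinner_sum_right: "cinner x (sum f F) = (\<Sum>j\<in>F. cinner x (f j))"
  by (induction F rule: infinite_finite_induct) (auto simp: cinner_add_right)

lemma cinner_ket_left [simp]: "cinner (ket i) x = ell2_apply x i"
proof -
  have "cinner (ket i) x = (\<Sum>\<^sub>\<infinity>j\<in>{i}. ell2_apply x j)"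
    unfolding cinner_def by (rule infsum_cong_neutral) (auto simp: ket.rep_eq)
  then show ?thesis by simp
qed

lemma cinner_ket_right [simp]: "cinner x (ket i) = cnj (ell2_apply x i)"
  by (subst cinner_commute) simp

lemma ell2_sum_le_norm:
  assumes "finite F"
  shows "(\<Sum>i\<in>F. (cmod (ell2_apply x i))\<^sup>2) \<le> (norm x)\<^sup>2"
  unfolding norm_ell2_sq by (intro finite_sum_le_infsum ell2_summable) (use assms in auto)

lemma ket_has_sum: "((\<lambda>i. ell2_apply x i *\<^sub>C ket i) has_sum x) UNIV"
proof -
  have dist: "norm ((\<Sum>i\<in>F. ell2_apply x i *\<^sub>C ket i) - x)
      = sqrt ((norm x)\<^sup>2 - (\<Sum>i\<in>F. (cmod (ell2_apply x i))\<^sup>2))" if "finite F" for F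
  proof -
    define p where "p = (\<Sum>i\<in>F. ell2_apply x i *\<^sub>C ket i)"
    have p: "ell2_apply p i = ell2_apply x i" if "i \<in> F" for i
      unfolding p_def ell2_apply_sum using that \<open>finite F\<close>
      by (simp add: scaleC.rep_eq ket.rep_eq if_distrib sum.delta cong: if_cong)
    have ip: "inner y p = (\<Sum>i\<in>F. (cmod (ell2_apply x i))\<^sup>2)"
      if y: "\<And>i. i \<in> F \<Longrightarrow> ell2_apply y i = ell2_apply x i" for y
    proof -
      have "cinner y p = (\<Sum>i\<in>F. ell2_apply x i * cnj (ell2_apply y i))"
        unfolding p_def by (simp add: cinner_sum_right cinner_scaleC_right)
      also have "\<dots> = (\<Sum>i\<in>F. of_real ((cmod (ell2_apply x i))\<^sup>2))"
        by (intro sum.cong refl) (simp add: y complex_norm_square del: of_real_power)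
      finally show ?thesis unfolding inner_ell2_def by simp
    qed
    have pp: "inner p p = (\<Sum>i\<in>F. (cmod (ell2_apply x i))\<^sup>2)"
      by (rule ip) (rule p)
    have "(norm (p - x))\<^sup>2 = inner p p - 2 * inner x p + inner x x"
      by (simp add: power2_norm_eq_inner inner_diff_left inner_diff_right inner_commute)
    also have "\<dots> = (norm x)\<^sup>2 - (\<Sum>i\<in>F. (cmod (ell2_apply x i))\<^sup>2)"
      unfolding pp ip[OF refl] power2_norm_eq_inner[of x] by linarith
    finally show ?thesis unfolding p_def by (metis norm_ge_zero real_sqrt_unique)
  qed
  have "((\<lambda>i. (cmod (ell2_apply x i))\<^sup>2) has_sum (norm x)\<^sup>2) UNIV"
    unfolding norm_ell2_sq by (rule has_sum_infsum[OF ell2_summable])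
  then have "((\<lambda>F. sqrt ((norm x)\<^sup>2 - (\<Sum>i\<in>F. (cmod (ell2_apply x i))\<^sup>2))) \<longlongrightarrow>
      sqrt ((norm x)\<^sup>2 - (norm x)\<^sup>2)) (finite_subsets_at_top UNIV)"
    unfolding has_sum_def by (intro tendsto_intros)
  moreover have "\<forall>\<^sub>F F in finite_subsets_at_top UNIV.
      sqrt ((norm x)\<^sup>2 - (\<Sum>i\<in>F. (cmod (ell2_apply x i))\<^sup>2))
      = norm ((\<Sum>i\<in>F. ell2_apply x i *\<^sub>C ket i) - x)"
    by (rule eventually_finite_subsets_at_top_weakI) (simp add: dist)
  ultimately have "((\<lambda>F. norm ((\<Sum>i\<in>F. ell2_apply x i *\<^sub>C ket i) - x)) \<longlongrightarrow> 0)
      (finite_subsets_at_top UNIV)"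
    using tendsto_cong by fastforce
  then show ?thesis
    unfolding has_sum_def by (metis LIM_zero_cancel tendsto_norm_zero_cancel)
qed


section \<open>Bounded operators\<close>

text \<open>The type of blinfuns consists of the real-linear bounded maps; the complex-linear ones form
  a closed subalgebra, on which the norm of the type is the usual operator norm.\<close>

definition clinear_op :: "('i ell2 \<Rightarrow>\<^sub>L 'j ell2) \<Rightarrow> bool" where
  "clinear_op A \<longleftrightarrow> (\<forall>c x. A (c *\<^sub>C x) = c *\<^sub>C A x)"

lemma ell2_apply_Blinfun:
  fixes T :: "'i ell2 \<Rightarrow> 'j \<Rightarrow> complex"
  assumes add: "\<And>x y i. T (x + y) i = T x i + T y i"
    and scale: "\<And>r x i. T (r *\<^sub>R x) i = of_real r * T x i"
    and bound: "\<And>x F. finite F \<Longrightarrow> (\<Sum>i\<in>F. (cmod (T x i))\<^sup>2) \<le> (K * norm x)\<^sup>2"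
  shows "ell2_apply (blinfun_apply (Blinfun (\<lambda>x. Abs_ell2 (T x))) x) i = T x i"
proof -
  have summable: "(\<lambda>i. (cmod (T x i))\<^sup>2) summable_on UNIV" for x
    by (rule nonneg_bdd_above_summable_on) (auto intro!: bdd_aboveI2 bound)
  have inv: "ell2_apply (Abs_ell2 (T x)) = T x" for x
    using summable by (intro Abs_ell2_inverse) simp
  have "bounded_linear (\<lambda>x. Abs_ell2 (T x))"
  proof (rule bounded_linear_intro)
    fix x y r
    show "Abs_ell2 (T (x + y)) = Abs_ell2 (T x) + Abs_ell2 (T y)"
      by (rule ell2_eqI) (simp add: inv add plus_ell2.rep_eq)
    show "Abs_ell2 (T (r *\<^sub>R x)) = r *\<^sub>R Abs_ell2 (T x)"
      by (rule ell2_eqI) (simp add: inv scale scaleR_ell2.rep_eq)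
    have "(norm (Abs_ell2 (T x)))\<^sup>2 \<le> (K * norm x)\<^sup>2"
      unfolding norm_ell2_sq inv by (rule infsum_le_finite_sums[OF summable bound])
    then have "norm (Abs_ell2 (T x)) \<le> \<bar>K * norm x\<bar>"
      by (simp add: abs_le_square_iff[symmetric])
    then show "norm (Abs_ell2 (T x)) \<le> norm x * \<bar>K\<bar>"
      by (simp add: abs_mult mult.commute)
  qed
  then show ?thesis by (simp add: bounded_linear_Blinfun_apply inv)
qed

text \<open>The adjoint, characterised by its defining identity; it exists for complex-linear
  operators.\<close>

definition cadjoint :: "('i ell2 \<Rightarrow>\<^sub>L 'j ell2) \<Rightarrow> ('j ell2 \<Rightarrow>\<^sub>L 'i ell2)" where
  "cadjoint A = (THE B :: 'j ell2 \<Rightarrow>\<^sub>L 'i ell2. \<forall>x y. cinner (B x) y = cinner x (A y))"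

lemma cadjoint_unique:
  assumes "\<And>x y. cinner (blinfun_apply B x) y = cinner x (blinfun_apply A y)"
  shows "cadjoint A = B"
  unfolding cadjoint_def
proof (rule the_equality)
  fix B' assume B': "\<forall>x y. cinner (blinfun_apply B' x) y = cinner x (blinfun_apply A y)"
  show "B' = B"
  proof (rule blinfun_eqI, rule ell2_eqI)
    fix x i
    have "cinner (blinfun_apply B' x) (ket i) = cinner (blinfun_apply B x) (ket i)"
      using B' assms by metis
    then show "ell2_apply (blinfun_apply B' x) i = ell2_apply (blinfun_apply B x) i" by simp
  qed
qed (use assms in blast)

lemma bounded_linear_cinner_right: "bounded_linear (cinner x)"
  by (rule bounded_linear_intro[where K = "norm x"])
    (use cinner_Cauchy_Schwarz[of x] in \<open>auto simp: cinner_add_right scaleR_eq_scaleC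
      cinner_scaleC_right scaleR_conv_of_real mult.commute\<close>)

lemma cinner_cadjoint:
  assumes "clinear_op A"
  shows "cinner (blinfun_apply (cadjoint A) x) y = cinner x (blinfun_apply A y)"
proof -
  define T where "T = (\<lambda>x i. cinner (blinfun_apply A (ket i)) x)"
  define B where "B = Blinfun (\<lambda>x. Abs_ell2 (T x))"
  have B: "ell2_apply (blinfun_apply B x) i = T x i" for x i
    unfolding B_def
  proof (rule ell2_apply_Blinfun[where K = "norm A"])
    fix x and F :: "'a set" assume "finite F"
    define v where "v = (\<Sum>i\<in>F. T x i *\<^sub>C ket i)"
    define s where "s = (\<Sum>i\<in>F. (cmod (T x i))\<^sup>2)"
    have s0: "0 \<le> s" unfolding s_def by (simp add: sum_nonneg)
    have v: "ell2_apply v i = T x i" if "i \<in> F" for i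
      unfolding v_def ell2_apply_sum using that \<open>finite F\<close>
      by (simp add: scaleC.rep_eq ket.rep_eq if_distrib sum.delta cong: if_cong)
    have "cinner v v = (\<Sum>i\<in>F. T x i * cnj (ell2_apply v i))"
      by (subst (2) v_def) (simp add: cinner_sum_right cinner_scaleC_right)
    also have "\<dots> = of_real s"
      unfolding s_def of_real_sum
      by (intro sum.cong refl) (simp add: v complex_norm_square del: of_real_power)
    finally have nv: "(norm v)\<^sup>2 = s"
      unfolding cinner_self_norm using of_real_eq_iff by blast
    have "cinner x (blinfun_apply A v) = (\<Sum>i\<in>F. T x i * cinner x (blinfun_apply A (ket i)))"
      unfolding v_def using assms
      by (simp add: clinear_op_def blinfun.sum_right cinner_sum_right cinner_scaleC_right)
    also have "\<dots> = of_real s"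
      unfolding s_def of_real_sum
      by (intro sum.cong refl, subst cinner_commute)
        (simp add: T_def complex_norm_square del: of_real_power)
    finally have "s \<le> norm x * norm (blinfun_apply A v)"
      using cinner_Cauchy_Schwarz[of x "blinfun_apply A v"] s0 by simp
    also have "\<dots> \<le> norm x * (norm A * norm v)"
      by (intro mult_left_mono norm_blinfun) simp
    finally have "norm v * norm v \<le> (norm A * norm x) * norm v"
      unfolding nv[symmetric] by (simp add: power2_eq_square mult_ac)
    then have "norm v \<le> norm A * norm x"
      by (cases "norm v = 0") (auto simp: mult_le_cancel_right)
    then show "(\<Sum>i\<in>F. (cmod (T x i))\<^sup>2) \<le> (norm A * norm x)\<^sup>2"
      unfolding s_def[symmetric] nv[symmetric] by (rule power_mono) simp
  qed (simp_all add: T_def cinner_add_right scaleR_eq_scaleC cinner_scaleC_right)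
  have "cinner (blinfun_apply B x) y = cinner x (blinfun_apply A y)" for x y
  proof -
    have "bounded_linear (\<lambda>y. cinner x (blinfun_apply A y))"
      by (rule bounded_linear_compose[OF bounded_linear_cinner_right blinfun.bounded_linear_right])
    then have "((\<lambda>i. cinner x (blinfun_apply A (ell2_apply y i *\<^sub>C ket i))) has_sum
        cinner x (blinfun_apply A y)) UNIV"
      using has_sum_bounded_linear[OF _ ket_has_sum] by (fastforce simp: o_def)
    moreover have "cinner x (blinfun_apply A (ell2_apply y i *\<^sub>C ket i))
        = cnj (ell2_apply (blinfun_apply B x) i) * ell2_apply y i" for i
      using assms by (simp add: clinear_op_def cinner_scaleC_right B T_def cinner_commute[of x])
    ultimately show ?thesis
      unfolding cinner_def[of "blinfun_apply B x"] by (simp add: infsumI)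
  qed
  then show ?thesis using cadjoint_unique by metis
qed

definition selfadjoint :: "('i ell2 \<Rightarrow>\<^sub>L 'i ell2) \<Rightarrow> bool" where
  "selfadjoint A \<longleftrightarrow> clinear_op A \<and> cadjoint A = A"

text \<open>Multiplication by a bounded function.\<close>

definition diag_op :: "('i \<Rightarrow> complex) \<Rightarrow> ('i ell2 \<Rightarrow>\<^sub>L 'i ell2)" where
  "diag_op f = Blinfun (\<lambda>x. Abs_ell2 (\<lambda>i. f i * ell2_apply x i))"

lemma ell2_apply_diag_op:
  assumes "bounded (range f)"
  shows "ell2_apply (blinfun_apply (diag_op f) x) i = f i * ell2_apply x i"
proof -
  obtain K where K: "\<And>i. cmod (f i) \<le> K"
    using assms unfolding bounded_iff by auto
  show ?thesis unfolding diag_op_def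
  proof (rule ell2_apply_Blinfun[where K = K])
    fix x :: "'a ell2" and F :: "'a set" assume "finite F"
    have "(\<Sum>i\<in>F. (cmod (f i * ell2_apply x i))\<^sup>2) \<le> (\<Sum>i\<in>F. K\<^sup>2 * (cmod (ell2_apply x i))\<^sup>2)"
      unfolding norm_mult power_mult_distrib
      by (intro sum_mono mult_right_mono power_mono K) auto
    also have "\<dots> \<le> K\<^sup>2 * (norm x)\<^sup>2"
      unfolding sum_distrib_left[symmetric]
      by (intro mult_left_mono ell2_sum_le_norm \<open>finite F\<close>) simp
    finally show "(\<Sum>i\<in>F. (cmod (f i * ell2_apply x i))\<^sup>2) \<le> (K * norm x)\<^sup>2"
      by (simp add: power_mult_distrib)
  qed (simp_all add: plus_ell2.rep_eq scaleR_ell2.rep_eq algebra_simps)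
qed

definition spectrum :: "('i ell2 \<Rightarrow>\<^sub>L 'i ell2) \<Rightarrow> complex set" where
  "spectrum A = {z. \<not> (\<exists>B. clinear_op B \<and> B o\<^sub>L (A - diag_op (\<lambda>_. z)) = id_blinfun
      \<and> (A - diag_op (\<lambda>_. z)) o\<^sub>L B = id_blinfun)}"

text \<open>Composition with an injective map of index types, and the isometric embedding (extension by
  zero) that is its adjoint.\<close>

definition pull_op :: "('i \<Rightarrow> 'j) \<Rightarrow> ('j ell2 \<Rightarrow>\<^sub>L 'i ell2)" where
  "pull_op f = Blinfun (\<lambda>x. Abs_ell2 (\<lambda>i. ell2_apply x (f i)))"

definition push_op :: "('i \<Rightarrow> 'j) \<Rightarrow> ('i ell2 \<Rightarrow>\<^sub>L 'j ell2)" where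
  "push_op f = Blinfun (\<lambda>x. Abs_ell2 (\<lambda>j. if j \<in> range f then ell2_apply x (inv f j) else 0))"

lemma ell2_apply_pull_op:
  assumes "inj f"
  shows "ell2_apply (blinfun_apply (pull_op f) x) i = ell2_apply x (f i)"
  unfolding pull_op_def
proof (rule ell2_apply_Blinfun[where K = 1])
  fix x and F :: "'a set" assume "finite F"
  have "(\<Sum>i\<in>F. (cmod (ell2_apply x (f i)))\<^sup>2) = (\<Sum>j\<in>f ` F. (cmod (ell2_apply x j))\<^sup>2)"
    using assms by (simp add: sum.reindex inj_on_subset)
  then show "(\<Sum>i\<in>F. (cmod (ell2_apply x (f i)))\<^sup>2) \<le> (1 * norm x)\<^sup>2"
    using ell2_sum_le_norm[of "f ` F" x] \<open>finite F\<close> by simp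
qed (simp_all add: plus_ell2.rep_eq scaleR_ell2.rep_eq)

lemma ell2_apply_push_op:
  assumes "inj f"
  shows "ell2_apply (blinfun_apply (push_op f) x) j
    = (if j \<in> range f then ell2_apply x (inv f j) else 0)"
  unfolding push_op_def
proof (rule ell2_apply_Blinfun[where K = 1])
  fix x :: "'a ell2" and F :: "'b set" assume "finite F"
  have "(\<Sum>j\<in>F. (cmod (if j \<in> range f then ell2_apply x (inv f j) else 0))\<^sup>2)
      = (\<Sum>j\<in>F \<inter> range f. (cmod (ell2_apply x (inv f j)))\<^sup>2)"
    unfolding sum.inter_restrict[OF \<open>finite F\<close>] by (intro sum.cong) auto
  also have "\<dots> = (\<Sum>i\<in>inv f ` (F \<inter> range f). (cmod (ell2_apply x i))\<^sup>2)"
    by (subst sum.reindex) (auto intro: inj_on_inv_into[of _ f UNIV, THEN inj_on_subset])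
  also have "\<dots> \<le> (norm x)\<^sup>2"
    using \<open>finite F\<close> by (intro ell2_sum_le_norm) simp
  finally show "(\<Sum>j\<in>F. (cmod (if j \<in> range f then ell2_apply x (inv f j) else 0))\<^sup>2)
      \<le> (1 * norm x)\<^sup>2" by simp
qed (simp_all add: plus_ell2.rep_eq scaleR_ell2.rep_eq)


section \<open>Fredholm operators\<close>

definition op_kernel :: "('i ell2 \<Rightarrow>\<^sub>L 'j ell2) \<Rightarrow> 'i ell2 set" where
  "op_kernel A = {x. A x = 0}"

definition finite_cdim :: "'i ell2 set \<Rightarrow> bool" where
  "finite_cdim V \<longleftrightarrow> (\<exists>B. finite B \<and> V = ell2.span B)"

definition fredholm :: "('i ell2 \<Rightarrow>\<^sub>L 'j ell2) \<Rightarrow> bool" where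
  "fredholm A \<longleftrightarrow> clinear_op A \<and> closed (range (blinfun_apply A))
      \<and> finite_cdim (op_kernel A) \<and> finite_cdim (op_kernel (cadjoint A))"

text \<open>For closed range, the kernel of the adjoint is isomorphic to the cokernel.\<close>

definition fredholm_index :: "('i ell2 \<Rightarrow>\<^sub>L 'j ell2) \<Rightarrow> int" where
  "fredholm_index A = int (ell2.dim (op_kernel A)) - int (ell2.dim (op_kernel (cadjoint A)))"


section \<open>Exponentially local chiral insulators in one dimension\<close>

text \<open>Here \<open>\<ell>\<^sup>2(\<int>) \<otimes> \<complex>\<^sup>n\<close> is \<open>(int \<times> 'n) ell2\<close>, with \<open>n = CARD('n)\<close>
  and \<open>\<delta>\<^sub>x \<otimes> e\<^sub>i = ket (x, i)\<close>.\<close>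

type_synonym 'n lattice_op = "(int \<times> 'n) ell2 \<Rightarrow>\<^sub>L (int \<times> 'n) ell2"

definition hop :: "'n::finite lattice_op \<Rightarrow> int \<Rightarrow> int \<Rightarrow> complex^'n^'n" where
  "hop A x y = (\<chi> i j. cinner (ket (x, i)) (A (ket (y, j))))"

text \<open>The norm of a matrix is its operator norm for the Euclidean norm (the norm of the type
  of matrices would be the Frobenius norm).\<close>

definition exp_local :: "'n::finite lattice_op \<Rightarrow> bool" where
  "exp_local A \<longleftrightarrow>
    (\<exists>c \<mu>. \<mu> > 0 \<and> (\<forall>x y. onorm ((*v) (hop A x y)) \<le> c * exp (- \<mu> * \<bar>real_of_int (x - y)\<bar>)))"

definition exp_local_insulators :: "'n::finite lattice_op set" where
  "exp_local_insulators = {H. selfadjoint H \<and> exp_local H \<and> 0 \<notin> spectrum H}"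

text \<open>The sum type splits \<open>\<complex>\<^sup>N = \<complex>\<^sup>W \<oplus> \<complex>\<^sup>W\<close> for \<open>W = CARD('w)\<close>.\<close>

definition chiral_sym :: "('w + 'w) lattice_op" where
  "chiral_sym = diag_op (\<lambda>(x, s). case s of Inl _ \<Rightarrow> 1 | Inr _ \<Rightarrow> - 1)"

definition chiral_insulators :: "('w::finite + 'w) lattice_op set" where
  "chiral_insulators =
    {H \<in> exp_local_insulators. H o\<^sub>L chiral_sym = - (chiral_sym o\<^sub>L H)}"

abbreviation plus_site :: "int \<times> 'w \<Rightarrow> int \<times> ('w + 'w)" where
  "plus_site \<equiv> map_prod id Inl"

abbreviation minus_site :: "int \<times> 'w \<Rightarrow> int \<times> ('w + 'w)" where
  "minus_site \<equiv> map_prod id Inr"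

text \<open>The block operator with rows \<open>0, S\<^sup>*\<close> and \<open>S, 0\<close>, and the lower left block of an operator.\<close>

definition off_diagonal :: "'w lattice_op \<Rightarrow> ('w + 'w) lattice_op" where
  "off_diagonal S = (push_op plus_site o\<^sub>L cadjoint S o\<^sub>L pull_op minus_site)
    + (push_op minus_site o\<^sub>L S o\<^sub>L pull_op plus_site)"

definition lower_left :: "('w + 'w) lattice_op \<Rightarrow> 'w lattice_op" where
  "lower_left H = pull_op minus_site o\<^sub>L H o\<^sub>L push_op plus_site"

lemma inj_sites: "inj plus_site" "inj minus_site"
  by (auto simp: inj_def)

lemma ell2_apply_push_plus [simp]:
  "ell2_apply (blinfun_apply (push_op plus_site) x) (n, Inl i) = ell2_apply x (n, i)"
  "ell2_apply (blinfun_apply (push_op plus_site) x) (n, Inr i) = 0"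
  using inv_f_f[OF inj_sites(1), of "(n, i)"]
  by (auto simp: ell2_apply_push_op[OF inj_sites(1)] image_iff)

lemma ell2_apply_push_minus [simp]:
  "ell2_apply (blinfun_apply (push_op minus_site) x) (n, Inr i) = ell2_apply x (n, i)"
  "ell2_apply (blinfun_apply (push_op minus_site) x) (n, Inl i) = 0"
  using inv_f_f[OF inj_sites(2), of "(n, i)"]
  by (auto simp: ell2_apply_push_op[OF inj_sites(2)] image_iff)

lemma ell2_apply_pull_sites [simp]:
  "ell2_apply (blinfun_apply (pull_op plus_site) x) (n, i) = ell2_apply x (n, Inl i)"
  "ell2_apply (blinfun_apply (pull_op minus_site) x) (n, i) = ell2_apply x (n, Inr i)"
  by (simp_all add: ell2_apply_pull_op inj_sites)

lemma lower_left_off_diagonal: "lower_left (off_diagonal S) = S"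
proof (rule blinfun_eqI, rule ell2_eqI)
  fix x :: "(int \<times> 'a) ell2" and j :: "int \<times> 'a"
  have pp: "blinfun_apply (pull_op plus_site) (blinfun_apply (push_op plus_site) x) = x"
    by (rule ell2_eqI) (auto simp: split_paired_all)
  have mp: "blinfun_apply (pull_op minus_site) (blinfun_apply (push_op plus_site) x) = 0"
    by (rule ell2_eqI) (auto simp: split_paired_all zero_ell2.rep_eq)
  show "ell2_apply (blinfun_apply (lower_left (off_diagonal S)) x) j
      = ell2_apply (blinfun_apply S x) j"
    by (cases j) (simp add: lower_left_def off_diagonal_def blinfun.add_left blinfun.zero_right
        pp mp plus_ell2.rep_eq)
qed

lemma ell2_apply_chiral_sym [simp]:
  "ell2_apply (blinfun_apply chiral_sym x) (n, Inl i) = ell2_apply x (n, Inl i)"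
  "ell2_apply (blinfun_apply chiral_sym x) (n, Inr i) = - ell2_apply x (n, Inr i)"
proof -
  have "bounded (range (\<lambda>(x :: int, s :: 'a + 'a). (case s of Inl _ \<Rightarrow> 1 | Inr _ \<Rightarrow> - 1) :: complex))"
    by (rule boundedI[where B = 1]) (auto split: sum.split)
  then show "ell2_apply (blinfun_apply chiral_sym x) (n, Inl i) = ell2_apply x (n, Inl i)"
    "ell2_apply (blinfun_apply chiral_sym x) (n, Inr i) = - ell2_apply x (n, Inr i)"
    unfolding chiral_sym_def by (simp_all add: ell2_apply_diag_op)
qed

lemma cinner_pull_push:
  assumes "inj f"
  shows "cinner (blinfun_apply (pull_op f) x) y = cinner x (blinfun_apply (push_op f) y)"
proof -
  have "cinner x (blinfun_apply (push_op f) y)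
      = (\<Sum>\<^sub>\<infinity>j\<in>range f. cnj (ell2_apply x j) * ell2_apply (blinfun_apply (push_op f) y) j)"
    unfolding cinner_def by (rule infsum_cong_neutral) (auto simp: ell2_apply_push_op[OF assms])
  also have "\<dots> = cinner (blinfun_apply (pull_op f) x) y"
    unfolding cinner_def
    by (subst infsum_reindex[OF assms])
      (simp add: o_def ell2_apply_push_op[OF assms] ell2_apply_pull_op[OF assms] inv_f_f[OF assms])
  finally show ?thesis by simp
qed

lemma cinner_push_pull:
  assumes "inj f"
  shows "cinner (blinfun_apply (push_op f) x) y = cinner x (blinfun_apply (pull_op f) y)"
  by (metis assms cinner_pull_push cinner_commute)

lemma off_diagonal_lower_left:
  fixes H :: "('a::finite + 'a) lattice_op"
  assumes "H \<in> chiral_insulators"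
  shows "off_diagonal (lower_left H) = H"
proof -
  have sa: "cinner (blinfun_apply H x) y = cinner x (blinfun_apply H y)" for x y
    using assms cinner_cadjoint[of H x y]
    by (auto simp: chiral_insulators_def exp_local_insulators_def selfadjoint_def)
  have anti: "blinfun_apply H (blinfun_apply chiral_sym x)
      = - blinfun_apply chiral_sym (blinfun_apply H x)" for x
    using assms
    by (auto simp: chiral_insulators_def blinfun.minus_left dest!: arg_cong[of _ _ "\<lambda>A. blinfun_apply A x"])
  have adj: "cadjoint (lower_left H) = pull_op plus_site o\<^sub>L H o\<^sub>L push_op minus_site"
    by (rule cadjoint_unique)
      (simp add: lower_left_def cinner_pull_push cinner_push_pull inj_sites sa)
  show ?thesis
  proof (rule blinfun_eqI, rule ell2_eqI)
    fix x :: "(int \<times> ('a + 'a)) ell2" and k :: "int \<times> ('a + 'a)"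
    define p where "p = blinfun_apply (push_op plus_site) (blinfun_apply (pull_op plus_site) x)"
    define m where "m = blinfun_apply (push_op minus_site) (blinfun_apply (pull_op minus_site) x)"
    have x: "x = p + m"
      unfolding p_def m_def
    proof (rule ell2_eqI)
      fix k :: "int \<times> ('a + 'a)"
      show "ell2_apply x k = ell2_apply (blinfun_apply (push_op plus_site) (blinfun_apply (pull_op plus_site) x) + blinfun_apply (push_op minus_site) (blinfun_apply (pull_op minus_site) x)) k"
        by (cases k; cases "snd k") (auto simp: plus_ell2.rep_eq)
    qed
    have p: "blinfun_apply chiral_sym p = p" unfolding p_def
    proof (rule ell2_eqI)
      fix k :: "int \<times> ('a + 'a)"
      show "ell2_apply (blinfun_apply chiral_sym (blinfun_apply (push_op plus_site) (blinfun_apply (pull_op plus_site) x))) k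
        = ell2_apply (blinfun_apply (push_op plus_site) (blinfun_apply (pull_op plus_site) x)) k"
        by (cases k; cases "snd k") auto
    qed
    have m: "blinfun_apply chiral_sym m = - m" unfolding m_def
    proof (rule ell2_eqI)
      fix k :: "int \<times> ('a + 'a)"
      show "ell2_apply (blinfun_apply chiral_sym (blinfun_apply (push_op minus_site) (blinfun_apply (pull_op minus_site) x))) k
        = ell2_apply (- blinfun_apply (push_op minus_site) (blinfun_apply (pull_op minus_site) x)) k"
        by (cases k; cases "snd k") (auto simp: uminus_ell2.rep_eq)
    qed
    have Hp: "ell2_apply (blinfun_apply H p) (n, Inl i) = 0" for n i
      using arg_cong[OF anti[of p], of "\<lambda>y. ell2_apply y (n, Inl i)"]
      by (simp add: p uminus_ell2.rep_eq)
    have Hm: "ell2_apply (blinfun_apply H m) (n, Inr i) = 0" for n i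
      using arg_cong[OF anti[of m], of "\<lambda>y. ell2_apply y (n, Inr i)"]
      by (simp add: m uminus_ell2.rep_eq blinfun.minus_right)
    have off: "blinfun_apply (off_diagonal (lower_left H)) x
        = blinfun_apply (push_op plus_site) (blinfun_apply (pull_op plus_site) (blinfun_apply H m))
        + blinfun_apply (push_op minus_site) (blinfun_apply (pull_op minus_site) (blinfun_apply H p))"
      by (simp add: off_diagonal_def adj blinfun.add_left) (simp add: lower_left_def p_def m_def)
    have "blinfun_apply H x = blinfun_apply H p + blinfun_apply H m"
      by (subst x) (rule blinfun.add_right)
    then show "ell2_apply (blinfun_apply (off_diagonal (lower_left H)) x) k
        = ell2_apply (blinfun_apply H x) k"
      unfolding off by (cases k; cases "snd k") (auto simp: plus_ell2.rep_eq Hp Hm)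
  qed
qed

definition half_line :: "'w lattice_op" where
  "half_line = diag_op (\<lambda>(x, i). if x \<ge> 0 then 1 else 0)"

lemma ell2_apply_half_line:
  "ell2_apply (blinfun_apply half_line y) (x, i) = (if x \<ge> 0 then ell2_apply y (x, i) else 0)"
proof -
  have "bounded (range (\<lambda>(x :: int, i :: 'a). if x \<ge> 0 then 1 else 0 :: complex))"
    by (rule boundedI[where B = 1]) auto
  then show ?thesis unfolding half_line_def by (simp add: ell2_apply_diag_op)
qed

definition half_line_compression :: "'w lattice_op \<Rightarrow> 'w lattice_op" where
  "half_line_compression S = (half_line o\<^sub>L S o\<^sub>L half_line) + id_blinfun - half_line"

definition chiral_index :: "('w::finite + 'w) lattice_op \<Rightarrow> int" where
  "chiral_index H = fredholm_index (half_line_compression (lower_left H))"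

end

theory Submission
  imports Defs
begin

text \<open>
  A chiral insulator is the same as an invertible exponentially local operator \<open>S\<close>, the lower left
  block. The diagonals of \<open>S\<close> decay exponentially, so \<open>S\<close> is a norm limit of banded operators, and
  the index, being stable under small perturbations, need only be understood for banded \<open>S\<close>. There the
  vectors supported to the left of \<open>n + l\<close> which \<open>S\<close> maps to the right of \<open>n\<close> form a space of
  dimension \<open>l W - ind\<close>, for every cut \<open>n\<close> and every \<open>l\<close> larger than the band width.

  To connect two banded invertible operators \<open>S\<close> and \<open>U\<close> of the same index, with \<open>U\<close> a power of a
  shift, one uses this count simultaneously at the equidistant cuts \<open>n = 2 l k\<close>: since \<open>S\<^sup>-\<^sup>1\<close> is a
  norm limit of banded operators, there is an invertible \<open>V\<close>, block diagonal with respect to the windows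
  of half-width \<open>l\<close> around the cuts, such that \<open>S V U\<^sup>-\<^sup>1\<close> almost commutes with the projections onto
  the half-lines to the right of all cuts. Hence \<open>S V U\<^sup>-\<^sup>1\<close> can be deformed along a segment to an
  operator that is block diagonal with respect to the intervals between the cuts. Invertible block
  diagonal operators with blocks of bounded size are connected to the identity by Gaussian elimination
  in all blocks at once, with uniform bounds; applied to \<open>V\<close> and to this operator, it yields a path from
  \<open>S\<close> to \<open>U\<close>.
\<close>

text \<open>Two things shape the argument. Paths must stay inside the local operators, and there are
  infinitely many cuts, so every estimate has to be uniform in the cut; all paths of operators
  \<open>S\<close> are pieced together from segments, multiplied by fixed local factors. Moreover
  the inverse of a banded operator is in general not banded. What survives is that its entries
  between distant sets form operators of small norm, and this smallness \<open>e\<close> must be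
  fixed before the window half-width \<open>l\<close>. All bounds for the window operators therefore
  depend only on the norms of \<open>S\<close> and of its inverse. The index enters by making the
  cut spaces of \<open>S\<close> and \<open>U\<close> equal in dimension at each cut;
  \<open>U\<close> is a permutation of the basis because its cut spaces are then spanned by basis
  vectors. The index itself is computed from a parametrix whose finite-dimensional data do not
  change under small perturbations, which gives stability and the dimension count together.\<close>

notation ell2_apply (infixl "$." 90)

lemmas ell2_simps = zero_ell2.rep_eq plus_ell2.rep_eq minus_ell2.rep_eq uminus_ell2.rep_eq
  scaleR_ell2.rep_eq scaleC.rep_eq

section \<open>Completeness of the space of square-summable functions\<close>

lemma ell2_apply_le_norm: "cmod (x $. i) \<le> norm x"
proof -
  have "(cmod (x $. i))\<^sup>2 \<le> (norm x)\<^sup>2"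
    using ell2_sum_le_norm[of "{i}" x] by simp
  then show ?thesis by (rule power2_le_imp_le) simp
qed

lemma ell2_of_bounded_sums:
  assumes "\<And>F. finite F \<Longrightarrow> (\<Sum>i\<in>F. (cmod (f i))\<^sup>2) \<le> C\<^sup>2" "0 \<le> C"
  obtains x where "\<And>i. x $. i = f i" "norm x \<le> C"
proof -
  have s: "(\<lambda>i. (cmod (f i))\<^sup>2) summable_on UNIV"
    by (rule nonneg_bdd_above_summable_on) (auto intro!: bdd_aboveI2 assms)
  have app: "Abs_ell2 f $. i = f i" for i
    using s by (simp add: Abs_ell2_inverse)
  have "(norm (Abs_ell2 f))\<^sup>2 \<le> C\<^sup>2"
    unfolding norm_ell2_sq app by (rule infsum_le_finite_sums[OF s assms(1)])
  then have "norm (Abs_ell2 f) \<le> C"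
    by (rule power2_le_imp_le) (rule assms(2))
  then show ?thesis using that app by blast
qed

text \<open>Completeness is what the contraction principle behind the perturbation lemma and the
  summation of the diagonals of a local operator rest on. Coordinatewise limits exist, and passing
  to the limit in finite sums shows that the convergence is in norm.\<close>

instance ell2 :: (type) banach
proof
  fix X :: "nat \<Rightarrow> 'a ell2" assume X: "Cauchy X"
  have "Cauchy (\<lambda>n. X n $. i)" for i
  proof (rule metric_CauchyI)
    fix e :: real assume "0 < e"
    then obtain M where "\<And>m n. m \<ge> M \<Longrightarrow> n \<ge> M \<Longrightarrow> dist (X m) (X n) < e"
      using X unfolding Cauchy_def by metis
    moreover have "dist (X m $. i) (X n $. i) \<le> dist (X m) (X n)" for m n
      using ell2_apply_le_norm[of "X m - X n" i] by (simp add: dist_norm ell2_simps)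
    ultimately show "\<exists>M. \<forall>m\<ge>M. \<forall>n\<ge>M. dist (X m $. i) (X n $. i) < e"
      by (meson le_less_trans)
  qed
  then obtain f where f: "\<And>i. (\<lambda>n. X n $. i) \<longlonglongrightarrow> f i"
    unfolding Cauchy_convergent_iff convergent_def by metis
  have tail: "\<exists>y. (\<forall>i. y $. i = f i - X n $. i) \<and> norm y \<le> e"
    if "0 < e" and N: "\<And>m. m \<ge> n \<Longrightarrow> dist (X m) (X n) < e" for e n
  proof -
    have "(\<Sum>i\<in>F. (cmod (f i - X n $. i))\<^sup>2) \<le> e\<^sup>2" if "finite F" for F
    proof (rule LIMSEQ_le_const2)
      show "(\<lambda>m. \<Sum>i\<in>F. (cmod (X m $. i - X n $. i))\<^sup>2) \<longlonglongrightarrow> (\<Sum>i\<in>F. (cmod (f i - X n $. i))\<^sup>2)"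
        by (intro tendsto_intros f)
      have "(\<Sum>i\<in>F. (cmod (X m $. i - X n $. i))\<^sup>2) \<le> e\<^sup>2" if "m \<ge> n" for m
      proof -
        have "(\<Sum>i\<in>F. (cmod (X m $. i - X n $. i))\<^sup>2) \<le> (norm (X m - X n))\<^sup>2"
          using ell2_sum_le_norm[OF \<open>finite F\<close>, of "X m - X n"] by (simp add: ell2_simps)
        also have "\<dots> \<le> e\<^sup>2"
          using N[OF that] by (intro power_mono) (auto simp: dist_norm)
        finally show ?thesis .
      qed
      then show "\<exists>N. \<forall>m\<ge>N. (\<Sum>i\<in>F. (cmod (X m $. i - X n $. i))\<^sup>2) \<le> e\<^sup>2" by blast
    qed
    then show ?thesis
      using ell2_of_bounded_sums[of "\<lambda>i. f i - X n $. i" e] \<open>0 < e\<close> by (metis less_imp_le)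
  qed
  obtain n1 where "\<And>m. m \<ge> n1 \<Longrightarrow> dist (X m) (X n1) < 1"
    using X unfolding Cauchy_def by (metis le_refl zero_less_one)
  \<comment> \<open>Only the differences \<open>f - X n\<close> are known to be square summable at
    this point; the limit is recovered by adding \<open>X n1\<close> back.\<close>
  from tail[OF _ this] obtain y1 where "\<And>i. y1 $. i = f i - X n1 $. i" by auto
  then have L: "(X n1 + y1) $. i = f i" for i by (simp add: ell2_simps)
  have "X \<longlonglongrightarrow> X n1 + y1"
  proof (rule metric_LIMSEQ_I)
    fix e :: real assume "0 < e"
    then obtain M where M: "\<And>m n. m \<ge> M \<Longrightarrow> n \<ge> M \<Longrightarrow> dist (X m) (X n) < e / 2"
      using X unfolding Cauchy_def by (metis half_gt_zero)
    have "dist (X n) (X n1 + y1) < e" if "n \<ge> M" for n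
    proof -
      have "dist (X m) (X n) < e / 2" if "m \<ge> n" for m
        using M \<open>n \<ge> M\<close> that le_trans by blast
      from tail[OF half_gt_zero[OF \<open>0 < e\<close>] this]
      obtain y where y: "\<And>i. y $. i = f i - X n $. i" "norm y \<le> e / 2" by blast
      have "y = (X n1 + y1) - X n"
        by (rule ell2_eqI) (simp add: y minus_ell2.rep_eq L)
      then show ?thesis using y(2) \<open>0 < e\<close> by (simp add: dist_norm norm_minus_commute)
    qed
    then show "\<exists>M. \<forall>n\<ge>M. dist (X n) (X n1 + y1) < e" by blast
  qed
  then show "convergent X" by (auto simp: convergent_def)
qed

subsection \<open>Complex-linear operators and adjoints\<close>

lemma clinear_opD: "clinear_op A \<Longrightarrow> A (c *\<^sub>C x) = c *\<^sub>C A x"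
  by (simp add: clinear_op_def)

lemma scaleC_minus_right: "c *\<^sub>C (x - y) = c *\<^sub>C x - c *\<^sub>C (y :: 'i ell2)"
  by (rule ell2_eqI) (simp add: ell2_simps algebra_simps)

lemma scaleC_scaleR: "c *\<^sub>C (r *\<^sub>R x) = r *\<^sub>R (c *\<^sub>C (x :: 'i ell2))"
  by (rule ell2_eqI) (simp add: ell2_simps algebra_simps)

lemma clinear_op_intros [intro, simp]:
  "clinear_op 0" "clinear_op id_blinfun"
  "clinear_op A \<Longrightarrow> clinear_op B \<Longrightarrow> clinear_op (A + B)"
  "clinear_op A \<Longrightarrow> clinear_op B \<Longrightarrow> clinear_op (A - B)"
  "clinear_op A \<Longrightarrow> clinear_op (- A)"
  "clinear_op A \<Longrightarrow> clinear_op (r *\<^sub>R A)"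
  "clinear_op A \<Longrightarrow> clinear_op D \<Longrightarrow> clinear_op (D o\<^sub>L A)"
  by (simp_all add: clinear_op_def blinfun.add_left blinfun.diff_left blinfun.minus_left
      blinfun.scaleR_left ell2.scale_right_distrib scaleC_minus_right scaleC_scaleR)

lemma clinear_op_sum [intro]: "(\<And>i. i \<in> F \<Longrightarrow> clinear_op (A i)) \<Longrightarrow> clinear_op (sum A F)"
  by (induction F rule: infinite_finite_induct) auto

lemma clinear_op_ext:
  assumes "clinear_op A" "clinear_op B" "\<And>i. A (ket i) = B (ket i)"
  shows "A = B"
proof (rule blinfun_eqI)
  fix x
  have h: "((\<lambda>i. A (x $. i *\<^sub>C ket i)) has_sum A x) UNIV"
    "((\<lambda>i. B (x $. i *\<^sub>C ket i)) has_sum B x) UNIV"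
    using has_sum_bounded_linear[OF blinfun.bounded_linear_right ket_has_sum] by (auto simp: o_def)
  show "A x = B x"
    using has_sum_unique[OF h(1)] h(2) by (simp add: clinear_opD assms)
qed

lemma cinner_minus_right: "cinner x (- y) = - cinner x y"
  unfolding cinner_def by (simp add: ell2_simps infsum_uminus)

lemma cinner_diff_right: "cinner x (y - z) = cinner x y - cinner x z"
  using cinner_add_right[of x y "- z"] by (simp add: cinner_minus_right)

lemma cinner_diff_left: "cinner (y - z) x = cinner y x - cinner z x"
  by (metis cinner_commute cinner_diff_right complex_cnj_diff)

lemma cinner_zero_left [simp]: "cinner 0 x = 0"
  by (metis cinner_commute cinner_zero_right complex_cnj_zero)

lemma cinner_ext: "(\<And>y. cinner x y = cinner x' y) \<Longrightarrow> x = x'"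
  by (rule ell2_eqI) (metis cinner_ket_right complex_cnj_cancel_iff)

lemma cinner_self_eq_0 [simp]: "cinner x x = 0 \<longleftrightarrow> x = 0"
  by (simp add: cinner_self_norm)

lemma cinner_cadjoint':
  assumes "clinear_op A"
  shows "cinner x (cadjoint A y) = cinner (A x) y"
  using cinner_cadjoint[OF assms, of y x] by (metis cinner_commute)

lemma clinear_cadjoint [simp]:
  assumes "clinear_op A"
  shows "clinear_op (cadjoint A)"
  unfolding clinear_op_def
  by (intro allI cinner_ext) (simp add: cinner_cadjoint[OF assms] cinner_scaleC_left)

lemma cadjoint_diff:
  "clinear_op A \<Longrightarrow> clinear_op B \<Longrightarrow> cadjoint (A - B) = cadjoint A - cadjoint B"
  by (rule cadjoint_unique) (simp add: cinner_cadjoint blinfun.diff_left cinner_diff_left cinner_diff_right)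

lemma norm_cadjoint_le:
  assumes "clinear_op A"
  shows "norm (cadjoint A) \<le> norm A"
proof (rule norm_blinfun_bound)
  fix x
  have "cmod (cinner (cadjoint A x) (cadjoint A x)) \<le> norm x * norm (A (cadjoint A x))"
    unfolding cinner_cadjoint[OF assms] by (rule cinner_Cauchy_Schwarz)
  also have "\<dots> \<le> norm x * (norm A * norm (cadjoint A x))"
    by (intro mult_left_mono norm_blinfun) simp
  finally have "norm (cadjoint A x) * norm (cadjoint A x) \<le> (norm A * norm x) * norm (cadjoint A x)"
    by (simp add: cinner_self_norm power2_eq_square mult_ac norm_mult)
  then show "norm (cadjoint A x) \<le> norm A * norm x"
    by (cases "norm (cadjoint A x) = 0") (auto simp: mult_le_cancel_right)
qed simp

subsection \<open>Invertible operators\<close>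

text \<open>Pointwise equations let compositions cancel by simplification. Complex linearity of both
  operators is included because the type contains all real-linear bounded maps.\<close>

definition op_inverse :: "('i ell2 \<Rightarrow>\<^sub>L 'i ell2) \<Rightarrow> ('i ell2 \<Rightarrow>\<^sub>L 'i ell2) \<Rightarrow> bool" where
  "op_inverse A B \<longleftrightarrow> clinear_op A \<and> clinear_op B \<and> (\<forall>x. A (B x) = x) \<and> (\<forall>x. B (A x) = x)"

definition invertible_op :: "('i ell2 \<Rightarrow>\<^sub>L 'i ell2) \<Rightarrow> bool" where
  "invertible_op A \<longleftrightarrow> (\<exists>B. op_inverse A B)"

lemma op_inverse_sym: "op_inverse A B \<Longrightarrow> op_inverse B A"
  by (auto simp: op_inverse_def)

lemma op_inverse_comp: "op_inverse A B \<Longrightarrow> op_inverse A' B' \<Longrightarrow> op_inverse (A o\<^sub>L A') (B' o\<^sub>L B)"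
  by (auto simp: op_inverse_def)

lemma invertible_op_comp: "invertible_op A \<Longrightarrow> invertible_op B \<Longrightarrow> invertible_op (A o\<^sub>L B)"
  unfolding invertible_op_def by (meson op_inverse_comp)

lemma op_inverse_id: "op_inverse id_blinfun id_blinfun"
  by (simp add: op_inverse_def)

lemma invertible_op_clinear [dest]: "invertible_op A \<Longrightarrow> clinear_op A"
  by (auto simp: invertible_op_def op_inverse_def)

lemma op_inverse_nonzero: "op_inverse A B \<Longrightarrow> A \<noteq> 0 \<and> B \<noteq> (0 :: 'i ell2 \<Rightarrow>\<^sub>L 'i ell2)"
proof -
  assume inv: "op_inverse A B"
  have "ket undefined $. undefined \<noteq> (0 :: 'i ell2) $. undefined"
    by (simp add: ket.rep_eq zero_ell2.rep_eq)
  then have "ket undefined \<noteq> (0 :: 'i ell2)" by metis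
  then show ?thesis using inv by (metis op_inverse_def zero_blinfun.rep_eq blinfun.zero_right)
qed

lemma op_inverse_lower_bound:
  assumes "op_inverse A B"
  shows "norm x \<le> norm B * norm (A x)"
  using norm_blinfun[of B "A x"] assms by (simp add: op_inverse_def)

text \<open>The lower bound gives injectivity and the bound on the inverse at once. Keeping
  \<open>C\<close> explicit is what later bounds the window inverses uniformly in the cut.\<close>

lemma op_inverse_of_bounded_below:
  assumes "clinear_op A" and C: "\<And>x. norm x \<le> C * norm (A x)" and surj: "\<And>y. \<exists>x. A x = y"
  obtains B where "op_inverse A B" "\<And>x. norm (B x) \<le> C * norm x"
proof -
  have inj: "x = y" if "A x = A y" for x y
    using C[of "x - y"] that by (simp add: blinfun.diff_right)
  define g where "g = inv (blinfun_apply A)"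
  have Ag: "A (g y) = y" for y
    unfolding g_def by (metis surj surj_f_inv_f surjI)
  have "bounded_linear g"
  proof (rule bounded_linear_intro)
    show "g (x + y) = g x + g y" for x y by (rule inj) (simp add: Ag blinfun.add_right)
    show "g (r *\<^sub>R x) = r *\<^sub>R g x" for r x by (rule inj) (simp add: Ag blinfun.scaleR_right)
    show "norm (g x) \<le> norm x * C" for x using C[of "g x"] by (simp add: Ag mult.commute)
  qed
  then have B: "blinfun_apply (Blinfun g) = g" by (rule bounded_linear_Blinfun_apply)
  have gC: "g (c *\<^sub>C x) = c *\<^sub>C g x" for c x
    by (rule inj) (simp add: Ag clinear_opD[OF assms(1)])
  have gA: "g (A x) = x" for x by (rule inj) (simp add: Ag)
  show ?thesis
  proof (rule that)
    show "op_inverse A (Blinfun g)"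
      using assms(1) by (auto simp: op_inverse_def B Ag gA clinear_op_def gC)
    show "norm (Blinfun g x) \<le> C * norm x" for x using C[of "g x"] by (simp add: B Ag)
  qed
qed

text \<open>\<open>A' B\<close> is \<open>1 + (A' - A) B\<close>, a perturbation of the identity by
  a contraction. It is bounded below by the triangle inequality and onto by the Banach fixed point
  theorem; composing with \<open>A\<close> on the right returns \<open>A'\<close>.\<close>

lemma op_inverse_perturb:
  assumes inv: "op_inverse A B" and "clinear_op A'" and small: "norm (A' - A) * norm B < 1"
  shows "invertible_op A'"
proof -
  define q where "q = norm (A' - A) * norm B"
  have q: "0 \<le> q" "q < 1" using small by (auto simp: q_def)
  have X: "norm ((A' - A) (B x)) \<le> q * norm x" for x
  proof -
    have "norm ((A' - A) (B x)) \<le> norm (A' - A) * norm (B x)" by (rule norm_blinfun)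
    also have "\<dots> \<le> norm (A' - A) * (norm B * norm x)" by (intro mult_left_mono norm_blinfun) simp
    finally show ?thesis by (simp add: q_def mult_ac)
  qed
  have AB: "A' (B x) = x + (A' - A) (B x)" for x
    using inv by (simp add: op_inverse_def blinfun.diff_left)
  have lower: "norm x \<le> (1 / (1 - q)) * norm (A' (B x))" for x
  proof -
    have "norm x \<le> norm (A' (B x)) + q * norm x"
      using norm_triangle_ineq4[of "A' (B x)" "(A' - A) (B x)"] X[of x] by (simp add: AB)
    then show ?thesis using q by (simp add: field_simps)
  qed
  have surj: "\<exists>x. A' (B x) = y" for y
  proof -
    have "\<exists>!x. y - (A' - A) (B x) = x"
    proof (rule banach_fix_type[OF q])
      have "dist (y - (A' - A) (B x)) (y - (A' - A) (B z)) = norm ((A' - A) (B (z - x)))" for x z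
        by (simp add: dist_norm blinfun.diff_right)
      then show "\<forall>x z. dist (y - (A' - A) (B x)) (y - (A' - A) (B z)) \<le> q * dist x z"
        using X by (metis dist_commute dist_norm)
    qed
    then obtain x where "y - (A' - A) (B x) = x" by auto
    then show ?thesis by (metis AB diff_add_cancel add.commute)
  qed
  have "clinear_op (A' o\<^sub>L B)" using inv assms(2) by (auto simp: op_inverse_def)
  obtain G where "op_inverse (A' o\<^sub>L B) G"
    by (rule op_inverse_of_bounded_below[OF \<open>clinear_op (A' o\<^sub>L B)\<close>, of "1 / (1 - q)"])
      (use lower surj in auto)
  from op_inverse_comp[OF this inv]
  have "op_inverse ((A' o\<^sub>L B) o\<^sub>L A) (B o\<^sub>L G)" .
  moreover have "(A' o\<^sub>L B) o\<^sub>L A = A'"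
    using inv by (auto intro!: blinfun_eqI simp: op_inverse_def)
  ultimately show ?thesis by (auto simp: invertible_op_def)
qed

lemma op_inverse_unipotent:
  assumes "clinear_op X" "X o\<^sub>L X = 0"
  shows "op_inverse (id_blinfun + X) (id_blinfun - X)"
proof -
  have "X (X x) = 0" for x using assms(2) by (metis blinfun_apply_blinfun_compose zero_blinfun.rep_eq)
  then show ?thesis using assms(1)
    by (auto simp: op_inverse_def blinfun.add_left blinfun.diff_left blinfun.add_right blinfun.diff_right)
qed

subsection \<open>Operators given by their components\<close>

lemma norm_ell2_le_of_sums:
  assumes "\<And>F. finite F \<Longrightarrow> (\<Sum>i\<in>F. (cmod (x $. i))\<^sup>2) \<le> C\<^sup>2" "0 \<le> C"
  shows "norm x \<le> C"
proof -
  have "(norm x)\<^sup>2 \<le> C\<^sup>2"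
    unfolding norm_ell2_sq by (rule infsum_le_finite_sums[OF ell2_summable assms(1)])
  then show ?thesis by (rule power2_le_imp_le) (rule assms(2))
qed

lemma operator_from_components:
  fixes T :: "'i ell2 \<Rightarrow> 'j \<Rightarrow> complex"
  assumes add: "\<And>x y i. T (x + y) i = T x i + T y i"
    and scale: "\<And>c x i. T (c *\<^sub>C x) i = c * T x i"
    and bound: "\<And>x F. finite F \<Longrightarrow> (\<Sum>i\<in>F. (cmod (T x i))\<^sup>2) \<le> (K * norm x)\<^sup>2" and "0 \<le> K"
  obtains A where "clinear_op A" "\<And>x i. A x $. i = T x i" "norm A \<le> K"
proof
  define A where "A = Blinfun (\<lambda>x. Abs_ell2 (T x))"
  show app: "A x $. i = T x i" for x i
    unfolding A_def
    by (rule ell2_apply_Blinfun[where K = K]) (use assms in \<open>auto simp: scaleR_eq_scaleC\<close>)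
  show "clinear_op A"
    unfolding clinear_op_def by (intro allI ell2_eqI) (simp add: app scale ell2_simps)
  show "norm A \<le> K"
    by (intro norm_blinfun_bound norm_ell2_le_of_sums)
      (use bound \<open>0 \<le> K\<close> in \<open>auto simp: app\<close>)
qed

text \<open>Weighted partial permutations of the basis. Asking for injectivity only where the weight
  is nonzero covers row operations, permutations and single diagonals with one construction.\<close>

lemma weighted_pull:
  fixes f :: "'i \<Rightarrow> 'j"
  assumes inj: "inj_on f {i. a i \<noteq> 0}" and M: "\<And>i. cmod (a i) \<le> M"
  obtains A where "clinear_op A" "\<And>x i. A x $. i = a i * x $. f i" "norm A \<le> M"
proof (rule operator_from_components[of "\<lambda>x i. a i * x $. f i" M])
  show "0 \<le> M" using M[of undefined] norm_ge_zero order_trans by blast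
  fix x and F :: "'i set" assume "finite F"
  have "(\<Sum>i\<in>F. (cmod (a i * x $. f i))\<^sup>2) = (\<Sum>i\<in>F \<inter> {i. a i \<noteq> 0}. (cmod (a i * x $. f i))\<^sup>2)"
    using \<open>finite F\<close> by (intro sum.mono_neutral_right) auto
  also have "\<dots> \<le> (\<Sum>i\<in>F \<inter> {i. a i \<noteq> 0}. M\<^sup>2 * (cmod (x $. f i))\<^sup>2)"
    unfolding norm_mult power_mult_distrib
    by (intro sum_mono mult_right_mono power_mono M) auto
  also have "\<dots> = M\<^sup>2 * (\<Sum>j\<in>f ` (F \<inter> {i. a i \<noteq> 0}). (cmod (x $. j))\<^sup>2)"
    by (subst sum.reindex) (auto intro: inj_on_subset[OF inj] simp: sum_distrib_left)
  also have "\<dots> \<le> M\<^sup>2 * (norm x)\<^sup>2"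
    using \<open>finite F\<close> by (intro mult_left_mono ell2_sum_le_norm) auto
  finally show "(\<Sum>i\<in>F. (cmod (a i * x $. f i))\<^sup>2) \<le> (M * norm x)\<^sup>2"
    by (simp add: power_mult_distrib)
qed (auto simp: ell2_simps algebra_simps)

section \<open>Coordinate projections and decompositions into blocks\<close>

definition proj :: "'i set \<Rightarrow> ('i ell2 \<Rightarrow>\<^sub>L 'i ell2)" where
  "proj X = diag_op (\<lambda>i. if i \<in> X then 1 else 0)"

lemma proj_apply [simp]: "proj X x $. i = (if i \<in> X then x $. i else 0)"
proof -
  have "bounded (range (\<lambda>i. if i \<in> X then 1 else 0 :: complex))"
    by (rule boundedI[where B = 1]) auto
  then show ?thesis by (simp add: proj_def ell2_apply_diag_op)
qed

lemma clinear_proj [simp, intro]: "clinear_op (proj X)"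
  unfolding clinear_op_def by (intro allI ell2_eqI) (simp add: ell2_simps)

lemma norm_ell2_mono:
  assumes "\<And>i. cmod (x $. i) \<le> cmod (y $. i)"
  shows "norm x \<le> norm y"
proof (rule norm_ell2_le_of_sums)
  fix F :: "'a set" assume "finite F"
  have "(\<Sum>i\<in>F. (cmod (x $. i))\<^sup>2) \<le> (\<Sum>i\<in>F. (cmod (y $. i))\<^sup>2)"
    by (intro sum_mono power_mono assms) simp
  also have "\<dots> \<le> (norm y)\<^sup>2" using \<open>finite F\<close> by (rule ell2_sum_le_norm)
  finally show "(\<Sum>i\<in>F. (cmod (x $. i))\<^sup>2) \<le> (norm y)\<^sup>2" .
qed simp

lemma norm_proj_le: "norm (proj X x) \<le> norm x"
  by (rule norm_ell2_mono) simp

lemma norm_proj_le_1: "norm (proj X) \<le> 1"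
  by (rule norm_blinfun_bound) (simp_all add: norm_proj_le)

lemma norm_proj_mono: "X \<subseteq> Y \<Longrightarrow> norm (proj X x) \<le> norm (proj Y x)"
  by (rule norm_ell2_mono) auto

lemma proj_proj [simp]: "proj X (proj Y x) = proj (X \<inter> Y) x"
  by (rule ell2_eqI) auto

lemma proj_compl_add: "proj X x + proj (- X) x = x"
  by (rule ell2_eqI) (simp add: ell2_simps)

lemma proj_eq_self_iff: "proj X x = x \<longleftrightarrow> (\<forall>i. i \<notin> X \<longrightarrow> x $. i = 0)"
  by (metis (full_types) ell2_eqI proj_apply)

lemma proj_eq_0_iff: "proj X x = 0 \<longleftrightarrow> (\<forall>i\<in>X. x $. i = 0)"
proof
  assume "proj X x = 0"
  then have "proj X x $. i = 0" for i by (simp add: zero_ell2.rep_eq)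
  then show "\<forall>i\<in>X. x $. i = 0" by simp (metis)
qed (auto intro!: ell2_eqI simp: zero_ell2.rep_eq)

lemma norm_proj_disjoint_union:
  assumes "X \<inter> Y = {}"
  shows "(norm (proj (X \<union> Y) x))\<^sup>2 = (norm (proj X x))\<^sup>2 + (norm (proj Y x))\<^sup>2"
proof -
  have "(norm (proj X x))\<^sup>2 + (norm (proj Y x))\<^sup>2
      = (\<Sum>\<^sub>\<infinity>i. (cmod (proj X x $. i))\<^sup>2 + (cmod (proj Y x $. i))\<^sup>2)"
    unfolding norm_ell2_sq by (rule infsum_add[symmetric]) (rule ell2_summable)+
  also have "\<dots> = (\<Sum>\<^sub>\<infinity>i. (cmod (proj (X \<union> Y) x $. i))\<^sup>2)"
    using assms by (intro infsum_cong) auto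
  finally show ?thesis by (simp only: norm_ell2_sq)
qed

lemma sum_norm_blocks_le:
  assumes "finite K"
  shows "(\<Sum>k\<in>K. (norm (proj (b -` {k}) x))\<^sup>2) \<le> (norm x)\<^sup>2"
proof -
  have "(\<Sum>k\<in>K. (norm (proj (b -` {k}) x))\<^sup>2) = (norm (proj (b -` K) x))\<^sup>2"
    using assms
  proof (induction K)
    case (insert k K)
    have "b -` insert k K = b -` {k} \<union> b -` K" by auto
    moreover have "b -` {k} \<inter> b -` K = {}" using insert by auto
    ultimately show ?case using insert by (simp add: norm_proj_disjoint_union)
  next
    case empty
    have "proj {} x = 0" by (rule ell2_eqI) (simp add: zero_ell2.rep_eq)
    then show ?case by simp
  qed
  then show ?thesis by (simp add: norm_proj_le)
qed

text \<open>Each map in \<open>T\<close> is injective, so as \<open>k\<close> varies the blocks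
  numbered by its values are distinct and their squared norms add up to at most that of
  \<open>x\<close>; summing over \<open>T\<close> costs the factor \<open>card T\<close>. The
  identity alone serves direct sums of blocks, the two neighbour maps serve operators coupling
  adjacent blocks.\<close>

lemma ell2_glue_sums:
  fixes b :: "'i \<Rightarrow> 'k"
  assumes T: "finite T" "\<And>\<tau>. \<tau> \<in> T \<Longrightarrow> inj \<tau>"
    and z: "\<And>k. (norm (z k))\<^sup>2 \<le> C\<^sup>2 * (\<Sum>\<tau>\<in>T. (norm (proj (b -` {\<tau> k}) x))\<^sup>2)" and F: "finite F"
  shows "(\<Sum>i\<in>F. (cmod (z (b i) $. i))\<^sup>2) \<le> (sqrt (card T) * C * norm x)\<^sup>2"
proof -
  have "(\<Sum>i\<in>F. (cmod (z (b i) $. i))\<^sup>2) = (\<Sum>k\<in>b ` F. \<Sum>i\<in>{i\<in>F. b i = k}. (cmod (z (b i) $. i))\<^sup>2)"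
    using F by (rule sum.image_gen)
  also have "\<dots> \<le> (\<Sum>k\<in>b ` F. (norm (z k))\<^sup>2)"
  proof (rule sum_mono)
    fix k
    show "(\<Sum>i\<in>{i\<in>F. b i = k}. (cmod (z (b i) $. i))\<^sup>2) \<le> (norm (z k))\<^sup>2"
      using ell2_sum_le_norm[of "{i\<in>F. b i = k}" "z k"] F by simp
  qed
  also have "\<dots> \<le> (\<Sum>k\<in>b ` F. C\<^sup>2 * (\<Sum>\<tau>\<in>T. (norm (proj (b -` {\<tau> k}) x))\<^sup>2))"
    by (rule sum_mono) (rule z)
  also have "\<dots> = C\<^sup>2 * (\<Sum>\<tau>\<in>T. \<Sum>k\<in>b ` F. (norm (proj (b -` {\<tau> k}) x))\<^sup>2)"
    by (subst sum.swap) (simp add: sum_distrib_left)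
  also have "\<dots> \<le> C\<^sup>2 * (\<Sum>\<tau>\<in>T. (norm x)\<^sup>2)"
  proof (intro mult_left_mono sum_mono)
    fix \<tau> assume "\<tau> \<in> T"
    then have "(\<Sum>k\<in>b ` F. (norm (proj (b -` {\<tau> k}) x))\<^sup>2) = (\<Sum>k\<in>\<tau> ` b ` F. (norm (proj (b -` {k}) x))\<^sup>2)"
      using T(2) by (subst sum.reindex) (auto intro: inj_on_subset)
    also have "\<dots> \<le> (norm x)\<^sup>2" using F by (intro sum_norm_blocks_le) simp
    finally show "(\<Sum>k\<in>b ` F. (norm (proj (b -` {\<tau> k}) x))\<^sup>2) \<le> (norm x)\<^sup>2" .
  qed simp
  also have "\<dots> = (sqrt (card T) * C * norm x)\<^sup>2"
    by (simp add: power_mult_distrib)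
  finally show ?thesis .
qed

lemma ell2_glue:
  fixes b :: "'i \<Rightarrow> 'k"
  assumes z: "\<And>k. norm (z k) \<le> C * norm (proj (b -` {k}) x)" and "0 \<le> C"
  obtains y where "\<And>i. y $. i = z (b i) $. i" "norm y \<le> C * norm x"
proof -
  have "(norm (z k))\<^sup>2 \<le> C\<^sup>2 * (\<Sum>\<tau>\<in>{id}. (norm (proj (b -` {\<tau> k}) x))\<^sup>2)" for k
    using power_mono[OF z[of k], of 2] by (simp add: power_mult_distrib)
  from ell2_glue_sums[OF _ _ this]
  have "(\<Sum>i\<in>F. (cmod (z (b i) $. i))\<^sup>2) \<le> (C * norm x)\<^sup>2" if "finite F" for F
    using that by force
  then show ?thesis
    by (rule ell2_of_bounded_sums[of "\<lambda>i. z (b i) $. i" "C * norm x"])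
      (use that \<open>0 \<le> C\<close> in auto)
qed

lemma norm_le_of_blocks:
  assumes "finite T" "\<And>\<tau>. \<tau> \<in> T \<Longrightarrow> inj \<tau>"
    "\<And>k. (norm (proj (b -` {k}) y))\<^sup>2 \<le> C\<^sup>2 * (\<Sum>\<tau>\<in>T. (norm (proj (b -` {\<tau> k}) x))\<^sup>2)" "0 \<le> C"
  shows "norm y \<le> sqrt (card T) * C * norm x"
proof (rule norm_ell2_le_of_sums)
  show "(\<Sum>i\<in>F. (cmod (y $. i))\<^sup>2) \<le> (sqrt (card T) * C * norm x)\<^sup>2" if "finite F" for F
    using ell2_glue_sums[where z = "\<lambda>k. proj (b -` {k}) y" and b = b, OF assms(1-3) that] by simp
qed (use \<open>0 \<le> C\<close> in simp)

subsection \<open>Locality\<close>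

text \<open>\<open>\<rho> i j\<close> marks the positions where a matrix entry may be nonzero.
  Phrasing this through vanishing inputs turns composition of operators into composition of
  relations; block diagonal and banded operators are special cases.\<close>

definition local_in :: "('i \<Rightarrow> 'j \<Rightarrow> bool) \<Rightarrow> ('j ell2 \<Rightarrow>\<^sub>L 'i ell2) \<Rightarrow> bool" where
  "local_in \<rho> A \<longleftrightarrow> (\<forall>x i. (\<forall>j. \<rho> i j \<longrightarrow> x $. j = 0) \<longrightarrow> A x $. i = 0)"

lemma local_inD: "local_in \<rho> A \<Longrightarrow> (\<And>j. \<rho> i j \<Longrightarrow> x $. j = 0) \<Longrightarrow> A x $. i = 0"
  by (auto simp: local_in_def)

lemma local_in_cong:
  assumes "local_in \<rho> A" "\<And>j. \<rho> i j \<Longrightarrow> x $. j = y $. j"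
  shows "A x $. i = A y $. i"
proof -
  have "A (x - y) $. i = 0"
    by (rule local_inD[OF assms(1)]) (simp add: minus_ell2.rep_eq assms(2))
  then show ?thesis by (simp add: minus_ell2.rep_eq blinfun.diff_right)
qed

lemma local_in_mono: "local_in \<rho> A \<Longrightarrow> (\<And>i j. \<rho> i j \<Longrightarrow> \<sigma> i j) \<Longrightarrow> local_in \<sigma> A"
  by (auto simp: local_in_def)

lemma local_in_comp:
  assumes "local_in \<rho> A" "local_in \<sigma> B" "\<And>i j k. \<rho> i j \<Longrightarrow> \<sigma> j k \<Longrightarrow> \<tau> i k"
  shows "local_in \<tau> (A o\<^sub>L B)"
  unfolding local_in_def
proof (intro allI impI)
  fix x i assume "\<forall>k. \<tau> i k \<longrightarrow> x $. k = 0"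
  then have "B x $. j = 0" if "\<rho> i j" for j
    using local_inD[OF assms(2)] assms(3) that by blast
  then show "(A o\<^sub>L B) x $. i = 0" using local_inD[OF assms(1)] by simp
qed

lemma local_in_linear:
  "local_in \<rho> 0"
  "local_in \<rho> A \<Longrightarrow> local_in \<rho> B \<Longrightarrow> local_in \<rho> (A + B)"
  "local_in \<rho> A \<Longrightarrow> local_in \<rho> B \<Longrightarrow> local_in \<rho> (A - B)"
  "local_in \<rho> A \<Longrightarrow> local_in \<rho> (r *\<^sub>R A)"
  by (auto simp: local_in_def ell2_simps blinfun.add_left blinfun.diff_left blinfun.scaleR_left)

lemma local_in_sum: "(\<And>i. i \<in> F \<Longrightarrow> local_in \<rho> (A i)) \<Longrightarrow> local_in \<rho> (sum A F)"
  by (induction F rule: infinite_finite_induct) (auto simp: local_in_linear)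

lemma local_in_id: "(\<And>i. \<rho> i i) \<Longrightarrow> local_in \<rho> id_blinfun"
  by (auto simp: local_in_def)

lemma local_in_proj: "(\<And>i. i \<in> X \<Longrightarrow> \<rho> i i) \<Longrightarrow> local_in \<rho> (proj X)"
  by (auto simp: local_in_def)

lemma local_in_cadjoint:
  assumes "local_in \<rho> A" "clinear_op A"
  shows "local_in (\<lambda>i j. \<rho> j i) (cadjoint A)"
  unfolding local_in_def
proof (intro allI impI)
  fix x i assume x: "\<forall>j. \<rho> j i \<longrightarrow> x $. j = 0"
  have A0: "A (ket i) $. j = 0" if "\<not> \<rho> j i" for j
    by (rule local_inD[OF assms(1)]) (use that in \<open>auto simp: ket.rep_eq\<close>)
  have "cinner (A (ket i)) x = 0"
    unfolding cinner_def
  proof (rule infsum_0)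
    show "cnj (A (ket i) $. j) * x $. j = 0" for j
      using x A0 by (cases "\<rho> j i") auto
  qed
  then show "cadjoint A x $. i = 0"
    using cinner_cadjoint'[OF assms(2), of "ket i" x] by simp
qed

section \<open>Block diagonal and banded operators\<close>

definition block_diag :: "('i \<Rightarrow> 'k) \<Rightarrow> ('i ell2 \<Rightarrow>\<^sub>L 'i ell2) \<Rightarrow> bool" where
  "block_diag b A \<longleftrightarrow> local_in (\<lambda>i j. b i = b j) A"

lemma block_diag_comp: "block_diag b A \<Longrightarrow> block_diag b B \<Longrightarrow> block_diag b (A o\<^sub>L B)"
  unfolding block_diag_def by (erule (1) local_in_comp) auto

definition banded :: "int \<Rightarrow> ((int \<times> 'a) ell2 \<Rightarrow>\<^sub>L (int \<times> 'b) ell2) \<Rightarrow> bool" where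
  "banded R A \<longleftrightarrow> local_in (\<lambda>i j. \<bar>fst i - fst j\<bar> \<le> R) A"

lemma bandedD: "banded R A \<Longrightarrow> (\<And>j. \<bar>fst i - fst j\<bar> \<le> R \<Longrightarrow> x $. j = 0) \<Longrightarrow> A x $. i = 0"
  unfolding banded_def by (rule local_inD)

lemma banded_mono: "banded R A \<Longrightarrow> R \<le> R' \<Longrightarrow> banded R' A"
  unfolding banded_def by (erule local_in_mono) auto

lemma banded_comp: "banded R A \<Longrightarrow> banded R' B \<Longrightarrow> banded (R + R') (A o\<^sub>L B)"
  unfolding banded_def by (erule (1) local_in_comp) auto

lemma banded_linear:
  "banded R A \<Longrightarrow> banded R B \<Longrightarrow> banded R (A + B)"
  "banded R A \<Longrightarrow> banded R B \<Longrightarrow> banded R (A - B)"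
  "banded R A \<Longrightarrow> banded R (r *\<^sub>R A)"
  unfolding banded_def by (auto intro: local_in_linear)

lemma banded_cadjoint:
  assumes "banded R A" "clinear_op A"
  shows "banded R (cadjoint A)"
  using local_in_cadjoint[OF assms(1)[unfolded banded_def] assms(2)]
  unfolding banded_def by (rule local_in_mono) auto

text \<open>With \<open>r = 1 / \<parallel>S\<parallel>\<^sup>2\<close> the operator \<open>1 - r S\<^sup>* S\<close> is a contraction and \<open>S\<^sup>-\<^sup>1\<close> is the fixed point
  of \<open>X \<mapsto> (1 - r S\<^sup>* S) X + r S\<^sup>*\<close>; the iteration from \<open>0\<close> consists of banded operators.\<close>

lemma banded_inverse_approx:
  fixes S :: "(int \<times> 'a) ell2 \<Rightarrow>\<^sub>L (int \<times> 'a) ell2"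
  assumes inv: "op_inverse S B" and S: "banded R S" and e: "0 < e"
  obtains R' B' where "clinear_op B'" "banded R' B'" "0 \<le> R'" "norm (B - B') < e"
proof -
  note cS = inv[unfolded op_inverse_def, THEN conjunct1]
  have S0: "norm S > 0" "norm B > 0" using op_inverse_nonzero[OF inv] by auto
  define r where "r = 1 / (norm S)\<^sup>2"
  have r: "r > 0" using S0 by (simp add: r_def)
  define Z where "Z = id_blinfun - r *\<^sub>R (cadjoint S o\<^sub>L S)"
  define q where "q = 1 - r / (norm B)\<^sup>2"
  have Z2: "(norm (Z x))\<^sup>2 \<le> q * (norm x)\<^sup>2" for x
  proof -
    have Zx: "Z x = x - r *\<^sub>R cadjoint S (S x)"
      by (simp add: Z_def blinfun.diff_left blinfun.scaleR_left)
    have "inner x (cadjoint S (S x)) = (norm (S x))\<^sup>2"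
      unfolding inner_ell2_def by (simp add: cinner_cadjoint'[OF cS] cinner_self_norm)
    then have "(norm (Z x))\<^sup>2 = (norm x)\<^sup>2 - 2 * r * (norm (S x))\<^sup>2 + r\<^sup>2 * (norm (cadjoint S (S x)))\<^sup>2"
      unfolding Zx power2_norm_eq_inner
      by (simp add: inner_diff_left inner_diff_right inner_commute power2_eq_square)
    also have "\<dots> \<le> (norm x)\<^sup>2 - 2 * r * (norm (S x))\<^sup>2 + r\<^sup>2 * (norm S * norm (S x))\<^sup>2"
      using norm_cadjoint_le[OF cS]
      by (intro add_left_mono mult_left_mono power_mono order_trans[OF norm_blinfun] mult_right_mono) auto
    \<comment> \<open>By the choice of \<open>r\<close> the quadratic term is bounded by half of the
      cross term.\<close>
    also have "\<dots> = (norm x)\<^sup>2 - r * (norm (S x))\<^sup>2"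
      using S0 by (simp add: r_def power_mult_distrib power2_eq_square field_simps)
    also have "\<dots> \<le> (norm x)\<^sup>2 - r * (norm x / norm B)\<^sup>2"
    proof (intro diff_left_mono mult_left_mono power_mono)
      show "norm x / norm B \<le> norm (S x)"
        using op_inverse_lower_bound[OF inv, of x] S0 by (simp add: field_simps)
    qed (use r in auto)
    finally show ?thesis
      by (simp add: q_def power_divide algebra_simps)
  qed
  have q1: "q < 1" using r S0 by (simp add: q_def)
  \<comment> \<open>A nonzero vector exists, and on it the bound just shown forces \<open>q\<close>
    to be nonnegative.\<close>
  have q0: "0 \<le> q"
  proof -
    have "0 \<le> q * (norm (B (ket undefined)))\<^sup>2" using Z2 order_trans zero_le_power2 by blast
    moreover have "ket undefined \<noteq> (0 :: (int \<times> 'a) ell2)"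
      using ket.rep_eq[of "undefined :: int \<times> 'a"] by (metis zero_ell2.rep_eq zero_neq_one)
    then have "B (ket undefined) \<noteq> 0" using inv by (metis op_inverse_def blinfun.zero_right)
    ultimately show ?thesis by (auto simp: zero_le_mult_iff)
  qed
  have Zn: "norm Z \<le> sqrt q"
  proof (rule norm_blinfun_bound)
    fix x show "norm (Z x) \<le> sqrt q * norm x"
      using real_sqrt_le_mono[OF Z2[of x]] by (simp add: real_sqrt_mult)
  qed (simp add: q0)
  define X where "X = rec_nat 0 (\<lambda>_ Y. (Z o\<^sub>L Y) + r *\<^sub>R cadjoint S)"
  have X0: "X 0 = 0" and XS: "X (Suc j) = (Z o\<^sub>L X j) + r *\<^sub>R cadjoint S" for j
    by (simp_all add: X_def)
  have cZ: "clinear_op Z" unfolding Z_def using cS by (intro clinear_op_intros clinear_cadjoint)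
  have R0: "banded \<bar>R\<bar> S" using S by (rule banded_mono) simp
  have bZ: "banded (2 * \<bar>R\<bar>) Z"
    unfolding Z_def
    by (intro banded_linear banded_mono[OF banded_comp[OF banded_cadjoint[OF R0 cS] R0]])
      (auto simp: banded_def intro: local_in_id)
  have X: "clinear_op (X j) \<and> (\<exists>R'\<ge>0. banded R' (X j)) \<and> norm (B - X j) \<le> sqrt q ^ j * norm B" for j
  proof (induction j)
    case 0
    show ?case unfolding X0 by (auto simp: banded_def local_in_linear)
  next
    case (Suc j)
    then obtain R' where R': "0 \<le> R'" "banded R' (X j)" by blast
    have "banded (2 * \<bar>R\<bar> + R') (X (Suc j))"
      unfolding XS using R' banded_mono[OF banded_cadjoint[OF R0 cS], of "2 * \<bar>R\<bar> + R'"]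
      by (intro banded_linear banded_comp bZ) auto
    then have "\<exists>R'\<ge>0. banded R' (X (Suc j))" using R' by (intro exI[of _ "2 * \<bar>R\<bar> + R'"]) auto
    \<comment> \<open>\<open>B\<close> is fixed by the iteration since \<open>S o\<^sub>L B\<close>
      is the identity, so the error is multiplied by \<open>Z\<close> in every step.\<close>
    moreover have "B - X (Suc j) = Z o\<^sub>L (B - X j)"
      using inv
      by (intro blinfun_eqI)
        (simp add: XS Z_def op_inverse_def blinfun.diff_left blinfun.add_left blinfun.scaleR_left
          blinfun.diff_right algebra_simps)
    then have "norm (B - X (Suc j)) \<le> norm Z * norm (B - X j)"
      by (metis norm_blinfun_compose)
    then have "norm (B - X (Suc j)) \<le> sqrt q * (sqrt q ^ j * norm B)"
      using Suc Zn by (meson mult_mono norm_ge_zero order_trans real_sqrt_ge_zero q0)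
    moreover have "clinear_op (X (Suc j))"
      unfolding XS using Suc cZ cS by (intro clinear_op_intros clinear_cadjoint) auto
    ultimately show ?case by (simp add: mult.assoc)
  qed
  have "(\<lambda>j. sqrt q ^ j * norm B) \<longlonglongrightarrow> 0 * norm B"
    using q0 q1 by (intro tendsto_intros LIMSEQ_realpow_zero) (auto simp: real_sqrt_lt_1_iff)
  then have "\<forall>\<^sub>F j in sequentially. sqrt q ^ j * norm B < e"
    using e by (intro order_tendstoD(2)[where y = "0 * norm B"]) auto
  then obtain j where "sqrt q ^ j * norm B < e" by (auto simp: eventually_sequentially)
  then show ?thesis using X[of j] that by force
qed

text \<open>The substitute for bandedness of the inverse: a band approximation of width
  \<open>l\<close> has no entries between sets further than \<open>l\<close> apart, so only the
  approximation error is seen there.\<close>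

lemma banded_inverse_tail:
  fixes S :: "(int \<times> 'a) ell2 \<Rightarrow>\<^sub>L (int \<times> 'a) ell2"
  assumes inv: "op_inverse S B" and S: "banded R S" and e: "0 < e"
  obtains l where "0 \<le> l"
    "\<And>X Y x. (\<And>i j. i \<in> X \<Longrightarrow> j \<in> Y \<Longrightarrow> l < \<bar>fst i - fst j\<bar>) \<Longrightarrow> norm (proj X (B (proj Y x))) \<le> e * norm x"
proof -
  obtain l B' where B': "clinear_op B'" "banded l B'" "0 \<le> l" "norm (B - B') < e"
    using banded_inverse_approx[OF assms] .
  have "norm (proj X (B (proj Y x))) \<le> e * norm x"
    if XY: "\<And>i j. i \<in> X \<Longrightarrow> j \<in> Y \<Longrightarrow> l < \<bar>fst i - fst j\<bar>" for X Y x
  proof -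
    have "B' (proj Y x) $. i = 0" if "i \<in> X" for i
      by (rule bandedD[OF B'(2)]) (use XY[OF that] in fastforce)
    then have "proj X (B (proj Y x)) = proj X ((B - B') (proj Y x))"
      by (intro ell2_eqI) (simp add: blinfun.diff_left ell2_simps)
    also have "norm \<dots> \<le> norm (B - B') * norm (proj Y x)"
      by (rule order_trans[OF norm_proj_le norm_blinfun])
    also have "\<dots> \<le> e * norm x"
      using B'(4) e by (intro mult_mono norm_proj_le) auto
    finally show ?thesis .
  qed
  then show ?thesis using that B'(3) by blast
qed

subsection \<open>Finite-dimensional subspaces\<close>

lemma clinear_op_module_hom:
  assumes "clinear_op A"
  shows "module_hom scaleC scaleC (blinfun_apply A)"
  by unfold_locales (simp_all add: blinfun.add_right clinear_opD[OF assms])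

definition orthonormal :: "'i ell2 set \<Rightarrow> bool" where
  "orthonormal B \<longleftrightarrow> (\<forall>x\<in>B. \<forall>y\<in>B. cinner x y = (if x = y then 1 else 0))"

lemma orthonormal_mono: "orthonormal B \<Longrightarrow> C \<subseteq> B \<Longrightarrow> orthonormal C"
  unfolding orthonormal_def by blast

lemma orthonormalD: "orthonormal B \<Longrightarrow> x \<in> B \<Longrightarrow> y \<in> B \<Longrightarrow> cinner x y = (if x = y then 1 else 0)"
  by (simp add: orthonormal_def)

lemma cinner_orthonormal_sum:
  assumes "orthonormal B" "finite B" "b \<in> B"
  shows "cinner b (\<Sum>v\<in>B. u v *\<^sub>C v) = u b"
proof -
  have "cinner b (\<Sum>v\<in>B. u v *\<^sub>C v) = (\<Sum>v\<in>B. if v = b then u v else 0)"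
    unfolding cinner_sum_right
    by (intro sum.cong) (use assms in \<open>auto simp: orthonormal_def cinner_scaleC_right\<close>)
  then show ?thesis using assms by simp
qed

lemma span_orthonormal:
  assumes "orthonormal B" "finite B"
  shows "x \<in> ell2.span B \<longleftrightarrow> x = (\<Sum>v\<in>B. cinner v x *\<^sub>C v)"
proof
  assume "x \<in> ell2.span B"
  then obtain u where u: "x = (\<Sum>v\<in>B. u v *\<^sub>C v)"
    using ell2.span_finite[OF assms(2)] by auto
  have "cinner v x = u v" if "v \<in> B" for v
    unfolding u by (rule cinner_orthonormal_sum[OF assms that])
  then have "(\<Sum>v\<in>B. cinner v x *\<^sub>C v) = (\<Sum>v\<in>B. u v *\<^sub>C v)" by (intro sum.cong) auto
  then show "x = (\<Sum>v\<in>B. cinner v x *\<^sub>C v)" using u by metis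
next
  assume x: "x = (\<Sum>v\<in>B. cinner v x *\<^sub>C v)"
  show "x \<in> ell2.span B"
    by (subst x) (intro ell2.span_sum ell2.span_scale ell2.span_base)
qed

lemma span_orthonormal_sum:
  "orthonormal B \<Longrightarrow> finite B \<Longrightarrow> x \<in> ell2.span B \<Longrightarrow> (\<Sum>v\<in>B. cinner v x *\<^sub>C v) = x"
  by (rule span_orthonormal[THEN iffD1, symmetric])

lemma norm_orthonormal_sum:
  assumes "orthonormal B" "finite B"
  shows "(norm (\<Sum>v\<in>B. u v *\<^sub>C v))\<^sup>2 = (\<Sum>v\<in>B. (cmod (u v))\<^sup>2)"
proof -
  define x where "x = (\<Sum>v\<in>B. u v *\<^sub>C v)"
  have "cinner x x = (\<Sum>v\<in>B. u v * cinner x v)"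
    by (subst (2) x_def) (simp add: cinner_sum_right cinner_scaleC_right)
  also have "\<dots> = (\<Sum>v\<in>B. of_real ((cmod (u v))\<^sup>2))"
  proof (rule sum.cong)
    fix v assume "v \<in> B"
    then have "cinner x v = cnj (u v)"
      by (metis cinner_commute cinner_orthonormal_sum[OF assms] x_def)
    then show "u v * cinner x v = of_real ((cmod (u v))\<^sup>2)"
      by (simp add: complex_norm_square del: of_real_power)
  qed simp
  finally have "complex_of_real ((norm x)\<^sup>2) = of_real (\<Sum>v\<in>B. (cmod (u v))\<^sup>2)"
    by (simp add: cinner_self_norm del: of_real_power)
  then show ?thesis unfolding x_def of_real_eq_iff .
qed

lemma independent_orthonormal:
  assumes "orthonormal B" "finite B"
  shows "\<not> ell2.dependent B"
proof (rule ell2.independent_if_scalars_zero[OF assms(2)])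
  fix f x assume "(\<Sum>v\<in>B. f v *\<^sub>C v) = 0" "x \<in> B"
  then show "f x = 0" using cinner_orthonormal_sum[OF assms, of x f] by simp
qed

lemma orthonormal_norm: "orthonormal B \<Longrightarrow> b \<in> B \<Longrightarrow> norm b = 1"
proof -
  assume "orthonormal B" "b \<in> B"
  then have "cinner b b = 1" by (auto simp: orthonormal_def)
  then have "(norm b)\<^sup>2 = 1" by (metis cinner_self_norm of_real_eq_1_iff)
  then show "norm b = 1" by (simp add: power2_eq_1_iff) (use norm_ge_zero[of b] in linarith)
qed

lemma closed_span_orthonormal:
  assumes "orthonormal B" "finite B"
  shows "closed (ell2.span B)"
proof -
  have c: "continuous_on UNIV (\<lambda>x. cinner v x *\<^sub>C v)" for v :: "'a ell2"
  proof -
    have "bounded_linear (\<lambda>x. cinner v x *\<^sub>C v)"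
    proof (rule bounded_linear_intro)
      show "norm (cinner v x *\<^sub>C v) \<le> norm x * (norm v * norm v)" for x
        using mult_right_mono[OF cinner_Cauchy_Schwarz[of v x], of "norm v"]
        by (simp add: norm_scaleC mult_ac)
    qed (simp_all add: cinner_add_right cinner_scaleC_right scaleR_eq_scaleC ell2.scale_left_distrib)
    then show ?thesis by (rule linear_continuous_on)
  qed
  have "closed {x. x = (\<Sum>v\<in>B. cinner v x *\<^sub>C v)}"
    by (intro closed_Collect_eq continuous_on_sum c continuous_on_id)
  moreover have "ell2.span B = {x. x = (\<Sum>v\<in>B. cinner v x *\<^sub>C v)}"
    using span_orthonormal[OF assms] by blast
  ultimately show ?thesis by (simp only:)
qed

text \<open>The given orthonormal set is kept, so that a basis of a subspace extends to a basis of
  the whole space; this is how complements are produced below.\<close>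

lemma gram_schmidt:
  assumes "orthonormal B" "finite B" "finite T"
  obtains B' where "B \<subseteq> B'" "finite B'" "orthonormal B'" "ell2.span B' = ell2.span (B \<union> T)"
proof -
  have "\<exists>B'. B \<subseteq> B' \<and> finite B' \<and> orthonormal B' \<and> ell2.span B' = ell2.span (B \<union> T)"
    using assms(3)
  proof (induction T)
    case empty
    then show ?case using assms by (intro exI[of _ B]) auto
  next
    case (insert a T)
    then obtain B1 where B1: "B \<subseteq> B1" "finite B1" "orthonormal B1"
      "ell2.span B1 = ell2.span (B \<union> T)" by blast
    have sp: "ell2.span (insert a (B \<union> T)) = ell2.span (insert a B1)"
      by (simp add: ell2.span_insert B1(4))
    define p where "p = (\<Sum>v\<in>B1. cinner v a *\<^sub>C v)"
    have pB: "p \<in> ell2.span B1" unfolding p_def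
      by (intro ell2.span_sum ell2.span_scale ell2.span_base)
    show ?case
    proof (cases "a = p")
      case True
      then have "ell2.span (insert a B1) = ell2.span B1" using pB by (simp add: ell2.span_redundant)
      then show ?thesis using B1 sp by (intro exI[of _ B1]) auto
    next
      case False
      define w where "w = a - p"
      define c where "c = (of_real (1 / norm w) :: complex)"
      define b where "b = c *\<^sub>C w"
      have w: "norm w \<noteq> 0" using False by (simp add: w_def)
      then have c0: "c \<noteq> 0" by (simp add: c_def)
      have orth: "cinner v w = 0" if "v \<in> B1" for v
        using cinner_orthonormal_sum[OF B1(3,2) that, of "\<lambda>v. cinner v a"]
        by (simp add: w_def p_def cinner_diff_right)
      have orthb: "cinner v b = 0" "cinner b v = 0" if "v \<in> B1" for v
        using orth[OF that] cinner_commute[of b v] by (auto simp: b_def cinner_scaleC_right)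
      have "norm b = 1" using w by (simp add: b_def norm_scaleC c_def norm_divide)
      then have bb: "cinner b b = 1" by (simp add: cinner_self_norm)
      have "orthonormal (insert b B1)"
        using B1(3) orthb bb by (auto simp: orthonormal_def)
      moreover have "ell2.span (insert b B1) = ell2.span (insert a B1)"
      proof -
        have a: "a = p + (1 / c) *\<^sub>C b" using c0 by (simp add: b_def w_def)
        have b: "b = c *\<^sub>C a - c *\<^sub>C p" by (simp add: b_def w_def scaleC_minus_right)
        have pi: "p \<in> ell2.span (insert y B1)" for y
          using pB ell2.span_mono[of B1 "insert y B1"] by blast
        have "a \<in> ell2.span (insert b B1)"
          by (subst a) (intro ell2.span_add pi ell2.span_scale ell2.span_base insertI1)
        moreover have "b \<in> ell2.span (insert a B1)"
          by (subst b) (intro ell2.span_diff pi ell2.span_scale ell2.span_base insertI1)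
        ultimately show ?thesis
          by (intro subset_antisym ell2.span_minimal)
            (auto intro: ell2.span_base ell2.subspace_span)
      qed
      ultimately show ?thesis
        using B1 sp by (intro exI[of _ "insert b B1"]) auto
    qed
  qed
  then show ?thesis using that by blast
qed

lemma finite_cdim_subspace: "finite_cdim V \<Longrightarrow> ell2.subspace V"
  by (auto simp: finite_cdim_def)

lemma finite_cdim_mono:
  assumes "finite_cdim V" "ell2.subspace U" "U \<subseteq> V"
  shows "finite_cdim U"
proof -
  obtain T where T: "finite T" "V = ell2.span T" using assms(1) by (auto simp: finite_cdim_def)
  obtain B where B: "B \<subseteq> U" "\<not> ell2.dependent B" "U \<subseteq> ell2.span B"
    by (rule ell2.maximal_independent_subset)
  have "finite B" using ell2.independent_span_bound[OF T(1) B(2)] B(1) assms(3) T(2) by auto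
  moreover have "U = ell2.span B"
    using B assms(2) by (metis ell2.span_minimal subset_antisym)
  ultimately show ?thesis by (auto simp: finite_cdim_def)
qed

lemma extend_orthonormal_basis:
  assumes "finite_cdim V" "orthonormal B" "B \<subseteq> V" "finite B"
  obtains B' where "B \<subseteq> B'" "finite B'" "orthonormal B'" "ell2.span B' = V" "card B' = ell2.dim V"
proof -
  obtain T where T: "finite T" "V = ell2.span T" using assms(1) by (auto simp: finite_cdim_def)
  obtain B' where B': "B \<subseteq> B'" "finite B'" "orthonormal B'" "ell2.span B' = ell2.span (B \<union> T)"
    using gram_schmidt[OF assms(2,4) T(1)] .
  have "ell2.span (B \<union> T) = V"
  proof (rule subset_antisym)
    show "ell2.span (B \<union> T) \<subseteq> V"
      unfolding T(2) using assms(3) T(2) by (intro ell2.span_minimal) (auto intro: ell2.span_base)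
    show "V \<subseteq> ell2.span (B \<union> T)" unfolding T(2) by (intro ell2.span_mono) auto
  qed
  moreover from this have "card B' = ell2.dim V"
    using ell2.dim_span_eq_card_independent[OF independent_orthonormal[OF B'(3,2)]] B'(4) by simp
  ultimately show ?thesis using that B' by blast
qed

lemma orthonormal_basis:
  assumes "finite_cdim V"
  obtains B where "finite B" "orthonormal B" "ell2.span B = V" "card B = ell2.dim V"
  by (rule extend_orthonormal_basis[OF assms, of "{}"]) (auto simp: orthonormal_def intro: that)

lemma finite_cdim_closed: "finite_cdim V \<Longrightarrow> closed V"
  by (rule orthonormal_basis) (use closed_span_orthonormal in blast)+

lemma finite_cdim_image:
  assumes "clinear_op A" "finite_cdim V"
  shows "finite_cdim (A ` V)"
proof -
  obtain T where T: "finite T" "V = ell2.span T" using assms(2) by (auto simp: finite_cdim_def)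
  have "A ` V = ell2.span (A ` T)"
    unfolding T(2) by (rule module_hom.span_image[OF clinear_op_module_hom[OF assms(1)], symmetric])
  then show ?thesis using T(1) by (auto simp: finite_cdim_def)
qed

lemma subspace_kernel:
  assumes "clinear_op A" "ell2.subspace V"
  shows "ell2.subspace {x \<in> V. A x = 0}"
  using assms(2) by (auto simp: ell2.subspace_def blinfun.add_right blinfun.zero_right
      clinear_opD[OF assms(1)])

lemma dim_image_inj:
  assumes A: "clinear_op A" and V: "finite_cdim V" and inj: "\<And>x. x \<in> V \<Longrightarrow> A x = 0 \<Longrightarrow> x = 0"
  shows "ell2.dim (A ` V) = ell2.dim V"
proof -
  obtain B where B: "finite B" "orthonormal B" "ell2.span B = V" "card B = ell2.dim V"
    using orthonormal_basis[OF V] .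
  have i: "inj_on A (ell2.span B)"
    unfolding B(3)
  proof (rule inj_onI)
    fix x y assume "x \<in> V" "y \<in> V" "A x = A y"
    then show "x = y"
      using inj[of "x - y"] finite_cdim_subspace[OF V] by (simp add: blinfun.diff_right ell2.subspace_diff)
  qed
  have "\<not> ell2.dependent (A ` B)"
    by (rule module_hom.independent_injective_image[OF clinear_op_module_hom[OF A]
          independent_orthonormal[OF B(2,1)] i])
  from ell2.dim_span_eq_card_independent[OF this]
  have "ell2.dim (A ` V) = card (A ` B)"
    using module_hom.span_image[OF clinear_op_module_hom[OF A], of B] B(3) by simp
  also have "\<dots> = card B" using i by (intro card_image) (auto intro: inj_on_subset ell2.span_base)
  finally show ?thesis using B by simp
qed

text \<open>\<open>A\<close> kills an orthonormal basis of its kernel and is injective on the span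
  of the vectors that complete it to a basis of \<open>V\<close>.\<close>

lemma rank_nullity:
  assumes A: "clinear_op A" and V: "finite_cdim V"
  shows "ell2.dim V = ell2.dim {x \<in> V. A x = 0} + ell2.dim (A ` V)"
proof -
  define Z where "Z = {x \<in> V. A x = 0}"
  have sV: "ell2.subspace V" by (rule finite_cdim_subspace[OF V])
  have Z: "finite_cdim Z" unfolding Z_def
    by (rule finite_cdim_mono[OF V subspace_kernel[OF A sV]]) auto
  obtain B where B: "finite B" "orthonormal B" "ell2.span B = Z" "card B = ell2.dim Z"
    using orthonormal_basis[OF Z] .
  have "B \<subseteq> V" using B(3) ell2.span_superset[of B] by (auto simp: Z_def)
  from extend_orthonormal_basis[OF V B(2) this B(1)]
  obtain B' where B': "B \<subseteq> B'" "finite B'" "orthonormal B'" "ell2.span B' = V" "card B' = ell2.dim V" .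
  define C where "C = B' - B"
  have C: "finite C" "orthonormal C" using B' orthonormal_mono[of B' C] by (auto simp: C_def)
  have CV: "ell2.span C \<subseteq> V" using B'(4) ell2.span_mono[of C B'] by (auto simp: C_def)
  have inj: "x = 0" if x: "x \<in> ell2.span C" "A x = 0" for x
  proof -
    have "x \<in> ell2.span B" using x CV B(3) by (auto simp: Z_def)
    then have "x = (\<Sum>v\<in>B. cinner v x *\<^sub>C v)" by (rule span_orthonormal_sum[OF B(2,1), symmetric])
    also have "\<dots> = 0"
    proof (rule sum.neutral, rule ballI)
      fix v assume "v \<in> B"
      have "cinner v x = cinner v (\<Sum>w\<in>C. cinner w x *\<^sub>C w)"
        by (simp add: span_orthonormal_sum[OF C(2,1) x(1)])
      also have "\<dots> = (\<Sum>w\<in>C. cinner w x * cinner v w)"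
        by (simp add: cinner_sum_right cinner_scaleC_right)
      also have "\<dots> = 0"
      proof -
        have "cinner v w = 0" if "w \<in> C" for w
          using orthonormalD[OF B'(3), of v w] that \<open>v \<in> B\<close> B'(1) by (auto simp: C_def)
        then show ?thesis by simp
      qed
      finally show "cinner v x *\<^sub>C v = 0" by simp
    qed
    finally show ?thesis .
  qed
  have "A ` V = A ` ell2.span C"
  proof -
    have "A ` V = ell2.span (A ` B')"
      using module_hom.span_image[OF clinear_op_module_hom[OF A], of B'] B'(4) by simp
    also have "\<dots> \<subseteq> ell2.span (A ` C)"
    proof (rule ell2.span_minimal)
      have "A b \<in> ell2.span (A ` C)" if "b \<in> B'" for b
      proof (cases "b \<in> B")
        case True
        then have "A b = 0" using B(3) ell2.span_base[of b B] by (auto simp: Z_def)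
        then show ?thesis by (simp add: ell2.span_zero)
      qed (use that in \<open>auto simp: C_def intro: ell2.span_base\<close>)
      then show "A ` B' \<subseteq> ell2.span (A ` C)" by auto
    qed (rule ell2.subspace_span)
    also have "\<dots> = A ` ell2.span C"
      by (rule module_hom.span_image[OF clinear_op_module_hom[OF A]])
    finally show ?thesis using CV by blast
  qed
  moreover have "finite_cdim (ell2.span C)" using C by (auto simp: finite_cdim_def)
  from dim_image_inj[OF A this inj] have "ell2.dim (A ` ell2.span C) = ell2.dim (ell2.span C)" .
  moreover have "ell2.dim (ell2.span C) = card C"
    by (rule ell2.dim_span_eq_card_independent[OF independent_orthonormal[OF C(2,1)]])
  moreover have "card C = card B' - card B" "card B \<le> card B'"
    using card_Diff_subset[OF B(1) B'(1)] card_mono[OF B'(2) B'(1)] by (simp_all add: C_def)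
  ultimately show ?thesis using B(4) B'(5) by (simp add: Z_def)
qed

section \<open>Coordinate subspaces\<close>

definition coord_space :: "'i set \<Rightarrow> 'i ell2 set" where
  "coord_space X = {x. proj X x = x}"

lemma coord_space_iff: "x \<in> coord_space X \<longleftrightarrow> (\<forall>i. i \<notin> X \<longrightarrow> x $. i = 0)"
  by (simp add: coord_space_def proj_eq_self_iff)

lemma proj_in_coord_space [simp]: "proj X x \<in> coord_space X"
  by (simp add: coord_space_def)

lemma proj_coord_space [simp]: "x \<in> coord_space X \<Longrightarrow> proj X x = x"
  by (simp add: coord_space_def)

lemma subspace_coord_space: "ell2.subspace (coord_space X)"
  by (auto simp: ell2.subspace_def coord_space_iff ell2_simps)

lemma inj_ket: "inj ket"
proof (rule injI)
  fix i j :: 'a assume "ket i = ket j"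
  from arg_cong[OF this, of "\<lambda>x. x $. i"] show "i = j"
    by (simp add: ket.rep_eq split: if_splits)
qed

lemma orthonormal_ket: "orthonormal (ket ` X)"
  by (auto simp: orthonormal_def ket.rep_eq inj_eq[OF inj_ket])

lemma norm_ket [simp]: "norm (ket i) = 1"
  using orthonormal_norm[OF orthonormal_ket[of UNIV], of "ket i"] by simp

lemma sum_ket_apply:
  assumes "finite X"
  shows "(\<Sum>j\<in>X. u j *\<^sub>C ket j) $. i = (if i \<in> X then u i else 0)"
  unfolding ell2_apply_sum using assms
  by (simp add: scaleC.rep_eq ket.rep_eq if_distrib sum.delta cong: if_cong)

lemma span_ket:
  assumes "finite X"
  shows "ell2.span (ket ` X) = coord_space X"
proof (rule subset_antisym)
  show "ell2.span (ket ` X) \<subseteq> coord_space X"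
    by (rule ell2.span_minimal[OF _ subspace_coord_space]) (auto simp: coord_space_iff ket.rep_eq)
  show "coord_space X \<subseteq> ell2.span (ket ` X)"
  proof
    fix x :: "'a ell2" assume "x \<in> coord_space X"
    then have "x = (\<Sum>j\<in>X. x $. j *\<^sub>C ket j)"
      by (intro ell2_eqI) (auto simp: sum_ket_apply[OF assms] coord_space_iff)
    moreover have "\<dots> \<in> ell2.span (ket ` X)"
      by (intro ell2.span_sum ell2.span_scale ell2.span_base) auto
    ultimately show "x \<in> ell2.span (ket ` X)" by simp
  qed
qed

lemma coord_space_finite:
  assumes "finite X"
  shows "finite_cdim (coord_space X)" "ell2.dim (coord_space X) = card X"
proof -
  show "finite_cdim (coord_space X)"
    unfolding finite_cdim_def using assms span_ket[OF assms] by (intro exI[of _ "ket ` X"]) simp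
  have "ell2.dim (ell2.span (ket ` X)) = card (ket ` X)"
    by (intro ell2.dim_span_eq_card_independent independent_orthonormal orthonormal_ket
        finite_imageI assms)
  then show "ell2.dim (coord_space X) = card X"
    unfolding span_ket[OF assms] by (simp add: card_image[OF inj_on_subset[OF inj_ket subset_UNIV]])
qed

text \<open>Meant for spaces whose vectors need not be supported on \<open>Q\<close> but are so
  concentrated there that vanishing on \<open>Q\<close> forces them to be zero;
  \<open>proj Q\<close> then embeds the space into one of finite dimension.\<close>

lemma finite_cdim_of_coordinates:
  assumes V: "ell2.subspace V" and Q: "finite Q"
    and inj: "\<And>x. x \<in> V \<Longrightarrow> proj Q x = 0 \<Longrightarrow> x = 0"
  shows "finite_cdim V"
proof -
  obtain B where B: "B \<subseteq> V" "\<not> ell2.dependent B" "V \<subseteq> ell2.span B"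
    by (rule ell2.maximal_independent_subset)
  have sp: "ell2.span B = V" using B V by (metis ell2.span_minimal subset_antisym)
  have i: "inj_on (proj Q) V"
  proof (rule inj_onI)
    fix x y assume "x \<in> V" "y \<in> V" "proj Q x = proj Q y"
    then show "x = y" using inj[of "x - y"] V by (simp add: blinfun.diff_right ell2.subspace_diff)
  qed
  have "\<not> ell2.dependent (proj Q ` B)"
    by (rule module_hom.independent_injective_image[OF clinear_op_module_hom[OF clinear_proj] B(2)])
      (simp add: sp i)
  moreover have "proj Q ` B \<subseteq> ell2.span (ket ` Q)" by (auto simp: span_ket[OF Q])
  ultimately have "finite (proj Q ` B)"
    using ell2.independent_span_bound[of "ket ` Q"] Q by blast
  then have "finite B" using i B(1) by (metis finite_imageD inj_on_subset)
  then show ?thesis using sp by (auto simp: finite_cdim_def)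
qed

subsection \<open>Fredholm operators from a parametrix\<close>

text \<open>The operator \<open>T\<close> is injective on the vectors vanishing on \<open>Q\<close>, and \<open>C\<close> is a complement of the
  image of this subspace; \<open>R\<close> is the resulting left inverse, extended by \<open>0\<close> to \<open>C\<close>.\<close>

definition parametrix :: "('i ell2 \<Rightarrow>\<^sub>L 'i ell2) \<Rightarrow> 'i set \<Rightarrow> 'i ell2 set \<Rightarrow> ('i ell2 \<Rightarrow>\<^sub>L 'i ell2) \<Rightarrow> bool" where
  "parametrix T Q C R \<longleftrightarrow> clinear_op T \<and> clinear_op R \<and> finite Q \<and> finite_cdim C
    \<and> (\<forall>y. proj Q (R y) = 0) \<and> (\<forall>y. y - T (R y) \<in> C)
    \<and> (\<forall>n c. proj Q n = 0 \<longrightarrow> c \<in> C \<longrightarrow> R (T n + c) = n)"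

text \<open>\<open>G = 1 + (T' - T) R\<close> is invertible and carries \<open>T n + c\<close> to
  \<open>T' n + c\<close>. Composing \<open>R\<close> with its inverse therefore leaves
  \<open>Q\<close> and \<open>C\<close>, and with them the index, as they were.\<close>

lemma parametrix_perturb:
  assumes par: "parametrix T Q C R" and T': "clinear_op T'" and small: "norm (T' - T) * norm R < 1"
  obtains R' where "parametrix T' Q C R'"
proof -
  note p = par[unfolded parametrix_def]
  define G where "G = id_blinfun + ((T' - T) o\<^sub>L R)"
  have cG: "clinear_op G" unfolding G_def using p T' by (intro clinear_op_intros) auto
  have "norm (G - id_blinfun) * norm (id_blinfun :: 'a ell2 \<Rightarrow>\<^sub>L 'a ell2) \<le> norm (G - id_blinfun) * 1"
    by (intro mult_left_mono norm_blinfun_id_le) simp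
  also have "\<dots> \<le> norm (T' - T) * norm R"
    unfolding G_def by (simp add: norm_blinfun_compose)
  finally have "norm (G - id_blinfun) * norm (id_blinfun :: 'a ell2 \<Rightarrow>\<^sub>L 'a ell2) < 1"
    using small by simp
  from op_inverse_perturb[OF op_inverse_id cG this]
  obtain Gi where Gi: "op_inverse G Gi" by (auto simp: invertible_op_def)
  have Gx: "G x = x + (T' (R x) - T (R x))" for x
    by (simp add: G_def blinfun.add_left blinfun.diff_left)
  have "parametrix T' Q C (R o\<^sub>L Gi)"
    unfolding parametrix_def
  proof (intro conjI allI impI)
    show "clinear_op (R o\<^sub>L Gi)" using p Gi by (auto simp: op_inverse_def)
    fix y
    have "G (Gi y) = y" using Gi by (simp add: op_inverse_def)
    then have "y - T' ((R o\<^sub>L Gi) y) = Gi y - T (R (Gi y))"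
      unfolding Gx by (simp add: algebra_simps)
    then show "y - T' ((R o\<^sub>L Gi) y) \<in> C" using p by simp
  next
    fix n c assume nc: "proj Q n = 0" "c \<in> C"
    then have "R (T n + c) = n" using p by blast
    then have "G (T n + c) = T' n + c" by (simp add: Gx)
    then have "Gi (T' n + c) = T n + c" using Gi by (metis op_inverse_def)
    then show "(R o\<^sub>L Gi) (T' n + c) = n" using \<open>R (T n + c) = n\<close> by simp
  qed (use p T' in auto)
  then show ?thesis by (rule that)
qed

text \<open>Modulo the vectors vanishing on \<open>Q\<close> in the source and their images in the
  target, \<open>T\<close> becomes the map \<open>t\<close> from the coordinates in \<open>Q\<close>
  to \<open>C\<close>. Kernel and cokernel of \<open>T\<close> have the dimensions of those of
  \<open>t\<close>, and the index of a map between finite-dimensional spaces is the difference of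
  their dimensions.\<close>

theorem parametrix_fredholm:
  assumes par: "parametrix T Q C R"
  shows "fredholm T" "fredholm_index T = int (card Q) - int (ell2.dim C)"
proof -
  have cT: "clinear_op T" and cR: "clinear_op R" and Q: "finite Q" and C: "finite_cdim C"
    and QR: "\<And>y. proj Q (R y) = 0" and TR: "\<And>y. y - T (R y) \<in> C"
    and RT: "\<And>n c. proj Q n = 0 \<Longrightarrow> c \<in> C \<Longrightarrow> R (T n + c) = n"
    using par by (auto simp: parametrix_def)
  have sC: "ell2.subspace C" by (rule finite_cdim_subspace[OF C])
  have C0: "0 \<in> C" using ell2.subspace_0[OF sC] .
  \<comment> \<open>\<open>E\<close> projects onto \<open>C\<close> along the image of the vectors
    vanishing on \<open>Q\<close>.\<close>
  define E where "E = id_blinfun - (T o\<^sub>L R)"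
  have cE: "clinear_op E" unfolding E_def using cT cR by (intro clinear_op_intros)
  have Ex: "E x = x - T (R x)" for x by (simp add: E_def blinfun.diff_left)
  have EC: "E x \<in> C" for x using TR by (simp add: Ex)
  have RC: "R c = 0" if "c \<in> C" for c using RT[of 0 c] that by (simp add: blinfun.zero_right)
  have ECid: "E c = c" if "c \<in> C" for c using RC[OF that] by (simp add: Ex blinfun.zero_right)
  have RTn: "R (T n) = n" if "proj Q n = 0" for n using RT[OF that C0] by simp
  define t where "t = E o\<^sub>L T"
  have ct: "clinear_op t" unfolding t_def using cT cE by (intro clinear_op_intros)
  have tx: "t x = T x - T (R (T x))" for x by (simp add: t_def Ex)
  have tQ: "t x = t (proj Q x)" for x
  proof -
    have "proj Q (proj (- Q) x) = 0" by (rule ell2_eqI) (simp add: ell2_simps)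
    then have "t (proj (- Q) x) = 0" by (simp add: tx RTn)
    then show ?thesis using proj_compl_add[of Q x] by (metis blinfun.add_right add_0_right)
  qed
  define K where "K = coord_space Q"
  have K: "finite_cdim K" "ell2.dim K = card Q" unfolding K_def by (rule coord_space_finite[OF Q])+
  define Z where "Z = {x \<in> K. t x = 0}"
  define D where "D = t ` K"
  have dims: "card Q = ell2.dim Z + ell2.dim D"
    using rank_nullity[OF ct K(1)] by (simp add: K Z_def D_def)
  have D: "finite_cdim D" unfolding D_def by (rule finite_cdim_image[OF ct K(1)])
  have DC: "D \<subseteq> C" by (auto simp: D_def t_def EC)
  have tD: "t x \<in> D" for x unfolding D_def K_def by (subst tQ) (intro imageI proj_in_coord_space)
  have range: "range T = {y. E y \<in> D}"
  proof (intro subset_antisym subsetI)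
    fix y assume "y \<in> range T"
    then obtain x where "y = T x" by auto
    then show "y \<in> {y. E y \<in> D}" using tD[of x] by (simp add: t_def)
  next
    fix y assume "y \<in> {y. E y \<in> D}"
    then obtain k where "E y = t k" by (auto simp: D_def)
    then have "y = T (k - R (T k) + R y)"
      by (simp add: tx Ex blinfun.add_right blinfun.diff_right algebra_simps)
    then show "y \<in> range T" by blast
  qed
  have closed: "closed (range T)"
    unfolding range using closed_vimage[OF finite_cdim_closed[OF D], of E]
    by (simp add: vimage_def linear_continuous_on blinfun.bounded_linear_right)
  have Zf: "finite_cdim Z"
    unfolding Z_def by (rule finite_cdim_mono[OF K(1) subspace_kernel[OF ct finite_cdim_subspace[OF K(1)]]]) auto
  \<comment> \<open>\<open>P\<close> corrects a vector by one vanishing on \<open>Q\<close>; if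
    \<open>t x = 0\<close>, the result lies in the kernel of \<open>T\<close>.\<close>
  define P where "P = id_blinfun - (R o\<^sub>L T)"
  have cP: "clinear_op P" unfolding P_def using cT cR by (intro clinear_op_intros)
  have Px: "P x = x - R (T x)" for x by (simp add: P_def blinfun.diff_left)
  have ker: "op_kernel T = P ` Z"
  proof (intro subset_antisym subsetI)
    fix x assume "x \<in> op_kernel T"
    then have Tx: "T x = 0" by (simp add: op_kernel_def)
    define k n where "k = proj Q x" and "n = proj (- Q) x"
    have xkn: "x = k + n" unfolding k_def n_def by (rule proj_compl_add[symmetric])
    have "proj Q n = 0" unfolding n_def by (rule ell2_eqI) (simp add: ell2_simps)
    have "t k = 0" using tQ[of x] Tx by (simp add: k_def tx blinfun.zero_right)
    then have "k \<in> Z" by (simp add: Z_def K_def k_def)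
    moreover have "T k = - T n" using Tx by (simp add: xkn blinfun.add_right eq_neg_iff_add_eq_0)
    then have "P k = x" using RTn[OF \<open>proj Q n = 0\<close>] by (simp add: Px xkn blinfun.minus_right)
    ultimately show "x \<in> P ` Z" by blast
  next
    fix x assume "x \<in> P ` Z"
    then show "x \<in> op_kernel T" by (auto simp: op_kernel_def Px blinfun.diff_right Z_def tx)
  qed
  have "ell2.dim (P ` Z) = ell2.dim Z"
  proof (rule dim_image_inj[OF cP Zf])
    fix x assume x: "x \<in> Z" "P x = 0"
    then have "proj Q (x - R (T x)) = 0" by (simp add: Px blinfun.zero_right)
    then show "x = 0" using x by (simp add: blinfun.diff_right QR Z_def K_def)
  qed
  then have dimker: "ell2.dim (op_kernel T) = ell2.dim Z" by (simp add: ker)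
  have finker: "finite_cdim (op_kernel T)" unfolding ker by (rule finite_cdim_image[OF cP Zf])
  obtain BD where BD: "finite BD" "orthonormal BD" "ell2.span BD = D" "card BD = ell2.dim D"
    using orthonormal_basis[OF D] .
  have "BD \<subseteq> C" using BD(3) DC ell2.span_superset[of BD] by blast
  from extend_orthonormal_basis[OF C BD(2) this BD(1)]
  obtain BC where BC: "BD \<subseteq> BC" "finite BC" "orthonormal BC" "ell2.span BC = C" "card BC = ell2.dim C" .
  define M where "M = BC - BD"
  have M: "finite M" "orthonormal M" "ell2.span M \<subseteq> C"
    using BC orthonormal_mono[of BC M] ell2.span_mono[of M BC] by (auto simp: M_def)
  have Mperp: "cinner c d = 0" if "c \<in> M" "d \<in> D" for c d
  proof -
    have "d = (\<Sum>v\<in>BD. cinner v d *\<^sub>C v)" using span_orthonormal_sum[OF BD(2,1)] BD(3) that by metis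
    then have "cinner c d = cinner c (\<Sum>v\<in>BD. cinner v d *\<^sub>C v)" by (rule arg_cong)
    also have "\<dots> = (\<Sum>v\<in>BD. cinner v d * cinner c v)"
      by (simp add: cinner_sum_right cinner_scaleC_right)
    also have "\<dots> = 0"
    proof -
      have "cinner c v = 0" if "v \<in> BD" for v
        using orthonormalD[OF BC(3), of c v] that \<open>c \<in> M\<close> BC(1) by (auto simp: M_def)
      then show ?thesis by simp
    qed
    finally show ?thesis .
  qed
  define Es where "Es = cadjoint E"
  have cEs: "clinear_op Es" unfolding Es_def by (rule clinear_cadjoint[OF cE])
  \<comment> \<open>A functional that vanishes on the range of \<open>T\<close> factors through
    \<open>E\<close> and sees only \<open>M\<close>, the part of the basis of \<open>C\<close>
    orthogonal to \<open>D\<close>.\<close>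
  have kers: "op_kernel (cadjoint T) = Es ` ell2.span M"
  proof (intro subset_antisym subsetI)
    fix y assume "y \<in> op_kernel (cadjoint T)"
    then have Ty: "cinner y (T x) = 0" for x
      using cinner_cadjoint[OF cT, of y x] by (simp add: op_kernel_def)
    define w where "w = (\<Sum>c\<in>M. cnj (cinner y c) *\<^sub>C c)"
    have "cinner y x = cinner (Es w) x" for x
    proof -
      have "cinner y x = cinner y (E x)" by (simp add: Ex cinner_diff_right Ty)
      also have "\<dots> = cinner y (\<Sum>v\<in>BC. cinner v (E x) *\<^sub>C v)"
        using span_orthonormal_sum[OF BC(3,2)] BC(4) EC by simp
      also have "\<dots> = (\<Sum>v\<in>BC. cinner v (E x) * cinner y v)"
        by (simp add: cinner_sum_right cinner_scaleC_right)
      also have "\<dots> = (\<Sum>v\<in>M. cinner v (E x) * cinner y v)"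
      proof (rule sum.mono_neutral_right)
        show "\<forall>v\<in>BC - M. cinner v (E x) * cinner y v = 0"
        proof
          fix v assume "v \<in> BC - M"
          then have "v \<in> D" using BD(3) ell2.span_base[of v BD] by (auto simp: M_def)
          then have "v \<in> range T" using ECid DC by (auto simp: range)
          then show "cinner v (E x) * cinner y v = 0" using Ty by auto
        qed
      qed (auto simp: BC(2) M_def)
      also have "\<dots> = cnj (cinner (E x) w)"
        by (simp add: w_def cinner_sum_right cinner_scaleC_right cinner_commute[of _ "E x"] mult.commute)
      also have "\<dots> = cinner (Es w) x"
        by (simp add: Es_def cinner_cadjoint[OF cE] cinner_commute[of _ w])
      finally show ?thesis .
    qed
    then have "y = Es w" by (rule cinner_ext)
    moreover have "w \<in> ell2.span M" unfolding w_def
      by (intro ell2.span_sum ell2.span_scale ell2.span_base)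
    ultimately show "y \<in> Es ` ell2.span M" by blast
  next
    fix y assume "y \<in> Es ` ell2.span M"
    then obtain w where w: "w \<in> ell2.span M" "y = Es w" by auto
    have w': "(\<Sum>c\<in>M. cinner c w *\<^sub>C c) = w" by (rule span_orthonormal_sum[OF M(2,1) w(1)])
    have "cadjoint T y = 0"
    proof (rule cinner_ext)
      fix x
      have "cinner (cadjoint T y) x = cinner w (t x)"
        by (simp add: w(2) Es_def cinner_cadjoint[OF cT] cinner_cadjoint[OF cE] t_def)
      also have "\<dots> = cnj (cinner (t x) w)" by (rule cinner_commute)
      also have "cinner (t x) w = (\<Sum>c\<in>M. cinner c w * cinner (t x) c)"
        by (subst w'[symmetric]) (simp only: cinner_sum_right cinner_scaleC_right)
      also have "\<dots> = 0"
        using Mperp[OF _ tD[of x]] by (intro sum.neutral) (metis cinner_commute complex_cnj_zero mult_zero_right)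
      finally show "cinner (cadjoint T y) x = cinner 0 x" by simp
    qed
    then show "y \<in> op_kernel (cadjoint T)" by (simp add: op_kernel_def)
  qed
  have sM: "finite_cdim (ell2.span M)" using M by (auto simp: finite_cdim_def)
  have "ell2.dim (Es ` ell2.span M) = ell2.dim (ell2.span M)"
  proof (rule dim_image_inj[OF cEs sM])
    fix x assume x: "x \<in> ell2.span M" "Es x = 0"
    then have "cinner x (E x) = 0" using cinner_cadjoint[OF cE, of x x] by (simp add: Es_def)
    then show "x = 0" using ECid x M(3) by auto
  qed
  also have "\<dots> = card M"
    by (rule ell2.dim_span_eq_card_independent[OF independent_orthonormal[OF M(2,1)]])
  also have "card M = ell2.dim C - ell2.dim D"
    unfolding M_def using BC BD by (simp add: card_Diff_subset)
  finally have dimkers: "ell2.dim (op_kernel (cadjoint T)) = ell2.dim C - ell2.dim D"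
    by (simp add: kers)
  have "ell2.dim D \<le> ell2.dim C" using BC BD by (metis card_mono)
  then show "fredholm_index T = int (card Q) - int (ell2.dim C)"
    by (simp add: fredholm_index_def dimker dimkers dims)
  have "finite_cdim (op_kernel (cadjoint T))" unfolding kers by (rule finite_cdim_image[OF cEs sM])
  then show "fredholm T" using cT closed finker by (simp add: fredholm_def)
qed

subsection \<open>The index of a banded invertible operator at a cut\<close>

abbreviation up :: "int \<Rightarrow> (int \<times> 'a) set" where
  "up n \<equiv> {i. n \<le> fst i}"

definition slab :: "int \<Rightarrow> int \<Rightarrow> (int \<times> 'a) set" where
  "slab a b = {a..<b} \<times> UNIV"

lemma in_slab [simp]: "i \<in> slab a b \<longleftrightarrow> a \<le> fst i \<and> fst i < b"
  by (cases i) (auto simp: slab_def)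

lemma finite_slab [simp]: "finite (slab a b :: (int \<times> 'a::finite) set)"
  by (simp add: slab_def)

lemma card_slab: "card (slab a b :: (int \<times> 'a::finite) set) = nat (b - a) * CARD('a)"
  by (simp add: slab_def card_cartesian_product)

lemma coord_space_up_Suc:
  fixes x :: "(int \<times> 'c) ell2"
  shows "x \<in> coord_space (- up m) \<longleftrightarrow> x \<in> coord_space (- up (m + 1)) \<and> proj (slab m (m + 1)) x = 0"
    and "x \<in> coord_space (up (m + 1)) \<longleftrightarrow> x \<in> coord_space (up m) \<and> proj (slab m (m + 1)) x = 0"
proof -
  have le: "m \<le> a \<longleftrightarrow> m + 1 \<le> a \<or> m \<le> a \<and> a < m + 1" for a by auto
  show "x \<in> coord_space (- up m) \<longleftrightarrow> x \<in> coord_space (- up (m + 1)) \<and> proj (slab m (m + 1)) x = 0"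
    unfolding coord_space_iff proj_eq_0_iff Ball_def in_slab Compl_iff mem_Collect_eq not_not
    using le by metis
  have le': "\<not> m + 1 \<le> a \<longleftrightarrow> \<not> m \<le> a \<or> m \<le> a \<and> a < m + 1" for a by auto
  show "x \<in> coord_space (up (m + 1)) \<longleftrightarrow> x \<in> coord_space (up m) \<and> proj (slab m (m + 1)) x = 0"
    unfolding coord_space_iff proj_eq_0_iff Ball_def in_slab mem_Collect_eq
    using le' by metis
qed

lemma half_line_eq_proj: "half_line = proj (up 0)"
  unfolding half_line_def proj_def by (rule arg_cong[of _ _ diag_op]) auto

lemma half_line_compression_apply:
  "half_line_compression S x = proj (up 0) (S (proj (up 0) x)) + proj (- up 0) x"
  by (rule ell2_eqI)
    (simp add: half_line_compression_def half_line_eq_proj blinfun.add_left blinfun.diff_left ell2_simps)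

lemma clinear_half_line_compression: "clinear_op S \<Longrightarrow> clinear_op (half_line_compression S)"
  unfolding half_line_compression_def half_line_eq_proj by (intro clinear_op_intros clinear_proj)

lemma norm_half_line_compression_diff:
  "norm (half_line_compression S - half_line_compression S') \<le> norm (S - S')"
proof (rule norm_blinfun_bound)
  fix x
  have "(half_line_compression S - half_line_compression S') x = proj (up 0) ((S - S') (proj (up 0) x))"
    by (simp add: blinfun.diff_left half_line_compression_apply blinfun.diff_right)
  also have "norm \<dots> \<le> norm (S - S') * norm (proj (up 0) x)"
    by (rule order_trans[OF norm_proj_le norm_blinfun])
  also have "\<dots> \<le> norm (S - S') * norm x"
    by (intro mult_left_mono norm_proj_le) simp
  finally show "norm ((half_line_compression S - half_line_compression S') x) \<le> norm (S - S') * norm x" .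
qed simp

definition cut_space :: "'w lattice_op \<Rightarrow> int \<Rightarrow> int \<Rightarrow> (int \<times> 'w) ell2 set" where
  "cut_space S n m = {x \<in> coord_space (- up m). S x \<in> coord_space (up n)}"

locale banded_invertible =
  fixes S B :: "('w::finite) lattice_op" and R :: int
  assumes inv: "op_inverse S B" and band: "banded R S" and R0: "0 \<le> R"
begin

lemma clinear_S [simp]: "clinear_op S" and clinear_B [simp]: "clinear_op B"
  and SB [simp]: "S (B x) = x" and BS [simp]: "B (S x) = x"
  using inv by (auto simp: op_inverse_def)

lemma S_eq_0 [simp]: "S x = 0 \<longleftrightarrow> x = 0"
  by (metis BS blinfun.zero_right)

lemma norm_S_pos: "0 < norm S" and norm_B_pos: "0 < norm B"
  using op_inverse_nonzero[OF inv] by auto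

lemma S_up:
  assumes "x \<in> coord_space (up m)" "n + R \<le> m"
  shows "S x \<in> coord_space (up n)"
  unfolding coord_space_iff
proof (intro allI impI)
  fix i :: "int \<times> 'w" assume "i \<notin> up n"
  then show "S x $. i = 0"
    using assms by (intro bandedD[OF band]) (auto simp: coord_space_iff)
qed

lemma S_down:
  assumes "x \<in> coord_space (- up m)" "m + R \<le> n"
  shows "S x \<in> coord_space (- up n)"
  unfolding coord_space_iff
proof (intro allI impI)
  fix i :: "int \<times> 'w" assume "i \<notin> - up n"
  then show "S x $. i = 0"
    using assms by (intro bandedD[OF band]) (auto simp: coord_space_iff)
qed

text \<open>A vector \<open>x\<close> of this space is \<open>B (S x)\<close> with
  \<open>S x\<close> supported on \<open>Y\<close>, so its part away from \<open>Y\<close> is at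
  most half of \<open>norm x\<close>, by the choice of \<open>1 / (2 * norm S)\<close>. What is near
  \<open>Y\<close> lives on finitely many coordinates, which therefore determine
  \<open>x\<close>.\<close>

lemma finite_cdim_support:
  assumes fin: "\<And>l. \<exists>Q. finite Q \<and> (\<forall>i\<in>X - Q. \<forall>j\<in>Y. l < \<bar>fst i - fst j\<bar>)"
  shows "finite_cdim {x \<in> coord_space X. S x \<in> coord_space Y}" (is "finite_cdim ?V")
proof -
  have e: "0 < 1 / (2 * norm S)" using norm_S_pos by simp
  obtain l where l: "0 \<le> l"
    "\<And>X Y x. (\<And>i j. i \<in> X \<Longrightarrow> j \<in> Y \<Longrightarrow> l < \<bar>fst i - fst j\<bar>) \<Longrightarrow>
      norm (proj X (B (proj Y x))) \<le> 1 / (2 * norm S) * norm x"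
    using banded_inverse_tail[OF inv band e] by blast
  obtain Q where Q: "finite Q" "\<And>i j. i \<in> X - Q \<Longrightarrow> j \<in> Y \<Longrightarrow> l < \<bar>fst i - fst j\<bar>"
    using fin[of l] by blast
  have sub: "ell2.subspace ?V"
    using subspace_coord_space[of X] subspace_coord_space[of Y]
    by (auto simp: ell2.subspace_def blinfun.zero_right blinfun.add_right clinear_opD)
  show ?thesis
  proof (rule finite_cdim_of_coordinates[OF sub Q(1)])
    fix x assume x: "x \<in> ?V" "proj Q x = 0"
    have "proj (X - Q) x = x"
      using x by (auto simp: proj_eq_self_iff proj_eq_0_iff coord_space_iff)
    then have "norm x = norm (proj (X - Q) (B (proj Y (S x))))"
      using x by simp
    also have "\<dots> \<le> 1 / (2 * norm S) * norm (S x)" by (rule l(2)) (rule Q(2))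
    also have "\<dots> \<le> 1 / (2 * norm S) * (norm S * norm x)"
      by (intro mult_left_mono norm_blinfun) simp
    also have "\<dots> = norm x / 2" using norm_S_pos by simp
    finally show "x = 0" by simp
  qed
qed

lemma finite_cdim_cut_space: "finite_cdim (cut_space S n m)"
  unfolding cut_space_def
proof (rule finite_cdim_support)
  show "\<exists>Q::(int \<times> 'w) set. finite Q \<and> (\<forall>i\<in>- up m - Q. \<forall>j\<in>(up n :: (int \<times> 'w) set). l < \<bar>fst i - fst j\<bar>)" for l
    by (intro exI[of _ "slab (n - l) m"]) auto
qed

text \<open>Since \<open>S\<close> maps \<open>up l\<close> into \<open>up 0\<close>, the preimage under \<open>S\<close> of the vectors supported on
  \<open>up 0\<close> splits into \<open>up l\<close> and the cut space.\<close>

lemma parametrix_cut: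
  assumes l: "R \<le> l"
  shows "parametrix (half_line_compression S) (slab 0 l) (S ` cut_space S 0 l)
    ((proj (up l) o\<^sub>L B o\<^sub>L proj (up 0)) + proj (- up 0))"
    (is "parametrix ?T ?Q ?C ?R")
  unfolding parametrix_def
proof (intro conjI allI impI)
  have Ry: "?R y = proj (up l) (B (proj (up 0) y)) + proj (- up 0) y" for y
    by (simp add: blinfun.add_left)
  have l0: "0 \<le> l" using l R0 by simp
  show "clinear_op ?T" by (rule clinear_half_line_compression) simp
  show "clinear_op ?R" by (intro clinear_op_intros clinear_proj clinear_B)
  show "finite ?Q" by simp
  show "finite_cdim ?C" by (rule finite_cdim_image[OF clinear_S finite_cdim_cut_space])
  fix y
  show "proj ?Q (?R y) = 0"
    unfolding proj_eq_0_iff by (auto simp: Ry ell2_simps)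
  show "y - ?T (?R y) \<in> ?C"
  proof
    define z where "z = B (proj (up 0) y)"
    have p1: "proj (up 0) (?R y) = proj (up l) z" "proj (- up 0) (?R y) = proj (- up 0) y"
      unfolding Ry z_def using l0 by (auto intro!: ell2_eqI simp: ell2_simps)
    have S1: "S (proj (up l) z) \<in> coord_space (up 0)" by (rule S_up[OF proj_in_coord_space]) (use l in simp)
    have Sz: "S (proj (- up l) z) = proj (up 0) y - S (proj (up l) z)"
      using proj_compl_add[of "up l" z] by (metis SB add_diff_cancel_left' blinfun.add_right z_def)
    show "y - ?T (?R y) = S (proj (- up l) z)"
      unfolding half_line_compression_apply p1 Sz using S1
      by (simp add: algebra_simps proj_compl_add)
    have "S (proj (- up l) z) \<in> coord_space (up 0)"
      unfolding Sz by (intro ell2.subspace_diff[OF subspace_coord_space] S1 proj_in_coord_space)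
    then show "proj (- up l) z \<in> cut_space S 0 l" by (simp add: cut_space_def)
  qed
next
  have l0: "0 \<le> l" using l R0 by simp
  fix n c assume n: "proj ?Q n = 0" and "c \<in> ?C"
  then obtain x where x: "x \<in> coord_space (- up l)" "S x \<in> coord_space (up 0)" "c = S x"
    by (auto simp: cut_space_def)
  have n0: "proj (up 0) n = proj (up l) n"
    using n l0 by (intro ell2_eqI) (auto simp: proj_eq_0_iff)
  have S1: "S (proj (up l) n) \<in> coord_space (up 0)" by (rule S_up[OF proj_in_coord_space]) (use l in simp)
  have Tn: "?T n = S (proj (up l) n) + proj (- up 0) n"
    using S1 by (simp add: half_line_compression_apply n0)
  have "proj (up 0) (?T n + c) = S (proj (up l) n + x)"
    using S1 x by (simp add: Tn blinfun.add_right) (auto intro!: ell2_eqI simp: ell2_simps)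
  moreover have "proj (- up 0) (?T n + c) = proj (- up 0) n"
    using S1 x by (intro ell2_eqI) (auto simp: Tn ell2_simps coord_space_iff)
  ultimately have "?R (?T n + c) = proj (up l) (proj (up l) n + x) + proj (- up 0) n"
    by (simp add: blinfun.add_left)
  also have "\<dots> = proj (up l) n + proj (- up 0) n"
    using x(1) by (intro ell2_eqI) (auto simp: ell2_simps coord_space_iff)
  also have "\<dots> = n" using proj_compl_add[of "up 0" n] by (simp add: n0)
  finally show "?R (?T n + c) = n" .
qed

text \<open>The explicit left inverse has norm at most \<open>norm B + 1\<close> whatever
  \<open>l\<close> is, so one closeness condition yields the index formula for all admissible
  \<open>l\<close>.\<close>

lemma fredholm_half_line_near:
  assumes "clinear_op S'" "norm (S' - S) * (norm B + 1) < 1"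
  shows "fredholm (half_line_compression S')"
    and "R \<le> l \<Longrightarrow> fredholm_index (half_line_compression S')
      = l * int CARD('w) - int (ell2.dim (cut_space S 0 l))"
proof -
  have par: "\<exists>R'. parametrix (half_line_compression S') (slab 0 l) (S ` cut_space S 0 l) R'"
    if l: "R \<le> l" for l
  proof -
    let ?R = "(proj (up l) o\<^sub>L B o\<^sub>L proj (up 0)) + proj (- up 0) :: 'w lattice_op"
    have "norm (proj (up l) o\<^sub>L B o\<^sub>L proj (up 0)) \<le> norm (proj (up l) o\<^sub>L B) * norm (proj (up 0) :: 'w lattice_op)"
      by (rule norm_blinfun_compose)
    also have "\<dots> \<le> norm (proj (up l) o\<^sub>L B) * 1"
      by (intro mult_left_mono norm_proj_le_1) simp
    also have "\<dots> \<le> norm (proj (up l) :: 'w lattice_op) * norm B"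
      by (simp add: norm_blinfun_compose)
    also have "\<dots> \<le> 1 * norm B" by (intro mult_right_mono norm_proj_le_1) simp
    finally have "norm ?R \<le> norm B + 1"
      using norm_triangle_ineq[of "proj (up l) o\<^sub>L B o\<^sub>L proj (up 0)" "proj (- up 0) :: 'w lattice_op"]
        norm_proj_le_1[of "- up 0 :: (int \<times> 'w) set"] by simp
    then have "norm (half_line_compression S' - half_line_compression S) * norm ?R
        \<le> norm (S' - S) * (norm B + 1)"
      by (intro mult_mono norm_half_line_compression_diff) auto
    also have "\<dots> < 1" by (rule assms(2))
    finally show ?thesis
      using parametrix_perturb[OF parametrix_cut[OF l] clinear_half_line_compression[OF assms(1)]] by blast
  qed
  show "fredholm (half_line_compression S')"
    using par[of R] parametrix_fredholm(1) by blast
  assume l: "R \<le> l"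
  have "ell2.dim (S ` cut_space S 0 l) = ell2.dim (cut_space S 0 l)"
    by (rule dim_image_inj[OF clinear_S finite_cdim_cut_space]) simp
  then show "fredholm_index (half_line_compression S')
      = l * int CARD('w) - int (ell2.dim (cut_space S 0 l))"
    using par[OF l] parametrix_fredholm(2) l R0 by (fastforce simp: card_slab)
qed

text \<open>Both spaces sit in \<open>cut_space S n (n + l + 1)\<close> as the kernels of two maps
  onto spaces of dimension \<open>CARD('w)\<close>: reading off \<open>x\<close> at the site
  \<open>n + l\<close>, and reading off \<open>S x\<close> at the site \<open>n\<close>.\<close>

lemma dim_cut_space_Suc:
  assumes "R \<le> l"
  shows "ell2.dim (cut_space S n (n + l)) = ell2.dim (cut_space S (n + 1) (n + 1 + l))"
proof -
  define m where "m = n + l"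
  define V where "V = cut_space S n (m + 1)"
  have V: "finite_cdim V" unfolding V_def by (rule finite_cdim_cut_space)
  have "{x \<in> V. proj (slab m (m + 1)) x = 0} = cut_space S n m"
    unfolding V_def cut_space_def
    using coord_space_up_Suc(1)[where m = m and 'c = 'w] by blast
  moreover have "proj (slab m (m + 1)) ` V = coord_space (slab m (m + 1))"
  proof (intro subset_antisym subsetI)
    fix y :: "(int \<times> 'w) ell2" assume y: "y \<in> coord_space (slab m (m + 1))"
    have "y \<in> coord_space (up m)" using y by (auto simp: coord_space_iff)
    then have "S y \<in> coord_space (up n)" by (rule S_up) (use assms in \<open>simp add: m_def\<close>)
    then have "y \<in> V" using y by (auto simp: V_def cut_space_def coord_space_iff)
    then show "y \<in> proj (slab m (m + 1)) ` V" using y by (metis image_eqI proj_coord_space)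
  qed auto
  ultimately have 1: "ell2.dim V = ell2.dim (cut_space S n m) + CARD('w)"
    using rank_nullity[OF clinear_proj[of "slab m (m + 1)"] V] by (simp add: coord_space_finite card_slab)
  define P where "P = proj (slab n (n + 1)) o\<^sub>L S"
  have cP: "clinear_op P" unfolding P_def by (intro clinear_op_intros clinear_proj clinear_S)
  have "{x \<in> V. P x = 0} = cut_space S (n + 1) (m + 1)"
    unfolding V_def cut_space_def P_def blinfun_apply_blinfun_compose
    using coord_space_up_Suc(2)[where m = n and 'c = 'w] by blast
  moreover have "P ` V = coord_space (slab n (n + 1))"
  proof (intro subset_antisym subsetI)
    fix y :: "(int \<times> 'w) ell2" assume y: "y \<in> coord_space (slab n (n + 1))"
    \<comment> \<open>The part of \<open>B y\<close> beyond the site \<open>m\<close> is mapped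
      beyond the site \<open>n\<close>, so dropping it does not change the image at
      \<open>n\<close>.\<close>
    define z where "z = B y"
    have S1: "S (proj (up (m + 1)) z) \<in> coord_space (up (n + 1))"
      by (rule S_up[OF proj_in_coord_space]) (use assms in \<open>simp add: m_def\<close>)
    have Sz: "S (proj (- up (m + 1)) z) = y - S (proj (up (m + 1)) z)"
      using proj_compl_add[of "up (m + 1)" z] by (metis SB add_diff_cancel_left' blinfun.add_right z_def)
    have "proj (- up (m + 1)) z \<in> V"
      using S1 y by (auto simp: V_def cut_space_def Sz coord_space_iff ell2_simps)
    moreover have "P (proj (- up (m + 1)) z) = y"
      using S1 y by (intro ell2_eqI) (auto simp: P_def Sz coord_space_iff ell2_simps)
    ultimately show "y \<in> P ` V" by blast
  qed (auto simp: P_def)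
  ultimately have 2: "ell2.dim V = ell2.dim (cut_space S (n + 1) (m + 1)) + CARD('w)"
    using rank_nullity[OF cP V] by (simp add: coord_space_finite card_slab)
  show ?thesis using 1 2 by (simp add: m_def add_ac)
qed

lemma dim_cut_space_shift:
  assumes "R \<le> l"
  shows "ell2.dim (cut_space S n (n + l)) = ell2.dim (cut_space S 0 l)"
proof (induction n rule: int_induct[where k = 0])
  case (step1 n)
  then show ?case using dim_cut_space_Suc[OF assms, of n] by (simp add: add_ac)
next
  case (step2 n)
  then show ?case using dim_cut_space_Suc[OF assms, of "n - 1"] by (simp add: add_ac)
qed simp

lemma dim_cut_space:
  assumes "R \<le> l"
  shows "int (ell2.dim (cut_space S n (n + l)))
    = l * int CARD('w) - fredholm_index (half_line_compression S)"
  using fredholm_half_line_near(2)[of S l] assms by (simp add: dim_cut_space_shift)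

end

subsection \<open>Block diagonal invertible operators are connected to the identity\<close>

lemma path_component_image:
  assumes "path_component G x y" "continuous_on UNIV f" "f ` G \<subseteq> H"
  shows "path_component H (f x) (f y)"
proof -
  obtain g where g: "path g" "path_image g \<subseteq> G" "pathstart g = x" "pathfinish g = y"
    using assms(1) by (auto simp: path_component_def)
  have "path (f \<circ> g)"
    using g(1) continuous_on_subset[OF assms(2)] by (intro path_continuous_image) auto
  moreover have "path_image (f \<circ> g) \<subseteq> H"
    using g(2) assms(3) by (auto simp: path_image_compose)
  ultimately show ?thesis
    unfolding path_component_def using g(3,4) by (auto simp: pathstart_compose pathfinish_compose)
qed

lemma continuous_on_compose_left: "continuous_on UNIV (\<lambda>X. A o\<^sub>L X)"
  by (intro linear_continuous_on bounded_bilinear.bounded_linear_right bounded_bilinear_blinfun_compose)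

lemma continuous_on_compose_right: "continuous_on UNIV (\<lambda>X. X o\<^sub>L A)"
  by (intro linear_continuous_on bounded_bilinear.bounded_linear_left bounded_bilinear_blinfun_compose)

definition block_GL :: "('i \<Rightarrow> 'k) \<Rightarrow> ('i ell2 \<Rightarrow>\<^sub>L 'i ell2) set" where
  "block_GL b = {A. invertible_op A \<and> block_diag b A}"

lemma block_diag_intros:
  "block_diag b id_blinfun"
  "block_diag b A \<Longrightarrow> block_diag b B \<Longrightarrow> block_diag b (A + B)"
  "block_diag b A \<Longrightarrow> block_diag b B \<Longrightarrow> block_diag b (A - B)"
  "block_diag b A \<Longrightarrow> block_diag b (r *\<^sub>R A)"
  "block_diag b (proj X)"
  unfolding block_diag_def by (auto intro: local_in_linear local_in_id local_in_proj)

lemma block_diag_minus: "block_diag b A \<Longrightarrow> block_diag b (- A)"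
  using block_diag_intros(4)[of b A "-1"] by simp

lemma block_GL_comp: "A \<in> block_GL b \<Longrightarrow> B \<in> block_GL b \<Longrightarrow> A o\<^sub>L B \<in> block_GL b"
  by (simp add: block_GL_def invertible_op_comp block_diag_comp)

lemma unipotent_block_GL:
  assumes "clinear_op X" "X o\<^sub>L X = 0" "block_diag b X"
  shows "id_blinfun + t *\<^sub>R X \<in> block_GL b"
proof -
  have "(t *\<^sub>R X) o\<^sub>L (t *\<^sub>R X) = (t * t) *\<^sub>R (X o\<^sub>L X)"
    by (rule blinfun_eqI) (simp add: blinfun.scaleR_left blinfun.scaleR_right)
  then have "op_inverse (id_blinfun + t *\<^sub>R X) (id_blinfun - t *\<^sub>R X)"
    using assms by (intro op_inverse_unipotent) auto
  then show ?thesis using assms(3)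
    by (auto simp: block_GL_def invertible_op_def intro: block_diag_intros)
qed

lemma closed_segment_memE:
  assumes "x \<in> closed_segment a b"
  obtains t where "0 \<le> t" "t \<le> 1" "x = (1 - t) *\<^sub>R a + t *\<^sub>R b"
  using assms by (auto simp: closed_segment_def)

text \<open>As \<open>t *\<^sub>R X\<close> squares to zero, every
  \<open>id_blinfun + t *\<^sub>R X\<close> is invertible, and the segment starting at
  \<open>V\<close> runs through the products of these with \<open>V\<close>.\<close>

lemma block_GL_unipotent_left:
  assumes "clinear_op X" "X o\<^sub>L X = 0" "block_diag b X" "V \<in> block_GL b"
  shows "path_component (block_GL b) V ((id_blinfun + X) o\<^sub>L V)"
proof (rule path_component_linepath, rule subsetI)
  fix Y assume "Y \<in> closed_segment V ((id_blinfun + X) o\<^sub>L V)"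
  then obtain t where Y: "Y = (1 - t) *\<^sub>R V + t *\<^sub>R ((id_blinfun + X) o\<^sub>L V)"
    by (rule closed_segment_memE)
  have "Y = (id_blinfun + t *\<^sub>R X) o\<^sub>L V"
    unfolding Y
    by (intro blinfun_eqI) (simp add: blinfun.add_left blinfun.diff_left blinfun.scaleR_left algebra_simps)
  then show "Y \<in> block_GL b"
    using block_GL_comp[OF unipotent_block_GL[OF assms(1-3)] assms(4)] by simp
qed

lemma block_GL_unipotent_right:
  assumes "clinear_op X" "X o\<^sub>L X = 0" "block_diag b X" "V \<in> block_GL b"
  shows "path_component (block_GL b) V (V o\<^sub>L (id_blinfun + X))"
proof (rule path_component_linepath, rule subsetI)
  fix Y assume "Y \<in> closed_segment V (V o\<^sub>L (id_blinfun + X))"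
  then obtain t where Y: "Y = (1 - t) *\<^sub>R V + t *\<^sub>R (V o\<^sub>L (id_blinfun + X))"
    by (rule closed_segment_memE)
  have "Y = V o\<^sub>L (id_blinfun + t *\<^sub>R X)"
    unfolding Y
    by (intro blinfun_eqI)
      (simp add: blinfun.add_left blinfun.diff_left blinfun.add_right blinfun.scaleR_left blinfun.scaleR_right algebra_simps)
  then show "Y \<in> block_GL b"
    using block_GL_comp[OF assms(4) unipotent_block_GL[OF assms(1-3)]] by simp
qed

section \<open>Invertible diagonal operators\<close>

lemma clinear_diag_op: "bounded (range f) \<Longrightarrow> clinear_op (diag_op f)"
  unfolding clinear_op_def
  by (intro allI ell2_eqI) (simp add: ell2_apply_diag_op ell2_simps)

lemma diag_op_block_GL:
  assumes "bounded (range a)" "0 < c" "\<And>i. c \<le> cmod (a i)"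
  shows "diag_op a \<in> block_GL b" "op_inverse (diag_op a) (diag_op (\<lambda>i. 1 / a i))"
    "bounded (range (\<lambda>i. 1 / a i))"
proof -
  have a0: "a i \<noteq> 0" for i using assms(2) assms(3)[of i] by auto
  show bd: "bounded (range (\<lambda>i. 1 / a i))"
    by (rule boundedI[where B = "1 / c"]) (use assms a0 in \<open>auto simp: norm_divide frac_le\<close>)
  show inv: "op_inverse (diag_op a) (diag_op (\<lambda>i. 1 / a i))"
    unfolding op_inverse_def
    by (intro conjI allI clinear_diag_op bd assms(1) ell2_eqI)
      (simp_all add: ell2_apply_diag_op[OF bd] ell2_apply_diag_op[OF assms(1)] a0)
  have "block_diag b (diag_op a)"
    unfolding block_diag_def local_in_def by (auto simp: ell2_apply_diag_op[OF assms(1)])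
  then show "diag_op a \<in> block_GL b" using inv by (auto simp: block_GL_def invertible_op_def)
qed

text \<open>The sign condition says that \<open>z\<close> and \<open>w\<close> enclose at most a
  right angle, so the cross term only helps. The factor \<open>1 / 2\<close> rounds
  \<open>1 / sqrt 2\<close> down.\<close>

lemma cmod_segment_ge:
  assumes "0 \<le> Re (cnj z * w)" "c \<le> cmod z" "c \<le> cmod w" "0 \<le> c" "0 \<le> t" "t \<le> 1"
  shows "c / 2 \<le> cmod ((1 - t) *\<^sub>R z + t *\<^sub>R w)"
proof -
  have "(c / 2)\<^sup>2 \<le> ((1 - t)\<^sup>2 + t\<^sup>2) * c\<^sup>2"
  proof -
    have "1 / 4 \<le> (1 - t)\<^sup>2 + t\<^sup>2" using zero_le_power2[of "2 * t - 1"]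
      by (simp add: power2_eq_square algebra_simps)
    then have "(1 / 4) * c\<^sup>2 \<le> ((1 - t)\<^sup>2 + t\<^sup>2) * c\<^sup>2" by (rule mult_right_mono) simp
    then show ?thesis by (simp add: power_divide)
  qed
  also have "\<dots> = (1 - t)\<^sup>2 * c\<^sup>2 + t\<^sup>2 * c\<^sup>2" by (rule distrib_right)
  also have "\<dots> \<le> (1 - t)\<^sup>2 * (cmod z)\<^sup>2 + t\<^sup>2 * (cmod w)\<^sup>2"
    using assms by (intro add_mono mult_left_mono power_mono) auto
  also have "\<dots> \<le> (1 - t)\<^sup>2 * (cmod z)\<^sup>2 + t\<^sup>2 * (cmod w)\<^sup>2 + 2 * t * (1 - t) * Re (cnj z * w)"
    using assms by simp
  also have "\<dots> = (cmod ((1 - t) *\<^sub>R z + t *\<^sub>R w))\<^sup>2"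
    unfolding cmod_power2 by (simp add: power2_eq_square algebra_simps)
  finally show ?thesis by (rule power2_le_imp_le) simp
qed

lemma diag_op_segment:
  assumes "bounded (range a)" "bounded (range d)" "0 < c"
    "\<And>i. c \<le> cmod (a i)" "\<And>i. c \<le> cmod (d i)" "\<And>i. 0 \<le> Re (cnj (a i) * d i)"
  shows "path_component (block_GL b) (diag_op a) (diag_op d)"
proof (rule path_component_linepath, rule subsetI)
  fix Y assume "Y \<in> closed_segment (diag_op a) (diag_op d)"
  then obtain t where t: "0 \<le> t" "t \<le> 1" "Y = (1 - t) *\<^sub>R diag_op a + t *\<^sub>R diag_op d"
    by (rule closed_segment_memE)
  obtain A D where AD: "\<And>i. cmod (a i) \<le> A" "\<And>i. cmod (d i) \<le> D"
    using assms(1,2) unfolding bounded_iff by auto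
  have "cmod ((1 - t) *\<^sub>R a i + t *\<^sub>R d i) \<le> A + D" for i
  proof -
    have "cmod ((1 - t) *\<^sub>R a i + t *\<^sub>R d i) \<le> (1 - t) * cmod (a i) + t * cmod (d i)"
      using norm_triangle_ineq[of "(1 - t) *\<^sub>R a i" "t *\<^sub>R d i"] t by simp
    also have "\<dots> \<le> 1 * cmod (a i) + 1 * cmod (d i)"
      using t by (intro add_mono mult_right_mono) auto
    finally show ?thesis using AD[of i] by simp
  qed
  then have bd: "bounded (range (\<lambda>i. (1 - t) *\<^sub>R a i + t *\<^sub>R d i))"
    by (intro boundedI[where B = "A + D"]) auto
  have "Y x $. i = ((1 - t) *\<^sub>R a i + t *\<^sub>R d i) * x $. i" for x i
    unfolding t(3)
    by (simp add: blinfun.add_left blinfun.scaleR_left ell2_simps ell2_apply_diag_op[OF assms(1)]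
        ell2_apply_diag_op[OF assms(2)] scaleR_conv_of_real distrib_right del: scaleR_left_diff_distrib of_real_diff)
  then have "Y = diag_op (\<lambda>i. (1 - t) *\<^sub>R a i + t *\<^sub>R d i)"
    by (intro blinfun_eqI ell2_eqI) (simp only: ell2_apply_diag_op[OF bd])
  moreover have "diag_op (\<lambda>i. (1 - t) *\<^sub>R a i + t *\<^sub>R d i) \<in> block_GL b"
    using assms t(1,2) by (intro diag_op_block_GL(1)[OF bd, of "c / 2"] cmod_segment_ge) auto
  ultimately show "Y \<in> block_GL b" by simp
qed

lemma diag_op_connected:
  assumes "bounded (range a)" "0 < c" "\<And>i. c \<le> cmod (a i)"
  shows "path_component (block_GL b) (diag_op a) id_blinfun"
proof -
  \<comment> \<open>A single segment to \<open>1\<close> could pass through zero. Each entry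
    encloses at most a right angle with \<open>\<i>\<close> or with \<open>- \<i>\<close>, according
    to the sign of its imaginary part, and both are perpendicular to \<open>1\<close>.\<close>
  define d where "d i = (if 0 \<le> Im (a i) then \<i> else - \<i>)" for i
  have bd: "bounded (range d)" "bounded (range (\<lambda>i. 1 :: complex))"
    by (auto intro!: boundedI[where B = 1] simp: d_def)
  have "path_component (block_GL b) (diag_op a) (diag_op d)"
    using assms by (intro diag_op_segment[OF assms(1) bd(1), of "min c 1"]) (auto simp: d_def min.coboundedI1)
  moreover have "path_component (block_GL b) (diag_op d) (diag_op (\<lambda>i. 1))"
    by (intro diag_op_segment[OF bd, of 1]) (auto simp: d_def)
  moreover have "diag_op (\<lambda>i. 1) = id_blinfun"
    by (intro blinfun_eqI ell2_eqI) (simp add: ell2_apply_diag_op[OF bd(2)])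
  ultimately show ?thesis using path_component_trans by metis
qed

text \<open>Gaussian elimination, simultaneously in all blocks: \<open>p\<close> numbers the indices of a block, and
  the indices with position outside \<open>A\<close> have been split off already.\<close>

lemma block_GL_elimination:
  fixes b :: "'i \<Rightarrow> 'k" and p :: "'i \<Rightarrow> 'p"
  assumes inj: "\<And>i j. b i = b j \<Longrightarrow> p i = p j \<Longrightarrow> i = j"
    and "finite A" and "V \<in> block_GL b"
    and "\<And>x i. p i \<notin> A \<Longrightarrow> V x $. i = x $. i"
    and "\<And>x. (\<And>i. p i \<in> A \<Longrightarrow> x $. i = 0) \<Longrightarrow> V x = x"
  shows "path_component (block_GL b) V id_blinfun"
  using assms(2-)
proof (induction A arbitrary: V)
  case empty
  then have "V = id_blinfun" by (intro blinfun_eqI) simp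
  then show ?case using empty by (simp add: path_component_refl)
next
  case (insert q A)
  note row = insert.prems(2) and col = insert.prems(3)
  have V: "block_diag b V" using insert.prems(1) by (simp add: block_GL_def)
  obtain B where B: "op_inverse V B" using insert.prems(1) by (auto simp: block_GL_def invertible_op_def)
  then have cV: "clinear_op V" by (simp add: op_inverse_def)
  define N where "N = card (insert q A)"
  have N: "0 < N" using insert by (simp add: N_def card_gt_0_iff)
  have nB: "0 < norm B" using op_inverse_nonzero[OF B] by simp
  \<comment> \<open>A column of \<open>V\<close> has norm at least \<open>1 / norm B\<close>, and a
    pivot column has at most \<open>N\<close> nonzero entries, one for each active position of its
    block. So one entry reaches \<open>\<delta>\<close>.\<close>
  define \<delta> where "\<delta> = 1 / (norm B * N)"
  have \<delta>: "0 < \<delta>" using nB N by (simp add: \<delta>_def)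
  have "\<exists>j. b j = b i \<and> p j \<in> insert q A \<and> \<delta> \<le> cmod (V (ket i) $. j)" if pi: "p i = q" for i
  proof (rule ccontr)
    assume no: "\<not> ?thesis"
    define J where "J = {j. b j = b i \<and> p j \<in> insert q A}"
    have "inj_on p J" using inj by (auto simp: J_def inj_on_def)
    moreover have "p ` J \<subseteq> insert q A" by (auto simp: J_def)
    ultimately have J: "finite J" "card J \<le> N"
      using insert.hyps(1) unfolding N_def by (auto intro: inj_on_finite card_inj_on_le)
    have iJ: "i \<in> J" using pi by (simp add: J_def)
    define x where "x = V (ket i)"
    \<comment> \<open>Other blocks are excluded by block diagonality, and the rows already split off
      are rows of the identity.\<close>
    have x0: "x $. j = 0" if "j \<notin> J" for j
    proof (cases "b j = b i")
      case True
      then have "p j \<notin> insert q A" using that by (simp add: J_def)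
      moreover from this pi have "j \<noteq> i" by auto
      ultimately show ?thesis by (simp add: x_def row ket.rep_eq)
    next
      case False
      show ?thesis unfolding x_def
        by (rule local_inD[OF V[unfolded block_diag_def]]) (use False in \<open>auto simp: ket.rep_eq\<close>)
    qed
    have "x = (\<Sum>j\<in>J. x $. j *\<^sub>C ket j)"
      by (rule ell2_eqI) (auto simp: sum_ket_apply[OF J(1)] x0)
    then have "norm x \<le> (\<Sum>j\<in>J. norm (x $. j *\<^sub>C ket j))" by (metis norm_sum)
    also have "\<dots> = (\<Sum>j\<in>J. cmod (x $. j))"
      by (simp add: norm_scaleC)
    also have "\<dots> < (\<Sum>j\<in>J. \<delta>)"
      using no iJ J(1) by (intro sum_strict_mono) (auto simp: J_def x_def not_le)
    also have "\<dots> \<le> N * \<delta>" using J(2) \<delta> by (simp add: mult_right_mono)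
    also have "\<dots> = 1 / norm B" using N by (simp add: \<delta>_def)
    finally have "norm B * norm x < 1" using nB by (simp add: field_simps)
    moreover have "1 \<le> norm B * norm x"
      using op_inverse_lower_bound[OF B, of "ket i"]
      by (simp add: x_def)
    ultimately show False by simp
  qed
  then obtain J where J: "\<And>i. p i = q \<Longrightarrow> b (J i) = b i" "\<And>i. p i = q \<Longrightarrow> p (J i) \<in> insert q A"
    "\<And>i. p i = q \<Longrightarrow> \<delta> \<le> cmod (V (ket i) $. J i)"
    by metis
  \<comment> \<open>Where the pivot is too small, the row \<open>J i\<close> with its large entry is
    added to row \<open>i\<close>, and the sum is at least \<open>\<delta> - \<delta> / 2\<close>.
    Elsewhere nothing is added, so that no large pivot is destroyed.\<close>
  define c :: "'i \<Rightarrow> complex" where "c i = (if p i = q \<and> cmod (V (ket i) $. i) < \<delta> / 2 then 1 else 0)" for i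
  have c: "p i = q" "p (J i) \<in> A" "p (J i) \<noteq> q" "b (J i) = b i" if "c i \<noteq> 0" for i
  proof -
    from that show pi: "p i = q" by (auto simp: c_def split: if_splits)
    show "b (J i) = b i" by (rule J(1)[OF pi])
    have "J i \<noteq> i" using J(3)[OF pi] that \<delta> by (auto simp: c_def split: if_splits)
    then show "p (J i) \<noteq> q" using inj[of "J i" i] J(1)[OF pi] pi by auto
    then show "p (J i) \<in> A" using J(2)[OF pi] by auto
  qed
  have "inj_on J {i. c i \<noteq> 0}"
  proof (rule inj_onI, simp)
    fix i j assume "c i \<noteq> 0" "c j \<noteq> 0" "J i = J j"
    then show "i = j" using c[of i] c[of j] inj[of i j] by metis
  qed
  moreover have "cmod (c i) \<le> 1" for i by (simp add: c_def)
  ultimately obtain X where X: "clinear_op X" "\<And>x i. X x $. i = c i * x $. J i"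
    using weighted_pull[of J c 1] by metis
  \<comment> \<open>Rows are added from positions in \<open>A\<close> to the position
    \<open>q\<close> only, so the operation squares to zero.\<close>
  have cJ: "c (J i) = 0" if "c i \<noteq> 0" for i using c(3)[OF that] by (simp add: c_def)
  have XX: "X o\<^sub>L X = 0"
    by (intro blinfun_eqI ell2_eqI) (use cJ in \<open>auto simp: X(2) zero_ell2.rep_eq\<close>)
  have bX: "block_diag b X"
    unfolding block_diag_def local_in_def using c(4) by (auto simp: X(2)) metis
  define V' where "V' = (id_blinfun + X) o\<^sub>L V"
  have V'x: "V' x = V x + X (V x)" for x by (simp add: V'_def blinfun.add_left)
  have path1: "path_component (block_GL b) V V'"
    unfolding V'_def by (rule block_GL_unipotent_left[OF X(1) XX bX insert.prems(1)])
  have V'G: "V' \<in> block_GL b"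
    using path_component_mem(2)[OF path1] .
  then have bV': "local_in (\<lambda>i j. b i = b j) V'" by (simp add: block_GL_def block_diag_def)
  have cV': "clinear_op V'" unfolding V'_def by (intro clinear_op_intros X(1) cV)
  have row': "V' x $. i = x $. i" if "p i \<notin> insert q A" for x i
    using that c(1)[of i] by (auto simp: V'x ell2_simps X(2) row)
  have col': "V' x = x" if x: "\<And>i. p i \<in> insert q A \<Longrightarrow> x $. i = 0" for x
  proof -
    have "X x = 0" using c(2) x by (intro ell2_eqI) (auto simp: X(2) zero_ell2.rep_eq)
    then show ?thesis using col[OF x] by (simp add: V'x)
  qed
  \<comment> \<open>The pivots of all blocks together; the value \<open>1\<close> elsewhere makes
    \<open>diag_op a\<close> invertible.\<close>
  define a where "a i = (if p i = q then V' (ket i) $. i else 1)" for i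
  define m where "m = min (\<delta> / 2) 1"
  have m0: "0 < m" using \<delta> by (simp add: m_def)
  have am: "m \<le> cmod (a i)" for i
  proof (cases "p i = q")
    case True
    have ai: "a i = V (ket i) $. i + c i * V (ket i) $. J i"
      using True by (simp add: a_def V'x ell2_simps X(2))
    have "\<delta> / 2 \<le> cmod (a i)"
    proof (cases "cmod (V (ket i) $. i) < \<delta> / 2")
      case less: True
      then have "a i = V (ket i) $. J i + V (ket i) $. i" using True by (simp add: ai c_def)
      then have "cmod (V (ket i) $. J i) - cmod (V (ket i) $. i) \<le> cmod (a i)"
        using norm_diff_ineq by metis
      then show ?thesis using J(3)[OF True] less by simp
    qed (simp add: ai c_def)
    then show ?thesis by (simp add: m_def)
  qed (simp add: a_def m_def)
  have "cmod (a i) \<le> norm V' + 1" for i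
  proof -
    have "cmod (V' (ket i) $. i) \<le> norm V' * norm (ket i)"
      by (rule order_trans[OF ell2_apply_le_norm norm_blinfun])
    then show ?thesis by (simp add: a_def add_increasing)
  qed
  then have ba: "bounded (range a)" by (intro boundedI[where B = "norm V' + 1"]) auto
  note dG = diag_op_block_GL[OF ba m0 am]
  define D D' where "D = diag_op a" and "D' = diag_op (\<lambda>i. 1 / a i)"
  have Dx: "D x $. i = a i * x $. i" "D' x $. i = x $. i / a i" for x i
    by (simp_all add: D_def D'_def ell2_apply_diag_op[OF ba] ell2_apply_diag_op[OF dG(3)])
  have a0: "a i \<noteq> 0" for i using am[of i] m0 by auto
  define E F where "E = {i. p i = q}" and "F = {i. p i \<in> A}"
  have EF: "E \<inter> F = {}" using insert.hyps(2) by (auto simp: E_def F_def)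
  have V'E: "V' (proj E x) $. i = a i * x $. i" if "p i = q" for x i
  proof -
    have "V' (proj E x) $. i = V' (x $. i *\<^sub>C ket i) $. i"
      by (rule local_in_cong[OF bV']) (use inj that in \<open>auto simp: E_def scaleC.rep_eq ket.rep_eq\<close>)
    then show ?thesis using that by (simp add: clinear_opD[OF cV'] scaleC.rep_eq a_def)
  qed
  have V'split: "V' x = V' (proj E x) + V' (proj F x) + proj (- (E \<union> F)) x" for x
  proof -
    have "V' (proj (- (E \<union> F)) x) = proj (- (E \<union> F)) x"
      by (rule col') (auto simp: E_def F_def)
    moreover have "x = proj E x + proj F x + proj (- (E \<union> F)) x"
      using EF by (intro ell2_eqI) (auto simp: ell2_simps)
    ultimately show ?thesis by (metis blinfun.add_right)
  qed
  \<comment> \<open>\<open>C\<close> clears the pivot columns and \<open>Q\<close> the pivot rows.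
    Each maps vectors on one of the sets \<open>E\<close>, \<open>F\<close> to vectors on the other
    and kills the rest, hence squares to zero.\<close>
  define C where "C = proj F o\<^sub>L V' o\<^sub>L proj E o\<^sub>L D'"
  define Q where "Q = proj E o\<^sub>L D' o\<^sub>L V' o\<^sub>L proj F"
  have cD': "clinear_op D'" unfolding D'_def by (rule clinear_diag_op[OF dG(3)])
  have bD': "block_diag b D'"
    unfolding block_diag_def local_in_def by (auto simp: Dx)
  have cC: "clinear_op C" "clinear_op Q"
    unfolding C_def Q_def by (intro clinear_op_intros clinear_proj cV' cD')+
  have bC: "block_diag b C" "block_diag b Q"
    unfolding C_def Q_def using bV'
    by (auto intro!: block_diag_comp block_diag_intros bD' simp: block_diag_def[symmetric])
  have z1: "proj E (D' (proj F x)) = 0" for x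
    using EF by (intro ell2_eqI) (auto simp: Dx ell2_simps)
  have z2: "proj F (proj E x) = 0" for x
    using EF by (intro ell2_eqI) (auto simp: ell2_simps)
  have CC: "C (C x) = 0" "Q (Q x) = 0" for x
    by (simp_all add: C_def Q_def z1 z2 blinfun.zero_right del: proj_proj)
  define W where "W = ((id_blinfun + (-1) *\<^sub>R C) o\<^sub>L V') o\<^sub>L (id_blinfun + (-1) *\<^sub>R Q)"
  have CC': "((-1) *\<^sub>R C) o\<^sub>L ((-1) *\<^sub>R C) = 0" "((-1) *\<^sub>R Q) o\<^sub>L ((-1) *\<^sub>R Q) = 0"
    by (auto intro!: blinfun_eqI simp: blinfun.minus_left blinfun.minus_right CC)
  have path2: "path_component (block_GL b) V' ((id_blinfun + (-1) *\<^sub>R C) o\<^sub>L V')"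
    by (rule block_GL_unipotent_left) (use cC CC' bC V'G in \<open>auto intro: block_diag_minus\<close>)
  have path3: "path_component (block_GL b) ((id_blinfun + (-1) *\<^sub>R C) o\<^sub>L V') W"
    unfolding W_def using path_component_mem(2)[OF path2]
    by (intro block_GL_unipotent_right) (use cC CC' bC V'G in \<open>auto intro: block_diag_minus\<close>)
  have Wx: "W x = V' (x - Q x) - C (V' (x - Q x))" for x
    by (simp add: W_def blinfun.add_left blinfun.minus_left blinfun.diff_left)
  have Qx: "Q x $. i = (if p i = q then V' (proj F x) $. i / a i else 0)" for x i
    by (simp add: Q_def E_def Dx)
  have rowW: "W x $. i = a i * x $. i" if i: "p i \<notin> A" for x i
  proof -
    have "W x $. i = V' (x - Q x) $. i" using i by (simp add: Wx C_def F_def ell2_simps)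
    also have "\<dots> = a i * x $. i"
    proof (cases "p i = q")
      case True
      have "proj E (Q x) = Q x" by (rule ell2_eqI) (simp add: Q_def)
      then have "V' (Q x) $. i = V' (proj F x) $. i" using V'E[OF True, of "Q x"] a0 True by (simp add: Qx)
      moreover have "V' x $. i = a i * x $. i + V' (proj F x) $. i"
        by (subst V'split) (use True V'E[OF True] in \<open>simp add: ell2_simps E_def\<close>)
      ultimately show ?thesis by (simp add: blinfun.diff_right ell2_simps)
    next
      case False
      then show ?thesis using i row'[of i] by (simp add: a_def ell2_simps Qx)
    qed
    finally show ?thesis .
  qed
  have colW: "W x = D x" if x: "\<And>i. p i \<in> A \<Longrightarrow> x $. i = 0" for x
  proof (rule ell2_eqI)
    fix i
    have Fx: "proj F x = 0" using x by (simp add: proj_eq_0_iff F_def)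
    have Qx0: "Q x = 0" by (simp add: Q_def Fx blinfun.zero_right)
    show "W x $. i = D x $. i"
    proof (cases "p i \<in> A")
      case True
      have Vx: "V' x = V' (proj E x) + proj (- (E \<union> F)) x"
        using V'split[of x] by (simp add: Fx blinfun.zero_right)
      have "proj E (D' (V' x)) = proj E x"
        using V'E a0 by (intro ell2_eqI) (auto simp: Vx Dx ell2_simps E_def)
      then have "C (V' x) = proj F (V' (proj E x))" by (simp add: C_def)
      then have "W x $. i = 0"
        using True by (simp add: Wx Qx0 Vx ell2_simps F_def)
      then show ?thesis using x[OF True] by (simp add: Dx)
    qed (simp add: rowW Dx)
  qed
  \<comment> \<open>Dividing by the pivots turns the rows and columns at \<open>q\<close> into those
    of the identity, as the induction hypothesis for \<open>A\<close> requires.\<close>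
  define W' where "W' = D' o\<^sub>L W"
  have D'G: "D' \<in> block_GL b"
    using op_inverse_sym[OF dG(2)] bD' by (auto simp: block_GL_def invertible_op_def D'_def)
  have "path_component (block_GL b) W' id_blinfun"
  proof (rule insert.IH)
    show "W' \<in> block_GL b"
      unfolding W'_def by (rule block_GL_comp[OF D'G path_component_mem(2)[OF path3]])
    show "W' x $. i = x $. i" if "p i \<notin> A" for x i
      using rowW[OF that] a0 by (simp add: W'_def Dx)
    show "W' x = x" if "\<And>i. p i \<in> A \<Longrightarrow> x $. i = 0" for x
      using colW[OF that] a0 by (intro ell2_eqI) (simp add: W'_def Dx)
  qed
  then have "path_component (block_GL b) (D o\<^sub>L W') (D o\<^sub>L id_blinfun)"
    by (rule path_component_image[OF _ continuous_on_compose_left])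
      (use dG(1) in \<open>auto simp: D_def intro: block_GL_comp\<close>)
  moreover have "D o\<^sub>L W' = W"
    by (intro blinfun_eqI ell2_eqI) (simp add: W'_def Dx a0)
  moreover have "D o\<^sub>L id_blinfun = D" by (rule blinfun_eqI) simp
  moreover have "path_component (block_GL b) D id_blinfun"
    unfolding D_def by (rule diag_op_connected[OF ba m0 am])
  ultimately have "path_component (block_GL b) W id_blinfun"
    using path_component_trans by metis
  then show ?case using path1 path2 path3 path_component_trans by metis
qed

text \<open>Finiteness of \<open>range p\<close>, with \<open>p\<close> injective on each block,
  bounds the size of the blocks; the elimination starts with no position split off.\<close>

lemma block_GL_connected:
  fixes b :: "'i \<Rightarrow> 'k" and p :: "'i \<Rightarrow> 'p"
  assumes "\<And>i j. b i = b j \<Longrightarrow> p i = p j \<Longrightarrow> i = j" "finite (range p)" "V \<in> block_GL b"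
  shows "path_component (block_GL b) V id_blinfun"
proof (rule block_GL_elimination[OF assms])
  show "V x = x" if "\<And>i. p i \<in> range p \<Longrightarrow> x $. i = 0" for x
  proof -
    have "x = 0" using that by (intro ell2_eqI) (simp add: zero_ell2.rep_eq)
    then show ?thesis by (simp add: blinfun.zero_right)
  qed
qed auto

subsection \<open>Cutting a banded invertible operator\<close>

lemma norm_orthonormal_family:
  assumes "orthonormal (v ` I)" "inj_on v I" "finite I"
  shows "(norm (\<Sum>i\<in>I. u i *\<^sub>C v i))\<^sup>2 = (\<Sum>i\<in>I. (cmod (u i))\<^sup>2)"
proof -
  have "(norm (\<Sum>w\<in>v ` I. u (inv_into I v w) *\<^sub>C w))\<^sup>2 = (\<Sum>w\<in>v ` I. (cmod (u (inv_into I v w)))\<^sup>2)"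
    by (rule norm_orthonormal_sum) (use assms in auto)
  then show ?thesis using assms(2) by (simp add: sum.reindex)
qed

lemma norm_proj_finite:
  assumes "finite I"
  shows "(norm (proj I x))\<^sup>2 = (\<Sum>i\<in>I. (cmod (x $. i))\<^sup>2)"
proof -
  have "proj I x = (\<Sum>i\<in>I. x $. i *\<^sub>C ket i)"
    by (rule ell2_eqI) (simp add: sum_ket_apply[OF assms])
  then show ?thesis
    using norm_orthonormal_family[OF orthonormal_ket inj_on_subset[OF inj_ket subset_UNIV] assms] by simp
qed

text \<open>The basis vectors with index in \<open>I\<close> go to an orthonormal basis of
  \<open>V\<close>, all others to zero. An operator on the whole space avoids a separate type for
  \<open>V\<close>.\<close>

lemma coordinate_isometry:
  fixes I :: "'i set"
  assumes I: "finite I" and V: "finite_cdim V" and card: "card I = ell2.dim V"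
  obtains J where "clinear_op J" "\<And>x. J x \<in> V" "\<And>x. norm (J x) = norm (proj I x)"
    "\<And>x. J (proj I x) = J x" "\<And>y. y \<in> V \<Longrightarrow> \<exists>x. J x = y"
proof -
  obtain B where B: "finite B" "orthonormal B" "ell2.span B = V" "card B = ell2.dim V"
    using orthonormal_basis[OF V] .
  obtain v where v: "bij_betw v I B"
    using finite_same_card_bij[OF I B(1)] card B(4) by auto
  then have vI: "inj_on v I" "v ` I = B" by (auto simp: bij_betw_def)
  have nrm: "norm (\<Sum>j\<in>I. x $. j *\<^sub>C v j) = norm (proj I x)" for x
  proof -
    have "(norm (\<Sum>j\<in>I. x $. j *\<^sub>C v j))\<^sup>2 = (norm (proj I x))\<^sup>2"
      using norm_orthonormal_family[of v I] vI B(2) I by (simp add: norm_proj_finite)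
    then show ?thesis by (simp add: power2_eq_iff_nonneg)
  qed
  have bd: "(\<Sum>i\<in>F. (cmod (\<Sum>j\<in>I. x $. j * v j $. i))\<^sup>2) \<le> (1 * norm x)\<^sup>2" if F: "finite F" for x F
  proof -
    have "(\<Sum>i\<in>F. (cmod (\<Sum>j\<in>I. x $. j * v j $. i))\<^sup>2)
        = (\<Sum>i\<in>F. (cmod ((\<Sum>j\<in>I. x $. j *\<^sub>C v j) $. i))\<^sup>2)"
      by (simp add: ell2_apply_sum scaleC.rep_eq)
    also have "\<dots> \<le> (norm (proj I x))\<^sup>2"
      using ell2_sum_le_norm[OF F, of "\<Sum>j\<in>I. x $. j *\<^sub>C v j"] by (simp only: nrm)
    also have "\<dots> \<le> (1 * norm x)\<^sup>2" by (simp add: norm_proj_le)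
    finally show ?thesis .
  qed
  obtain J where J: "clinear_op J" "\<And>x i. J x $. i = (\<Sum>j\<in>I. x $. j * v j $. i)"
    by (rule operator_from_components[of "\<lambda>x i. \<Sum>j\<in>I. x $. j * v j $. i" 1, OF _ _ bd])
      (auto simp: ell2_simps distrib_right sum.distrib sum_distrib_left mult.assoc)
  have Jx: "J x = (\<Sum>j\<in>I. x $. j *\<^sub>C v j)" for x
    by (rule ell2_eqI) (simp add: J(2) ell2_apply_sum scaleC.rep_eq)
  show ?thesis
  proof (rule that[OF J(1)])
    show "J x \<in> V" for x
      unfolding Jx B(3)[symmetric] using vI by (intro ell2.span_sum ell2.span_scale ell2.span_base) auto
    show "norm (J x) = norm (proj I x)" for x by (simp only: Jx nrm)
    show "J (proj I x) = J x" for x by (simp add: Jx cong: sum.cong)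
    fix y assume "y \<in> V"
    then obtain u where "y = (\<Sum>w\<in>B. u w *\<^sub>C w)"
      using ell2.span_finite[OF B(1)] B(3) by auto
    also have "\<dots> = (\<Sum>j\<in>I. u (v j) *\<^sub>C v j)"
      using vI by (metis (no_types, lifting) sum.reindex_cong)
    also have "\<dots> = J (\<Sum>j\<in>I. u (v j) *\<^sub>C ket j)"
      unfolding Jx by (intro sum.cong) (simp_all add: sum_ket_apply[OF I])
    finally show "\<exists>x. J x = y" by metis
  qed
qed

text \<open>By \<open>comm\<close> each \<open>A k\<close> preserves the block \<open>k\<close> and
  its complement, so the direct sum can use its action on the block and ignore the rest.\<close>

lemma block_sum:
  fixes b :: "'i \<Rightarrow> 'k"
  assumes "\<And>k. clinear_op (A k)" "\<And>k x. norm (A k x) \<le> C * norm x" "0 \<le> C"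
    and comm: "\<And>k x. A k (proj (b -` {k}) x) = proj (b -` {k}) (A k x)"
  obtains V where "clinear_op V" "norm V \<le> C" "block_diag b V"
    "\<And>k x. proj (b -` {k}) (V x) = A k (proj (b -` {k}) x)"
proof -
  have bd: "(\<Sum>i\<in>F. (cmod (A (b i) x $. i))\<^sup>2) \<le> (C * norm x)\<^sup>2" if "finite F" for x F
  proof -
    have "norm (proj (b -` {k}) (A k x)) \<le> C * norm (proj (b -` {k}) x)" for k
      using assms(2)[of k "proj (b -` {k}) x"] by (simp add: comm)
    from ell2_glue[of "\<lambda>k. proj (b -` {k}) (A k x)" C b x, OF this \<open>0 \<le> C\<close>]
    obtain y where y: "\<And>i. y $. i = A (b i) x $. i" "norm y \<le> C * norm x" by auto
    have "(\<Sum>i\<in>F. (cmod (A (b i) x $. i))\<^sup>2) \<le> (norm y)\<^sup>2"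
      using ell2_sum_le_norm[OF that, of y] by (simp add: y)
    also have "\<dots> \<le> (C * norm x)\<^sup>2" by (intro power_mono y) simp
    finally show ?thesis .
  qed
  obtain V where V: "clinear_op V" "\<And>x i. V x $. i = A (b i) x $. i" "norm V \<le> C"
    by (rule operator_from_components[of "\<lambda>x i. A (b i) x $. i" C, OF _ _ bd])
      (use assms in \<open>auto simp: ell2_simps blinfun.add_right clinear_opD\<close>)
  have blk: "proj (b -` {k}) (V x) = A k (proj (b -` {k}) x)" for k x
    unfolding comm by (rule ell2_eqI) (auto simp: V(2))
  have "block_diag b V"
    unfolding block_diag_def local_in_def
  proof (intro allI impI)
    fix x i assume "\<forall>j. b i = b j \<longrightarrow> x $. j = 0"
    then have "proj (b -` {b i}) x = 0" by (auto simp: proj_eq_0_iff)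
    then have "proj (b -` {b i}) (V x) = 0" by (simp add: blk blinfun.zero_right)
    then show "V x $. i = 0" by (simp add: proj_eq_0_iff)
  qed
  then show ?thesis using that V blk by blast
qed

lemma vector_eq_by_blocks:
  assumes "\<And>k. proj (b -` {k}) x = proj (b -` {k}) y"
  shows "x = y"
proof (rule ell2_eqI)
  fix i
  have "proj (b -` {b i}) x $. i = proj (b -` {b i}) y $. i" by (simp only: assms)
  then show "x $. i = y $. i" by simp
qed

text \<open>Invertibility of every block alone does not make the direct sum invertible; the bound
  \<open>K\<close> common to all inverses does.\<close>

lemma block_sum_inverse:
  fixes b :: "'i \<Rightarrow> 'k"
  assumes inv: "\<And>k. op_inverse (A k) (B k)"
    and bdd: "\<And>k x. norm (A k x) \<le> C * norm x" "0 \<le> C" "\<And>k x. norm (B k x) \<le> K * norm x" "0 \<le> K"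
    and comm: "\<And>k x. A k (proj (b -` {k}) x) = proj (b -` {k}) (A k x)"
  obtains V V' where "op_inverse V V'" "norm V' \<le> K" "block_diag b V"
    "\<And>k x. proj (b -` {k}) (V x) = A k (proj (b -` {k}) x)"
proof -
  have cA: "clinear_op (A k)" "clinear_op (B k)" "A k (B k x) = x" "B k (A k x) = x" for k x
    using inv[of k] by (auto simp: op_inverse_def)
  have commB: "B k (proj (b -` {k}) x) = proj (b -` {k}) (B k x)" for k x
    using comm[of k "B k x"] by (metis cA(3,4))
  obtain V where V: "clinear_op V" "block_diag b V"
    "\<And>k x. proj (b -` {k}) (V x) = A k (proj (b -` {k}) x)"
    using block_sum[OF cA(1) bdd(1,2) comm] by metis
  obtain V' where V': "clinear_op V'" "norm V' \<le> K"
    "\<And>k x. proj (b -` {k}) (V' x) = B k (proj (b -` {k}) x)"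
    using block_sum[OF cA(2) bdd(3,4) commB] by metis
  have "op_inverse V V'"
    unfolding op_inverse_def
  proof (intro conjI allI V(1) V'(1))
    show "V (V' x) = x" for x by (rule vector_eq_by_blocks[of b]) (simp only: V(3) V'(3) cA)
    show "V' (V x) = x" for x by (rule vector_eq_by_blocks[of b]) (simp only: V(3) V'(3) cA)
  qed
  then show ?thesis using that V V' by blast
qed

section \<open>The window around a single cut\<close>

context banded_invertible
begin

abbreviation cocut_space :: "int \<Rightarrow> int \<Rightarrow> (int \<times> 'w) ell2 set" where
  "cocut_space n m \<equiv> {x \<in> coord_space (up m). S x \<in> coord_space (- up n)}"

lemma finite_cdim_cocut_space: "finite_cdim (cocut_space n m)"
proof (rule finite_cdim_support)
  show "\<exists>Q::(int \<times> 'w) set. finite Q \<and> (\<forall>i\<in>up m - Q. \<forall>j\<in>- (up n :: (int \<times> 'w) set). l < \<bar>fst i - fst j\<bar>)" for l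
    by (intro exI[of _ "slab m (n + l + 1)"]) auto
qed

text \<open>The window of half-width \<open>l\<close> around \<open>n\<close> is the direct sum, up to small tails, of
  the cut space (which \<open>S\<close> maps to the right of \<open>n\<close>) and the cocut space (mapped to the left of
  \<open>n\<close>). Mapping a set \<open>I\<close> of coordinates of the window onto the first summand, and the others onto
  the second one, therefore almost makes \<open>S\<close> respect the cut.\<close>

lemma window_operator:
  assumes l: "R \<le> l" and e0: "0 \<le> e" and e: "4 * e * (norm S)\<^sup>2 * norm B \<le> 1"
    and tail: "\<And>X Y x. (\<And>i j. i \<in> X \<Longrightarrow> j \<in> Y \<Longrightarrow> l < \<bar>fst i - fst j\<bar>) \<Longrightarrow>
      norm (proj X (B (proj Y x))) \<le> e * norm x"
    and I: "I \<subseteq> slab (n - l) (n + l)" "card I = ell2.dim (cut_space S n (n + l))"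
  obtains A A' where "op_inverse A A'" "\<And>x. norm (A x) \<le> 3 * norm x"
    "\<And>x. norm (A' x) \<le> (4 * norm B * norm S + 1) * norm x"
    "\<And>x. A (proj (slab (n - l) (n + l)) x) = proj (slab (n - l) (n + l)) (A x)"
    "\<And>x. norm (proj (- up n) (S (A (proj I x)))) \<le> e * (norm S)\<^sup>2 * norm x"
    "\<And>x. norm (proj (up n) (S (A (proj (slab (n - l) (n + l) - I) x)))) \<le> e * (norm S)\<^sup>2 * norm x"
proof -
  define s where "s = norm S"
  define \<beta> where "\<beta> = norm B"
  have s: "0 < s" "0 < \<beta>" using norm_S_pos norm_B_pos by (auto simp: s_def \<beta>_def)
  define Q where "Q = (slab (n - l) (n + l) :: (int \<times> 'w) set)"
  define E F where "E = cut_space S n (n + l)" and "F = cocut_space n (n - l)"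
  have fin: "finite_cdim E" "finite_cdim F"
    unfolding E_def F_def by (rule finite_cdim_cut_space finite_cdim_cocut_space)+
  have EF: "e \<in> coord_space (- up (n + l))" "S e \<in> coord_space (up n)" if "e \<in> E" for e
    using that by (auto simp: E_def cut_space_def)
  have FF: "f \<in> coord_space (up (n - l))" "S f \<in> coord_space (- up n)" if "f \<in> F" for f
    using that by (auto simp: F_def)
  have nS: "norm (S x) \<le> s * norm x" for x unfolding s_def by (rule norm_blinfun)
  have lowS: "norm x \<le> \<beta> * norm (S x)" for x unfolding \<beta>_def by (rule op_inverse_lower_bound[OF inv])
  \<comment> \<open>\<open>x\<close> is \<open>B (S x)\<close> with \<open>S x\<close> to the right
    of \<open>n\<close>, hence almost nothing of it lies further than \<open>l\<close> to the left
    of \<open>n\<close>.\<close>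
  have tE: "norm (proj (- up (n - l)) x) \<le> e * s * norm x" if "x \<in> E" for x
  proof -
    have "norm (proj (- up (n - l)) (B (proj (up n) (S x)))) \<le> e * norm (S x)" by (rule tail) auto
    also have "\<dots> \<le> e * (s * norm x)" by (intro mult_left_mono nS e0)
    finally show ?thesis using EF(2)[OF that] by simp
  qed
  have tF: "norm (proj (up (n + l)) x) \<le> e * s * norm x" if "x \<in> F" for x
  proof -
    have "norm (proj (up (n + l)) (B (proj (- up n) (S x)))) \<le> e * norm (S x)" by (rule tail) auto
    also have "\<dots> \<le> e * (s * norm x)" by (intro mult_left_mono nS e0)
    finally show ?thesis using FF(2)[OF that] by simp
  qed
  have outE: "x - proj Q x = proj (- up (n - l)) x" if "x \<in> E" for x
    using EF(1)[OF that] by (intro ell2_eqI) (auto simp: Q_def ell2_simps coord_space_iff)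
  have outF: "x - proj Q x = proj (up (n + l)) x" if "x \<in> F" for x
    using FF(1)[OF that] by (intro ell2_eqI) (auto simp: Q_def ell2_simps coord_space_iff)
  have splitE: "proj (up n) (S (x + y)) = S x" and splitF: "proj (- up n) (S (x + y)) = S y"
    if "x \<in> E" "y \<in> F" for x y
    using EF(2)[OF that(1)] FF(2)[OF that(2)]
    by (auto intro!: ell2_eqI simp: blinfun.add_right ell2_simps coord_space_iff)
  \<comment> \<open>Cutting \<open>S (x + y)\<close> at \<open>n\<close> recovers \<open>S x\<close>
    and \<open>S y\<close>, so \<open>x\<close> and \<open>y\<close> are controlled by
    \<open>x + y\<close>. The smallness of \<open>e\<close> makes the part of \<open>x + y\<close>
    outside the window at most half of it in norm.\<close>
  have lower: "norm x + norm y \<le> 4 * \<beta> * s * norm (proj Q (x + y))" if xy: "x \<in> E" "y \<in> F" for x y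
  proof -
    have "norm x \<le> \<beta> * norm (proj (up n) (S (x + y)))" using lowS[of x] splitE[OF xy] by simp
    also have "\<dots> \<le> \<beta> * (s * norm (x + y))"
      using s by (intro mult_left_mono order_trans[OF norm_proj_le nS]) simp
    finally have 1: "norm x \<le> \<beta> * s * norm (x + y)" by simp
    have "norm y \<le> \<beta> * norm (proj (- up n) (S (x + y)))" using lowS[of y] splitF[OF xy] by simp
    also have "\<dots> \<le> \<beta> * (s * norm (x + y))"
      using s by (intro mult_left_mono order_trans[OF norm_proj_le nS]) simp
    finally have 2: "norm y \<le> \<beta> * s * norm (x + y)" by simp
    have "norm ((x + y) - proj Q (x + y)) \<le> norm (x - proj Q x) + norm (y - proj Q y)"
      using norm_triangle_ineq[of "x - proj Q x" "y - proj Q y"] by (simp add: blinfun.add_right algebra_simps)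
    also have "\<dots> \<le> e * s * (norm x + norm y)"
      using tE[OF xy(1)] tF[OF xy(2)] by (simp add: outE[OF xy(1)] outF[OF xy(2)] distrib_left)
    also have "\<dots> \<le> e * s * (2 * (\<beta> * s * norm (x + y)))"
      using 1 2 e0 s by (intro mult_left_mono) auto
    also have "\<dots> = (4 * e * s\<^sup>2 * \<beta>) * norm (x + y) / 2" by (simp add: power2_eq_square)
    also have "\<dots> \<le> 1 * norm (x + y) / 2"
      using e by (intro divide_right_mono mult_right_mono) (auto simp: s_def \<beta>_def)
    finally have "norm (x + y) \<le> 2 * norm (proj Q (x + y))"
      using norm_triangle_ineq2[of "x + y" "proj Q (x + y)"] by simp
    then have "2 * (\<beta> * s * norm (x + y)) \<le> 2 * (\<beta> * s * (2 * norm (proj Q (x + y))))"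
      using s by (intro mult_left_mono) auto
    then show ?thesis using 1 2 by simp
  qed
  \<comment> \<open>Cut \<open>S z\<close> at \<open>n\<close> and pull both halves back. Removing
    the far right of \<open>p\<close> and the far left of \<open>q\<close> respects the conditions
    on the images because \<open>R \<le> l\<close>, and changes nothing inside the window.\<close>
  have surj: "\<exists>x\<in>E. \<exists>y\<in>F. proj Q (x + y) = z" if z: "z \<in> coord_space Q" for z
  proof -
    define p where "p = B (proj (up n) (S z))"
    define q where "q = B (proj (- up n) (S z))"
    have pq: "z = p + q"
      unfolding p_def q_def by (metis BS blinfun.add_right proj_compl_add)
    have "S (proj (up (n + l)) p) \<in> coord_space (up n)"
      by (rule S_up[OF proj_in_coord_space]) (use l in simp)
    moreover have "S (proj (- up (n + l)) p) = proj (up n) (S z) - S (proj (up (n + l)) p)"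
      using proj_compl_add[of "up (n + l)" p] by (metis SB add_diff_cancel_left' blinfun.add_right p_def)
    ultimately have x: "proj (- up (n + l)) p \<in> E"
      by (auto simp: E_def cut_space_def intro!: ell2.subspace_diff[OF subspace_coord_space])
    have "S (proj (- up (n - l)) q) \<in> coord_space (- up n)"
      by (rule S_down[OF proj_in_coord_space]) (use l in simp)
    moreover have "S (proj (up (n - l)) q) = proj (- up n) (S z) - S (proj (- up (n - l)) q)"
      using proj_compl_add[of "up (n - l)" q] by (metis SB add_diff_cancel_right' blinfun.add_right q_def)
    ultimately have y: "proj (up (n - l)) q \<in> F"
      by (auto simp: F_def intro!: ell2.subspace_diff[OF subspace_coord_space])
    have "proj Q (proj (- up (n + l)) p + proj (up (n - l)) q) = proj Q z"
      by (rule ell2_eqI) (auto simp: pq ell2_simps Q_def)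
    then show ?thesis using x y z by auto
  qed
  \<comment> \<open>\<open>proj Q\<close> identifies \<open>E + F\<close> with the coordinates of
    the window, while cutting images under \<open>S\<close> at \<open>n\<close> shows that its
    dimension is that of \<open>E\<close> plus that of \<open>F\<close>.\<close>
  have dims: "ell2.dim E + ell2.dim F = card Q"
  proof -
    define V where "V = {x + y | x y. x \<in> E \<and> y \<in> F}"
    obtain BE BF where BEF: "finite BE" "E = ell2.span BE" "finite BF" "F = ell2.span BF"
      using fin by (auto simp: finite_cdim_def)
    have V: "finite_cdim V"
      unfolding finite_cdim_def using BEF
      by (intro exI[of _ "BE \<union> BF"]) (auto simp: V_def ell2.span_Un)
    have "0 \<in> E" "0 \<in> F" using fin finite_cdim_subspace ell2.subspace_0 by blast+
    have "proj Q ` V = coord_space Q"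
    proof (intro subset_antisym subsetI)
      fix z assume "z \<in> coord_space Q"
      then show "z \<in> proj Q ` V" using surj[of z] by (auto simp: V_def)
    qed auto
    moreover have "ell2.dim (proj Q ` V) = ell2.dim V"
    proof (rule dim_image_inj[OF clinear_proj V])
      fix z assume "z \<in> V" "proj Q z = 0"
      then obtain x y where "x \<in> E" "y \<in> F" "z = x + y" by (auto simp: V_def)
      moreover from this have "norm x + norm y \<le> 0" using lower[of x y] \<open>proj Q z = 0\<close> by simp
      then have "norm x = 0" "norm y = 0" using norm_ge_zero[of x] norm_ge_zero[of y] by linarith+
      ultimately show "z = 0" by simp
    qed
    ultimately have "ell2.dim V = card Q" by (simp add: coord_space_finite Q_def)
    define P where "P = proj (up n) o\<^sub>L S"
    have cP: "clinear_op P" unfolding P_def by (intro clinear_op_intros clinear_proj clinear_S)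
    have "{z \<in> V. P z = 0} = F"
    proof (intro subset_antisym subsetI)
      fix z assume "z \<in> {z \<in> V. P z = 0}"
      then show "z \<in> F" by (auto simp: V_def P_def splitE)
    next
      fix z assume "z \<in> F"
      then show "z \<in> {z \<in> V. P z = 0}"
        using splitE[OF \<open>0 \<in> E\<close>, of z] \<open>0 \<in> E\<close> by (force simp: V_def P_def blinfun.zero_right)
    qed
    moreover have "P ` V = S ` E"
    proof (intro subset_antisym subsetI)
      fix z assume "z \<in> P ` V"
      then show "z \<in> S ` E" by (auto simp: V_def P_def splitE)
    next
      fix z assume "z \<in> S ` E"
      then obtain x where x: "x \<in> E" "z = S x" by auto
      then have "z = P (x + 0)" "x + 0 \<in> V" using splitE[OF x(1) \<open>0 \<in> F\<close>] \<open>0 \<in> F\<close>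
        by (auto simp: P_def V_def simp del: add_0_right)
      then show "z \<in> P ` V" by blast
    qed
    moreover have "ell2.dim (S ` E) = ell2.dim E" by (rule dim_image_inj[OF clinear_S fin(1)]) simp
    ultimately show ?thesis using rank_nullity[OF cP V] \<open>ell2.dim V = card Q\<close> by simp
  qed
  have finI: "finite I" "finite (Q - I)" using I(1) by (auto simp: Q_def intro: finite_subset)
  obtain JE where JE: "clinear_op JE" "\<And>x. JE x \<in> E" "\<And>x. norm (JE x) = norm (proj I x)"
    "\<And>x. JE (proj I x) = JE x" "\<And>y. y \<in> E \<Longrightarrow> \<exists>x. JE x = y"
    using coordinate_isometry[OF finI(1) fin(1)] I(2) unfolding E_def by blast
  have "card (Q - I) = ell2.dim F"
    using dims I card_Diff_subset[OF finI(1)] by (simp add: Q_def E_def)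
  then obtain JF where JF: "clinear_op JF" "\<And>x. JF x \<in> F" "\<And>x. norm (JF x) = norm (proj (Q - I) x)"
    "\<And>x. JF (proj (Q - I) x) = JF x" "\<And>y. y \<in> F \<Longrightarrow> \<exists>x. JF x = y"
    using coordinate_isometry[OF finI(2) fin(2)] by blast
  \<comment> \<open>Basis vectors in \<open>I\<close> go to \<open>E\<close>, those in the rest of
    the window to \<open>F\<close>, both truncated so that different windows do not interact.
    Outside the window \<open>A\<close> is the identity.\<close>
  define A where "A = (proj Q o\<^sub>L (JE + JF)) + proj (- Q)"
  have Ax: "A x = proj Q (JE x + JF x) + proj (- Q) x" for x by (simp add: A_def blinfun.add_left)
  have cA: "clinear_op A" unfolding A_def by (intro clinear_op_intros clinear_proj JE JF)
  have AQ: "proj Q (A x) = proj Q (JE x + JF x)" "proj (- Q) (A x) = proj (- Q) x" for x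
    by (auto intro!: ell2_eqI simp: Ax ell2_simps)
  have upper: "norm (A x) \<le> 3 * norm x" for x
  proof -
    have "norm (A x) \<le> norm (JE x + JF x) + norm (proj (- Q) x)"
      unfolding Ax by (rule order_trans[OF norm_triangle_ineq add_right_mono[OF norm_proj_le]])
    also have "\<dots> \<le> (norm (JE x) + norm (JF x)) + norm (proj (- Q) x)"
      by (intro add_right_mono norm_triangle_ineq)
    also have "\<dots> \<le> 3 * norm x"
      using norm_proj_le[of I x] norm_proj_le[of "Q - I" x] norm_proj_le[of "- Q" x] by (simp add: JE JF)
    finally show ?thesis .
  qed
  have QI: "proj Q x = proj I x + proj (Q - I) x" for x
    using I(1) by (intro ell2_eqI) (auto simp: Q_def ell2_simps)
  have below: "norm x \<le> (4 * \<beta> * s + 1) * norm (A x)" for x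
  proof -
    have "norm (proj Q x) \<le> norm (JE x) + norm (JF x)"
      unfolding QI JE JF by (rule norm_triangle_ineq)
    also have "\<dots> \<le> 4 * \<beta> * s * norm (proj Q (A x))" unfolding AQ by (rule lower[OF JE(2) JF(2)])
    also have "\<dots> \<le> 4 * \<beta> * s * norm (A x)" using s by (intro mult_left_mono norm_proj_le) simp
    finally have "norm (proj Q x) \<le> 4 * \<beta> * s * norm (A x)" .
    moreover have "norm (proj (- Q) x) \<le> norm (A x)" by (metis AQ(2) norm_proj_le)
    moreover have "norm x \<le> norm (proj Q x) + norm (proj (- Q) x)"
      by (metis norm_triangle_ineq proj_compl_add)
    ultimately show ?thesis by (simp add: distrib_right)
  qed
  have "\<exists>x. A x = y" for y
  proof -
    obtain u v where uv: "u \<in> E" "v \<in> F" "proj Q (u + v) = proj Q y" using surj[of "proj Q y"] by auto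
    obtain x1 x2 where x12: "JE x1 = u" "JF x2 = v" using JE(5)[OF uv(1)] JF(5)[OF uv(2)] by auto
    define x where "x = proj I x1 + proj (Q - I) x2 + proj (- Q) y"
    have "proj I x = proj I x1" "proj (Q - I) x = proj (Q - I) x2" "proj (- Q) x = proj (- Q) y"
      using I(1) by (auto intro!: ell2_eqI simp: x_def ell2_simps Q_def)
    then have "A x = proj Q (u + v) + proj (- Q) y"
      unfolding Ax by (metis JE(4) JF(4) x12)
    then show ?thesis using uv(3) by (metis proj_compl_add)
  qed
  from op_inverse_of_bounded_below[OF cA below this]
  obtain A' where A': "op_inverse A A'" "\<And>x. norm (A' x) \<le> (4 * \<beta> * s + 1) * norm x" by blast
  have JEQ: "JE (proj Q x) = JE x" "JF (proj Q x) = JF x" for x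
  proof -
    have "proj I (proj Q x) = proj I x" "proj (Q - I) (proj Q x) = proj (Q - I) x"
      using I(1) by (auto intro!: ell2_eqI simp: Q_def)
    then show "JE (proj Q x) = JE x" "JF (proj Q x) = JF x" by (metis JE(4), metis JF(4))
  qed
  have JI: "A (proj I x) = proj Q (JE x)" "A (proj (Q - I) x) = proj Q (JF x)" for x
  proof -
    have "proj (Q - I) (proj I x) = 0" "proj I (proj (Q - I) x) = 0"
      by (auto intro!: ell2_eqI simp: zero_ell2.rep_eq)
    then have "JF (proj I x) = 0" "JE (proj (Q - I) x) = 0"
      by (metis JF(4) blinfun.zero_right, metis JE(4) blinfun.zero_right)
    moreover have "proj (- Q) (proj I x) = 0" "proj (- Q) (proj (Q - I) x) = 0"
      using I(1) by (auto intro!: ell2_eqI simp: zero_ell2.rep_eq Q_def)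
    ultimately show "A (proj I x) = proj Q (JE x)" "A (proj (Q - I) x) = proj Q (JF x)"
      unfolding Ax by (simp_all add: JE(4) JF(4) del: proj_proj)
  qed
  show ?thesis
  proof (rule that[OF A'(1) upper])
    show "norm (A' x) \<le> (4 * norm B * norm S + 1) * norm x" for x
      using A'(2)[of x] by (simp add: \<beta>_def s_def)
    show "A (proj (slab (n - l) (n + l)) x) = proj (slab (n - l) (n + l)) (A x)" for x
      unfolding Q_def[symmetric] AQ(1) unfolding Ax JEQ
      by (rule ell2_eqI) (auto simp: ell2_simps)
    show "norm (proj (- up n) (S (A (proj I x)))) \<le> e * (norm S)\<^sup>2 * norm x" for x
    proof -
      \<comment> \<open>Before truncation the image under \<open>S\<close> has nothing to the left
        of \<open>n\<close>; only the small tail that is cut off contributes.\<close>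
      have "A (proj I x) = JE x - proj (- up (n - l)) (JE x)"
        unfolding JI outE[OF JE(2), symmetric] by simp
      then have "proj (- up n) (S (A (proj I x))) = - proj (- up n) (S (proj (- up (n - l)) (JE x)))"
        using EF(2)[OF JE(2), of x]
        by (intro ell2_eqI) (auto simp: blinfun.diff_right ell2_simps coord_space_iff)
      then have "norm (proj (- up n) (S (A (proj I x)))) \<le> s * norm (proj (- up (n - l)) (JE x))"
        using order_trans[OF norm_proj_le nS] by simp
      also have "\<dots> \<le> s * (e * s * norm (JE x))" using s by (intro mult_left_mono tE JE(2)) simp
      also have "\<dots> \<le> s * (e * s * norm x)"
        using s e0 unfolding JE(3) by (intro mult_left_mono norm_proj_le) simp_all
      finally show ?thesis by (simp add: s_def power2_eq_square mult_ac)
    qed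
    show "norm (proj (up n) (S (A (proj (slab (n - l) (n + l) - I) x)))) \<le> e * (norm S)\<^sup>2 * norm x" for x
    proof -
      have "A (proj (Q - I) x) = JF x - proj (up (n + l)) (JF x)"
        unfolding JI outF[OF JF(2), symmetric] by simp
      then have "proj (up n) (S (A (proj (Q - I) x))) = - proj (up n) (S (proj (up (n + l)) (JF x)))"
        using FF(2)[OF JF(2), of x]
        by (intro ell2_eqI) (auto simp: blinfun.diff_right ell2_simps coord_space_iff)
      then have "norm (proj (up n) (S (A (proj (Q - I) x)))) \<le> s * norm (proj (up (n + l)) (JF x))"
        using order_trans[OF norm_proj_le nS] by simp
      also have "\<dots> \<le> s * (e * s * norm (JF x))" using s by (intro mult_left_mono tF JF(2)) simp
      also have "\<dots> \<le> s * (e * s * norm x)"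
        using s e0 unfolding JF(3) by (intro mult_left_mono norm_proj_le) simp_all
      finally show ?thesis by (simp add: s_def Q_def power2_eq_square mult_ac)
    qed
  qed
qed

end

section \<open>Banded invertible operators and permutations of the basis\<close>

definition banded_GL :: "((int \<times> 'w::finite) ell2 \<Rightarrow>\<^sub>L (int \<times> 'w) ell2) set" where
  "banded_GL = {A. invertible_op A \<and> (\<exists>R. banded R A)}"

lemma banded_GL_comp: "A \<in> banded_GL \<Longrightarrow> B \<in> banded_GL \<Longrightarrow> A o\<^sub>L B \<in> banded_GL"
  unfolding banded_GL_def using invertible_op_comp banded_comp by blast

lemma int_div_eq_iff:
  fixes x d k :: int
  assumes "0 < d"
  shows "x div d = k \<longleftrightarrow> d * k \<le> x \<and> x < d * k + d"
proof
  assume "x div d = k"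
  then have "x = d * k + x mod d" by auto
  then show "d * k \<le> x \<and> x < d * k + d"
    using pos_mod_bound[OF assms, of x] pos_mod_sign[OF assms, of x] by linarith
next
  assume "d * k \<le> x \<and> x < d * k + d"
  then show "x div d = k" by (intro int_div_pos_eq[of _ _ _ "x - d * k"]) auto
qed

lemma banded_block_diag:
  assumes "0 < d" "block_diag (\<lambda>i. (fst i + c) div d) V"
  shows "banded d V"
  unfolding banded_def
proof (rule local_in_mono[OF assms(2)[unfolded block_diag_def]])
  fix i :: "int \<times> 'a" and j :: "int \<times> 'a"
  define k where "k = (fst i + c) div d"
  assume "(fst i + c) div d = (fst j + c) div d"
  then have "(fst i + c) div d = k" "(fst j + c) div d = k" by (simp_all add: k_def)
  then show "\<bar>fst i - fst j\<bar> \<le> d" unfolding int_div_eq_iff[OF assms(1)] by linarith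
qed

lemma banded_GL_block_diag_connected:
  fixes V :: "'w::finite lattice_op"
  assumes d: "0 < d" and V: "V \<in> block_GL (\<lambda>i. (fst i + c) div d)"
  shows "path_component banded_GL V id_blinfun"
proof -
  define p :: "int \<times> 'w \<Rightarrow> int \<times> 'w" where "p i = ((fst i + c) mod d, snd i)" for i
  have "range p \<subseteq> {0..<d} \<times> UNIV" using d by (auto simp: p_def)
  then have "finite (range p)" by (rule finite_subset) simp
  moreover have "i = j" if "(fst i + c) div d = (fst j + c) div d" "p i = p j" for i j
  proof -
    have "fst i + c = fst j + c"
      using that div_mult_mod_eq[of "fst i + c" d] div_mult_mod_eq[of "fst j + c" d]
      unfolding p_def prod.inject by metis
    then show ?thesis using that(2) by (simp add: p_def prod_eq_iff)
  qed
  ultimately have "path_component (block_GL (\<lambda>i. (fst i + c) div d)) V id_blinfun"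
    using V by (intro block_GL_connected) auto
  moreover have "block_GL (\<lambda>i. (fst i + c) div d) \<subseteq> (banded_GL :: 'w lattice_op set)"
    using banded_block_diag[OF d] by (auto simp: block_GL_def banded_GL_def)
  ultimately show ?thesis by (rule path_component_of_subset[rotated])
qed

text \<open>\<open>U x\<close> vanishes to the left of \<open>n\<close> exactly when
  \<open>x\<close> is supported on the image of \<open>up n\<close> under \<open>\<tau>\<close>, so
  the cut space is spanned by basis vectors. This provides the sets \<open>I\<close> for the windows
  of another operator of the same index, and makes the index of a shift a matter of
  counting.\<close>

lemma cut_space_permutation:
  fixes U :: "'w lattice_op"
  assumes \<tau>: "bij \<tau>" "\<And>x i. U x $. i = x $. \<tau> i" "\<And>i. \<bar>fst (\<tau> i) - fst i\<bar> \<le> R"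
    and l: "R \<le> l"
  shows "cut_space U n (n + l) = coord_space (\<tau> ` up n \<inter> slab (n - l) (n + l))"
proof -
  define P where "P n = \<tau> ` up n" for n
  have P: "\<tau> i \<in> P n \<longleftrightarrow> n \<le> fst i" for i n
    using bij_is_inj[OF \<tau>(1)] by (auto simp: P_def inj_image_mem_iff)
  have Pbd: "n - l \<le> fst j" if "j \<in> P n" for j n
  proof -
    obtain i where i: "j = \<tau> i" "n \<le> fst i" using \<open>j \<in> P n\<close> by (auto simp: P_def)
    then show ?thesis using \<tau>(3)[of i] l by auto
  qed
  define I where "I n = P n \<inter> slab (n - l) (n + l)" for n
  have "cut_space U n (n + l) = coord_space (I n)"
  proof -
    have "x \<in> cut_space U n (n + l) \<longleftrightarrow> x \<in> coord_space (I n)" for x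
    proof
      assume x: "x \<in> cut_space U n (n + l)"
      have "x $. j = 0" if "j \<notin> I n" for j
      proof (cases "j \<in> P n")
        case True
        then have "j \<notin> - up (n + l)" using that Pbd[OF True] by (simp add: I_def)
        then show ?thesis using x unfolding cut_space_def coord_space_iff by blast
      next
        case False
        obtain i where i: "j = \<tau> i" using bij_is_surj[OF \<tau>(1)] by blast
        then have "i \<notin> up n" using False P[of i n] by simp
        then have "U x $. i = 0" using x unfolding cut_space_def coord_space_iff by blast
        then show ?thesis by (simp add: i \<tau>(2))
      qed
      then show "x \<in> coord_space (I n)" by (simp add: coord_space_iff)
    next
      assume x: "x \<in> coord_space (I n)"
      have "x $. j = 0" if "j \<notin> - up (n + l)" for j
      proof -
        have "j \<notin> I n" using that by (simp add: I_def)
        then show ?thesis using x unfolding coord_space_iff by blast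
      qed
      moreover have "U x $. i = 0" if "i \<notin> up n" for i
      proof -
        have "\<tau> i \<notin> I n" using that by (simp add: I_def P)
        then show ?thesis using x unfolding coord_space_iff \<tau>(2) by blast
      qed
      ultimately show "x \<in> cut_space U n (n + l)"
        unfolding cut_space_def coord_space_iff by blast
    qed
    then show ?thesis by blast
  qed
  then show ?thesis by (simp add: I_def P_def)
qed

lemma permutation_op:
  fixes \<tau> :: "int \<times> 'w::finite \<Rightarrow> int \<times> 'w"
  assumes \<tau>: "bij \<tau>" "\<And>i. \<bar>fst (\<tau> i) - fst i\<bar> \<le> R"
  obtains U Ui where "banded_invertible U Ui R" "\<And>x i. U x $. i = x $. \<tau> i"
proof -
  obtain U :: "'w lattice_op" where U: "clinear_op U" "\<And>x i. U x $. i = 1 * x $. \<tau> i"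
    by (rule weighted_pull[of \<tau> "\<lambda>_. 1" 1]) (use bij_is_inj[OF \<tau>(1)] in auto)
  obtain Ui :: "'w lattice_op" where Ui: "clinear_op Ui" "\<And>x i. Ui x $. i = 1 * x $. inv \<tau> i"
    by (rule weighted_pull[of "inv \<tau>" "\<lambda>_. 1" 1])
      (use bij_is_inj[OF bij_imp_bij_inv[OF \<tau>(1)]] in auto)
  have "op_inverse U Ui"
    unfolding op_inverse_def using U(1) Ui(1) bij_is_inj[OF \<tau>(1)] bij_is_surj[OF \<tau>(1)]
    by (auto intro!: ell2_eqI simp del: split_paired_All simp: U(2) Ui(2) surj_f_inv_f)
  moreover have "banded R U"
    unfolding banded_def local_in_def U(2) using \<tau>(2) by (simp add: abs_minus_commute del: split_paired_All)
  moreover have "0 \<le> R" using \<tau>(2)[of undefined] by linarith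
  ultimately have "banded_invertible U Ui R" by unfold_locales
  then show ?thesis using that U(2) by simp
qed

section \<open>All cuts at once\<close>

context banded_invertible
begin

text \<open>The coordinates \<open>I\<close> for the window of \<open>S\<close> at a cut are those
  spanning the cut space of \<open>U\<close>; equality of the indices says that there are as many as
  needed. The inverse of \<open>U\<close> sends the right of a cut to \<open>I\<close> together with
  what lies right of the window, and \<open>S V\<close> sends these back to the right of the cut, up
  to a small error.\<close>

lemma connected_to_permutation:
  assumes U: "banded_invertible U Ui R"
    and \<tau>: "bij \<tau>" "\<And>x i. U x $. i = x $. \<tau> i" "\<And>i. \<bar>fst (\<tau> i) - fst i\<bar> \<le> R"
    and ind: "fredholm_index (half_line_compression S) = fredholm_index (half_line_compression U)"
  shows "path_component banded_GL S U"
proof -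
  interpret U: banded_invertible U Ui R by (rule U)
  define s where "s = norm S"
  define \<beta> where "\<beta> = norm B"
  have s: "0 < s" "0 < \<beta>" using norm_S_pos norm_B_pos by (auto simp: s_def \<beta>_def)
  \<comment> \<open>The bound on the inverses of the window operators.\<close>
  define K where "K = 4 * \<beta> * s + 1"
  have K: "1 \<le> K" using s by (simp add: K_def)
  \<comment> \<open>Twice the leakage \<open>e * s\<^sup>2\<close> through a cut, times the bound
    \<open>K * \<beta>\<close> on the inverse of \<open>Y\<close>, is to be \<open>1 / 2\<close>. As
    \<open>K\<close> is at least \<open>1\<close>, this \<open>e\<close> is also small enough for
    the windows.\<close>
  define e where "e = 1 / (4 * s\<^sup>2 * \<beta> * K)"
  have e: "0 < e" using s K by (simp add: e_def)
  have eK: "4 * e * s\<^sup>2 * \<beta> * K = 1" using s K by (simp add: e_def)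
  have e1: "4 * e * (norm S)\<^sup>2 * norm B \<le> 1"
  proof -
    have "4 * e * s\<^sup>2 * \<beta> * 1 \<le> 4 * e * s\<^sup>2 * \<beta> * K" using e s K by (intro mult_left_mono) auto
    then show ?thesis using eK by (simp add: s_def \<beta>_def)
  qed
  obtain l0 where l0: "0 \<le> l0"
    "\<And>X Y x. (\<And>i j. i \<in> X \<Longrightarrow> j \<in> Y \<Longrightarrow> l0 < \<bar>fst i - fst j\<bar>) \<Longrightarrow>
      norm (proj X (B (proj Y x))) \<le> e * norm x"
    using banded_inverse_tail[OF inv band e] by blast
  \<comment> \<open>The \<open>1\<close> ensures a positive period \<open>2 * l\<close> even if the
    other two numbers vanish.\<close>
  define l where "l = max (max l0 R) 1"
  have l: "R \<le> l" "l0 \<le> l" "0 < l" by (auto simp: l_def)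
  have tail: "norm (proj X (B (proj Y x))) \<le> e * norm x"
    if "\<And>i j. i \<in> X \<Longrightarrow> j \<in> Y \<Longrightarrow> l < \<bar>fst i - fst j\<bar>" for X Y x
    by (rule l0(2)) (use that l(2) in fastforce)
  have Ui: "Ui x $. \<tau> i = x $. i" for x i using \<tau>(2)[of "Ui x" i] by simp
  have Ui': "Ui x $. j = x $. inv \<tau> j" for x j
    using Ui[of x "inv \<tau> j"] bij_is_surj[OF \<tau>(1)] by (simp add: surj_f_inv_f)
  have nUi: "norm (Ui x) \<le> norm x" for x
  proof -
    obtain A :: "'w lattice_op" where "\<And>x i. A x $. i = 1 * x $. inv \<tau> i" "norm A \<le> 1"
      by (rule weighted_pull[of "inv \<tau>" "\<lambda>_. 1" 1])
        (use bij_is_inj[OF bij_imp_bij_inv[OF \<tau>(1)]] in auto)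
    then have "A x = Ui x" "norm (A x) \<le> norm x"
      using norm_blinfun[of A x] mult_right_mono[of "norm A" 1 "norm x"] by (auto intro!: ell2_eqI simp: Ui')
    then show ?thesis by simp
  qed
  have nU: "norm U \<le> 1"
  proof -
    obtain A :: "'w lattice_op" where "\<And>x i. A x $. i = 1 * x $. \<tau> i" "norm A \<le> 1"
      by (rule weighted_pull[of \<tau> "\<lambda>_. 1" 1]) (use bij_is_inj[OF \<tau>(1)] in auto)
    moreover from this have "A = U" by (intro blinfun_eqI ell2_eqI) (simp add: \<tau>(2))
    ultimately show ?thesis by simp
  qed
  \<comment> \<open>The coordinates to which \<open>Ui\<close> moves those in
    \<open>up n\<close>.\<close>
  define P where "P n = \<tau> ` up n" for n
  have P: "\<tau> i \<in> P n \<longleftrightarrow> n \<le> fst i" for i n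
    using bij_is_inj[OF \<tau>(1)] by (auto simp: P_def inj_image_mem_iff)
  have Pbd: "n - l \<le> fst j" if "j \<in> P n" for j n
  proof -
    obtain i where i: "j = \<tau> i" "n \<le> fst i" using \<open>j \<in> P n\<close> by (auto simp: P_def)
    then show ?thesis using \<tau>(3)[of i] l(1) by auto
  qed
  have Pbd': "fst j < n + l" if "j \<notin> P n" for j n
  proof -
    obtain i where i: "j = \<tau> i" using bij_is_surj[OF \<tau>(1)] by blast
    then have "fst i < n" using that P by auto
    then show ?thesis using \<tau>(3)[of i] l(1) i by auto
  qed
  have UP: "Ui (proj (up n) x) = proj (P n) (Ui x)" "Ui (proj (- up n) x) = proj (- P n) (Ui x)" for n x
  proof -
    have "inv \<tau> j \<in> up n \<longleftrightarrow> j \<in> P n" for j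
      using P[of "inv \<tau> j" n] bij_is_surj[OF \<tau>(1)] by (simp add: surj_f_inv_f)
    then show "Ui (proj (up n) x) = proj (P n) (Ui x)" "Ui (proj (- up n) x) = proj (- P n) (Ui x)"
      by (auto intro!: ell2_eqI simp: Ui')
  qed
  define I where "I n = P n \<inter> slab (n - l) (n + l)" for n
  have "cut_space U n (n + l) = coord_space (I n)" for n
    unfolding I_def P_def by (rule cut_space_permutation[OF \<tau> l(1)])
  moreover have "finite (I n)" for n by (auto simp: I_def)
  ultimately have cardI: "card (I n) = ell2.dim (cut_space S n (n + l))" for n
    using dim_cut_space[OF l(1), of n] U.dim_cut_space[OF l(1), of n] ind by (simp add: coord_space_finite)
  have Isub: "I n \<subseteq> slab (n - l) (n + l)" for n by (auto simp: I_def)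
  define Q where "Q k = (slab (2 * l * k - l) (2 * l * k + l) :: (int \<times> 'w) set)" for k
  define good where "good k A A' \<longleftrightarrow> op_inverse A A' \<and> (\<forall>x. norm (A x) \<le> 3 * norm x)
    \<and> (\<forall>x. norm (A' x) \<le> K * norm x) \<and> (\<forall>x. A (proj (Q k) x) = proj (Q k) (A x))
    \<and> (\<forall>x. norm (proj (- up (2 * l * k)) (S (A (proj (I (2 * l * k)) x)))) \<le> e * s\<^sup>2 * norm x)
    \<and> (\<forall>x. norm (proj (up (2 * l * k)) (S (A (proj (Q k - I (2 * l * k)) x)))) \<le> e * s\<^sup>2 * norm x)" for k A A'
  have "\<exists>A A'. good k A A'" for k
    by (rule window_operator[OF l(1) less_imp_le[OF e] e1 tail Isub[of "2 * l * k"] cardI[of "2 * l * k"]])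
      (auto simp: good_def Q_def K_def s_def \<beta>_def)
  then obtain A A' where "\<And>k. good k (A k) (A' k)" by metis
  then have A: "\<And>k. op_inverse (A k) (A' k)" "\<And>k x. norm (A k x) \<le> 3 * norm x"
    "\<And>k x. norm (A' k x) \<le> K * norm x" "\<And>k x. A k (proj (Q k) x) = proj (Q k) (A k x)"
    "\<And>k x. norm (proj (- up (2 * l * k)) (S (A k (proj (I (2 * l * k)) x)))) \<le> e * s\<^sup>2 * norm x"
    "\<And>k x. norm (proj (up (2 * l * k)) (S (A k (proj (Q k - I (2 * l * k)) x)))) \<le> e * s\<^sup>2 * norm x"
    unfolding good_def by blast+
  \<comment> \<open>Two tilings of the same period: windows centred at the cuts
    \<open>2 * l * k\<close>, and blocks running from one cut to the next. The added
    \<open>0\<close> gives both the shape \<open>(fst i + c) div d\<close>.\<close>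
  define win blk where "win i = (fst i + l) div (2 * l)" and "blk i = (fst i + 0) div (2 * l)"
    for i :: "int \<times> 'w"
  have l2: "0 < 2 * l" using l by simp
  have win_iff: "win i = k \<longleftrightarrow> 2 * l * k - l \<le> fst i \<and> fst i < 2 * l * k + l" for i k
    unfolding win_def int_div_eq_iff[OF l2] by auto
  have blk_iff: "blk i = k \<longleftrightarrow> 2 * l * k \<le> fst i \<and> fst i < 2 * l * k + 2 * l" for i k
    unfolding blk_def int_div_eq_iff[OF l2] by auto
  have winQ: "win -` {k} = Q k" for k
    by (rule set_eqI) (simp add: win_iff Q_def)
  obtain V V' where V: "op_inverse V V'" "norm V' \<le> K" "block_diag win V"
    "\<And>k x. proj (Q k) (V x) = A k (proj (Q k) x)"
    using block_sum_inverse[of A A' 3 K win, OF A(1,2) _ A(3)] A(4) K unfolding winQ by auto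
  have VQ: "V (proj (Q k) x) = A k (proj (Q k) x)" for k x
  proof (rule vector_eq_by_blocks[of win], unfold winQ)
    fix j
    show "proj (Q j) (V (proj (Q k) x)) = proj (Q j) (A k (proj (Q k) x))"
    proof (cases "j = k")
      case True
      then show ?thesis by (simp add: V(4) A(4)[symmetric])
    next
      case False
      then have "Q j \<inter> Q k = {}" by (auto simp: winQ[symmetric])
      moreover have "proj {} y = 0" for y :: "(int \<times> 'w) ell2" by (simp add: proj_eq_0_iff)
      ultimately show ?thesis by (simp add: V(4) A(4) blinfun.zero_right)
    qed
  qed
  have cV: "clinear_op V" using V(1) by (simp add: op_inverse_def)
  define Y where "Y = (S o\<^sub>L V) o\<^sub>L Ui"
  define Yi where "Yi = U o\<^sub>L (V' o\<^sub>L B)"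
  have Yinv: "op_inverse Y Yi" unfolding Y_def Yi_def
    by (intro op_inverse_comp inv V op_inverse_sym[OF U.inv])
  have Yx: "Y x = S (V (Ui x))" for x by (simp add: Y_def)
  \<comment> \<open>The border between the windows \<open>k\<close> and \<open>k + 1\<close> lies at
    \<open>2 * l * k + l\<close>; being block diagonal for the windows, \<open>V\<close> moves
    nothing across it.\<close>
  have winup: "i \<in> up (2 * l * k + l) \<longleftrightarrow> k + 1 \<le> win i" for i k
  proof -
    have w: "2 * l * win i - l \<le> fst i" "fst i < 2 * l * win i + l" using win_iff by blast+
    show ?thesis
    proof
      assume "k + 1 \<le> win i"
      then have "2 * l * (k + 1) \<le> 2 * l * win i" using l2 by (intro mult_left_mono) auto
      then show "i \<in> up (2 * l * k + l)" using w(1) by (simp add: algebra_simps)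
    next
      assume "i \<in> up (2 * l * k + l)"
      then have "2 * l * k < 2 * l * win i" using w(2) by simp
      then show "k + 1 \<le> win i" using l2 by (simp add: mult_less_cancel_left_pos)
    qed
  qed
  have Vup: "V z \<in> coord_space (up (2 * l * k + l))" if "z \<in> coord_space (up (2 * l * k + l))" for k z
    unfolding coord_space_iff
  proof (intro allI impI)
    fix i :: "int \<times> 'w" assume i: "i \<notin> up (2 * l * k + l)"
    show "V z $. i = 0"
    proof (rule local_inD[OF V(3)[unfolded block_diag_def]])
      fix j :: "int \<times> 'w" assume "win i = win j"
      then have "j \<notin> up (2 * l * k + l)" using i winup by metis
      then show "z $. j = 0" using that unfolding coord_space_iff by blast
    qed
  qed
  have Vdn: "V z \<in> coord_space (- up (2 * l * k + l))" if "z \<in> coord_space (- up (2 * l * k + l))" for k z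
    unfolding coord_space_iff
  proof (intro allI impI)
    fix i :: "int \<times> 'w" assume i: "i \<notin> - up (2 * l * k + l)"
    show "V z $. i = 0"
    proof (rule local_inD[OF V(3)[unfolded block_diag_def]])
      fix j :: "int \<times> 'w" assume "win i = win j"
      then have "j \<notin> - up (2 * l * k + l)" using i winup by (metis ComplD ComplI)
      then show "z $. j = 0" using that unfolding coord_space_iff by blast
    qed
  qed
  define \<eta> where "\<eta> = e * s\<^sup>2"
  have \<eta>: "0 < \<eta>" using e s by (simp add: \<eta>_def)
  have off1: "norm (proj (- up (2 * l * k)) (Y (proj (up (2 * l * k)) x))) \<le> \<eta> * norm x" for k x
  proof -
    define n where "n = 2 * l * k"
    define y where "y = proj (P n) (Ui x)"
    \<comment> \<open>\<open>V\<close> keeps the part beyond the window to the right of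
      \<open>n + l\<close>, and \<open>S\<close> moves it by at most \<open>R \<le> l\<close>, so it
      stays right of the cut. Only the part on \<open>I n\<close> can leak, and there the estimate
      for \<open>A k\<close> applies.\<close>
    have y: "y = proj (I n) y + proj (up (n + l)) y"
      using Pbd[of _ n] by (intro ell2_eqI) (auto simp: y_def I_def ell2_simps not_less)
    have "V (proj (up (n + l)) y) \<in> coord_space (up (n + l))"
      unfolding n_def by (rule Vup[OF proj_in_coord_space])
    then have "S (V (proj (up (n + l)) y)) \<in> coord_space (up n)"
      by (rule S_up) (use l in simp)
    then have "proj (- up n) (S (V (proj (up (n + l)) y))) = 0"
      by (auto simp: proj_eq_0_iff coord_space_iff)
    moreover have "V (proj (I n) y) = A k (proj (I n) y)"
    proof -
      have "proj (Q k) (proj (I n) y) = proj (I n) y"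
        using Isub[of n] by (intro ell2_eqI) (auto simp: Q_def n_def)
      then show ?thesis using VQ[of k "proj (I n) y"] by (simp only:)
    qed
    ultimately have "proj (- up n) (S (V y)) = proj (- up n) (S (A k (proj (I n) y)))"
      by (subst y) (simp add: blinfun.add_right)
    then have "norm (proj (- up n) (S (V y))) \<le> \<eta> * norm y"
      using A(5)[of k y] by (simp add: \<eta>_def n_def)
    also have "\<dots> \<le> \<eta> * norm x"
      unfolding y_def using \<eta> by (intro mult_left_mono order_trans[OF norm_proj_le nUi]) simp
    finally show ?thesis by (simp add: Yx UP y_def n_def)
  qed
  have off2: "norm (proj (up (2 * l * k)) (Y (proj (- up (2 * l * k)) x))) \<le> \<eta> * norm x" for k x
  proof -
    define n where "n = 2 * l * k"
    define y where "y = proj (- P n) (Ui x)"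
    have y: "y = proj (Q k - I n) y + proj (- up (n - l)) y"
      using Pbd'[of _ n] by (intro ell2_eqI) (auto simp: y_def I_def Q_def n_def[symmetric] ell2_simps not_le)
    \<comment> \<open>The left border of the window \<open>k\<close> is the right border of the
      window \<open>k - 1\<close>.\<close>
    have nl: "n - l = 2 * l * (k - 1) + l" by (simp add: n_def algebra_simps)
    have "V (proj (- up (n - l)) y) \<in> coord_space (- up (n - l))"
      unfolding nl by (rule Vdn[OF proj_in_coord_space])
    then have "S (V (proj (- up (n - l)) y)) \<in> coord_space (- up n)"
      by (rule S_down) (use l in simp)
    then have "proj (up n) (S (V (proj (- up (n - l)) y))) = 0"
      by (auto simp: proj_eq_0_iff coord_space_iff)
    moreover have "V (proj (Q k - I n) y) = A k (proj (Q k - I n) y)"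
    proof -
      have "proj (Q k) (proj (Q k - I n) y) = proj (Q k - I n) y" by (intro ell2_eqI) auto
      then show ?thesis using VQ[of k "proj (Q k - I n) y"] by (simp only:)
    qed
    ultimately have "proj (up n) (S (V y)) = proj (up n) (S (A k (proj (Q k - I n) y)))"
      by (subst y) (simp add: blinfun.add_right)
    then have "norm (proj (up n) (S (V y))) \<le> \<eta> * norm y"
      using A(6)[of k y] by (simp add: \<eta>_def n_def)
    also have "\<dots> \<le> \<eta> * norm x"
      unfolding y_def using \<eta> by (intro mult_left_mono order_trans[OF norm_proj_le nUi]) simp
    finally show ?thesis by (simp add: Yx UP y_def n_def)
  qed
  have Ui_band: "banded R Ui"
    unfolding banded_def local_in_def
  proof (intro allI impI)
    fix x :: "(int \<times> 'w) ell2" and i :: "int \<times> 'w"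
    assume x: "\<forall>j. \<bar>fst i - fst j\<bar> \<le> R \<longrightarrow> x $. j = 0"
    have "\<bar>fst i - fst (inv \<tau> i)\<bar> \<le> R"
      using \<tau>(3)[of "inv \<tau> i"] bij_is_surj[OF \<tau>(1)] by (simp add: surj_f_inv_f)
    then show "Ui x $. i = 0" using x unfolding Ui' by blast
  qed
  \<comment> \<open>A window enlarged by \<open>l\<close> on both sides is the union of the two
    blocks that meet at its cut.\<close>
  have blk_near: "w - 1 \<le> blk i \<and> blk i \<le> w" if "win i' = w" "\<bar>fst i - fst i'\<bar> \<le> l" for w i i'
  proof -
    have "2 * l * blk i \<le> fst i" "fst i < 2 * l * blk i + 2 * l" using blk_iff by blast+
    moreover have "2 * l * w - l \<le> fst i'" "fst i' < 2 * l * w + l" using that(1) win_iff by blast+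
    ultimately have "2 * l * (w - 1) < 2 * l * (blk i + 1)" "2 * l * blk i < 2 * l * (w + 1)"
      using that(2) by (auto simp: algebra_simps)
    then show ?thesis using l2 by (simp add: mult_less_cancel_left_pos)
  qed
  have Yloc: "local_in (\<lambda>i j. \<bar>blk i - blk j\<bar> \<le> 1) Y"
  proof -
    have SV: "local_in (\<lambda>i j. \<exists>i'. \<bar>fst i - fst i'\<bar> \<le> l \<and> win i' = win j) (S o\<^sub>L V)"
      by (rule local_in_comp[OF banded_mono[OF band l(1), unfolded banded_def] V(3)[unfolded block_diag_def]]) auto
    show ?thesis
      unfolding Y_def
    proof (rule local_in_comp[OF SV banded_mono[OF Ui_band l(1), unfolded banded_def]])
      fix i j j' :: "int \<times> 'w"
      assume "\<exists>i'. \<bar>fst i - fst i'\<bar> \<le> l \<and> win i' = win j'" "\<bar>fst j' - fst j\<bar> \<le> l"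
      then show "\<bar>blk i - blk j\<bar> \<le> 1"
        using blk_near[of _ "win j'" i] blk_near[of j' "win j'" j] by (force simp: abs_minus_commute)
    qed
  qed
  define b where "b k = blk -` {k}" for k
  have bI: "2 * l * k \<le> fst i \<and> fst i < 2 * l * k + 2 * l" if "i \<in> b k" for i k
    using that blk_iff[of i k] by (simp add: b_def)
  have Ynorm: "norm ((proj (b k) o\<^sub>L Y o\<^sub>L proj (b k)) x) \<le> norm Y * norm x" for k x
  proof -
    have "norm ((proj (b k) o\<^sub>L Y o\<^sub>L proj (b k)) x) \<le> norm Y * norm (proj (b k) x)"
      using order_trans[OF norm_proj_le norm_blinfun] by simp
    also have "\<dots> \<le> norm Y * norm x" by (intro mult_left_mono norm_proj_le) simp
    finally show ?thesis .
  qed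
  have cY: "clinear_op Y" using Yinv by (simp add: op_inverse_def)
  \<comment> \<open>The block diagonal part of \<open>Y\<close>; the remainder couples neighbouring
    blocks only.\<close>
  obtain D where D: "clinear_op D" "block_diag blk D"
    "\<And>k x. proj (b k) (D x) = proj (b k) (Y (proj (b k) x))"
  proof (rule block_sum[of "\<lambda>k. proj (b k) o\<^sub>L Y o\<^sub>L proj (b k)" "norm Y" blk])
    show "clinear_op (proj (b k) o\<^sub>L Y o\<^sub>L proj (b k))" for k
      by (intro clinear_op_intros clinear_proj cY)
  qed (use that Ynorm in \<open>auto simp: b_def\<close>)
  \<comment> \<open>A block of the difference receives only what crosses its two bounding cuts. One
    factor \<open>sqrt 2\<close> comes from squaring a sum of two terms, the other from the number
    of neighbour maps.\<close>
  have near: "norm ((Y - D) x) \<le> 2 * \<eta> * norm x" for x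
  proof -
    define z where "z = (Y - D) x"
    have "(norm (proj (b k) z))\<^sup>2 \<le> (sqrt 2 * \<eta>)\<^sup>2 * (\<Sum>\<tau>\<in>{\<lambda>k. k - 1, \<lambda>k. k + 1}. (norm (proj (b (\<tau> k)) x))\<^sup>2)" for k
    proof -
      define u v where "u = proj (b (k - 1)) x" and "v = proj (b (k + 1)) x"
      have "proj (b k) z = proj (b k) (Y u) + proj (b k) (Y v)"
      proof (rule ell2_eqI)
        fix i
        show "proj (b k) z $. i = (proj (b k) (Y u) + proj (b k) (Y v)) $. i"
        proof (cases "blk i = k")
          case True
          have "Y x $. i = Y (u + v + proj (b k) x) $. i"
            by (rule local_in_cong[OF Yloc]) (use True in \<open>auto simp: u_def v_def b_def ell2_simps\<close>)
          moreover have "D x $. i = Y (proj (b k) x) $. i"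
            using arg_cong[OF D(3)[of k x], of "\<lambda>y. y $. i"] True by (simp add: b_def)
          ultimately show ?thesis
            using True by (simp add: z_def b_def blinfun.diff_left blinfun.add_right ell2_simps)
        qed (simp add: b_def ell2_simps)
      qed
      moreover have "norm (proj (b k) (Y u)) \<le> \<eta> * norm u"
      proof -
        have "b (k - 1) \<subseteq> - up (2 * l * k)"
          by (rule subsetI) (drule bI, simp add: algebra_simps)
        then have "proj (- up (2 * l * k)) u = u" by (simp add: u_def Int_absorb1)
        moreover have "b k \<subseteq> up (2 * l * k)" by (rule subsetI) (drule bI, simp)
        ultimately show ?thesis
          using off2[of k u] norm_proj_mono[of "b k" "up (2 * l * k)" "Y u"] by simp
      qed
      moreover have "norm (proj (b k) (Y v)) \<le> \<eta> * norm v"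
      proof -
        have "b (k + 1) \<subseteq> up (2 * l * (k + 1))"
          by (rule subsetI) (drule bI, simp)
        then have "proj (up (2 * l * (k + 1))) v = v" by (simp add: v_def Int_absorb1)
        moreover have "b k \<subseteq> - up (2 * l * (k + 1))"
          by (rule subsetI) (drule bI, simp add: algebra_simps)
        ultimately show ?thesis
          using off1[of "k + 1" v] norm_proj_mono[of "b k" "- up (2 * l * (k + 1))" "Y v"] by simp
      qed
      ultimately have "norm (proj (b k) z) \<le> \<eta> * (norm u + norm v)"
        using norm_triangle_ineq[of "proj (b k) (Y u)" "proj (b k) (Y v)"] by (simp add: distrib_left)
      then have "(norm (proj (b k) z))\<^sup>2 \<le> (\<eta> * (norm u + norm v))\<^sup>2" by (rule power_mono) simp
      also have "\<dots> \<le> \<eta>\<^sup>2 * (2 * ((norm u)\<^sup>2 + (norm v)\<^sup>2))"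
        unfolding power_mult_distrib
        using sum_squares_bound[of "norm u" "norm v"] by (intro mult_left_mono) (auto simp: power2_sum)
      also have "\<dots> = (sqrt 2 * \<eta>)\<^sup>2 * ((norm u)\<^sup>2 + (norm v)\<^sup>2)" by (simp add: power_mult_distrib)
      also have "(norm u)\<^sup>2 + (norm v)\<^sup>2 = (\<Sum>\<tau>\<in>{\<lambda>k. k - 1, \<lambda>k. k + 1}. (norm (proj (b (\<tau> k)) x))\<^sup>2)"
      proof -
        have "(\<lambda>k::int. k - 1) \<noteq> (\<lambda>k. k + 1)" by (simp add: fun_eq_iff)
        then show ?thesis by (simp add: u_def v_def)
      qed
      finally show ?thesis .
    qed
    then have "norm z \<le> sqrt (card {\<lambda>k::int. k - 1, \<lambda>k. k + 1}) * (sqrt 2 * \<eta>) * norm x"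
      unfolding b_def using \<eta> by (intro norm_le_of_blocks) (auto simp: inj_def)
    also have "card {\<lambda>k::int. k - 1, \<lambda>k. k + 1} = 2" by (simp add: fun_eq_iff)
    finally have "norm z \<le> sqrt 2 * (sqrt 2 * \<eta>) * norm x" by simp
    moreover have "sqrt 2 * (sqrt 2 * \<eta>) = 2 * \<eta>"
      unfolding mult.assoc[symmetric] by simp
    ultimately show ?thesis by (simp only: z_def)
  qed
  have YD: "norm (Y - D) \<le> 2 * \<eta>" using \<eta> by (intro norm_blinfun_bound near) simp
  \<comment> \<open>This bound is independent of \<open>l\<close>, as it has to be: \<open>l\<close>
    was chosen after \<open>e\<close>, and \<open>e\<close> with this bound in view.\<close>
  have "norm Yi \<le> norm U * norm (V' o\<^sub>L B)" unfolding Yi_def by (rule norm_blinfun_compose)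
  also have "\<dots> \<le> 1 * (norm V' * norm B)" by (intro mult_mono nU norm_blinfun_compose) auto
  also have "\<dots> \<le> 1 * (K * \<beta>)"
    unfolding \<beta>_def by (intro mult_left_mono mult_right_mono V(2)) auto
  finally have nYi: "norm Yi \<le> K * \<beta>" by simp
  have "2 * \<eta> * (K * \<beta>) = 1 / 2" using eK by (simp add: \<eta>_def mult_ac)
  then have small: "norm (Y - D) * norm Yi < 1"
    using mult_mono[OF YD nYi] \<eta> by simp
  have bY: "banded (R + 2 * l + R) Y"
    unfolding Y_def using banded_block_diag[OF l2 V(3)[unfolded win_def]]
    by (intro banded_comp band Ui_band)
  have bD: "banded (2 * l) D" using banded_block_diag[OF l2 D(2)[unfolded blk_def]] .
  have seg: "(1 - t) *\<^sub>R Y + t *\<^sub>R D \<in> banded_GL" if t: "0 \<le> t" "t \<le> 1" for t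
  proof -
    have "(1 - t) *\<^sub>R Y + t *\<^sub>R D - Y = - (t *\<^sub>R (Y - D))" by (simp add: algebra_simps)
    then have "norm ((1 - t) *\<^sub>R Y + t *\<^sub>R D - Y) * norm Yi = t * (norm (Y - D) * norm Yi)"
      using t by simp
    also have "\<dots> \<le> 1 * (norm (Y - D) * norm Yi)" using t by (intro mult_right_mono) auto
    also have "\<dots> < 1" using small by simp
    finally have "invertible_op ((1 - t) *\<^sub>R Y + t *\<^sub>R D)"
      by (intro op_inverse_perturb[OF Yinv]) (use cY D(1) in auto)
    moreover have "banded (max (R + 2 * l + R) (2 * l)) ((1 - t) *\<^sub>R Y + t *\<^sub>R D)"
      by (intro banded_linear banded_mono[OF bY] banded_mono[OF bD]) auto
    ultimately show ?thesis by (auto simp: banded_GL_def)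
  qed
  then have path_YD: "path_component banded_GL Y D"
    by (intro path_component_linepath) (auto elim!: closed_segment_memE)
  have UG: "U \<in> banded_GL" and SG: "S \<in> banded_GL"
    using U.inv U.band inv band by (auto simp: banded_GL_def invertible_op_def)
  have "D \<in> block_GL (\<lambda>i. (fst i + 0) div (2 * l))"
    using seg[of 1] D(2)[unfolded blk_def] by (auto simp: block_GL_def banded_GL_def simp del: add_0_right)
  then have "path_component banded_GL D id_blinfun" by (rule banded_GL_block_diag_connected[OF l2])
  with path_YD have "path_component banded_GL Y id_blinfun" by (rule path_component_trans)
  then have "path_component banded_GL (Y o\<^sub>L U) (id_blinfun o\<^sub>L U)"
    by (rule path_component_image[OF _ continuous_on_compose_right]) (use UG banded_GL_comp in auto)
  \<comment> \<open>Two paths meet at \<open>S o\<^sub>L V\<close>: joining \<open>Y\<close> to the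
    identity leads from there to \<open>U\<close>, joining \<open>V\<close> to the identity leads
    from there to \<open>S\<close>.\<close>
  moreover have "Y o\<^sub>L U = S o\<^sub>L V" by (rule blinfun_eqI) (simp add: Yx)
  moreover have "id_blinfun o\<^sub>L U = U" by (rule blinfun_eqI) simp
  moreover have "V \<in> block_GL (\<lambda>i. (fst i + l) div (2 * l))"
    using V(1) V(3)[unfolded win_def] by (auto simp: block_GL_def invertible_op_def)
  then have "path_component banded_GL V id_blinfun" by (rule banded_GL_block_diag_connected[OF l2])
  then have "path_component banded_GL (S o\<^sub>L V) (S o\<^sub>L id_blinfun)"
    by (rule path_component_image[OF _ continuous_on_compose_left]) (use SG banded_GL_comp in auto)
  moreover have "S o\<^sub>L id_blinfun = S" by (rule blinfun_eqI) simp
  ultimately show ?thesis by (metis path_component_sym path_component_trans)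
qed

end

subsection \<open>Exponentially local operators\<close>

lemma onorm_hop_le:
  fixes M :: "complex^'n::finite^'m::finite"
  assumes "\<And>i j. cmod (M $ i $ j) \<le> K"
  shows "onorm ((*v) M) \<le> real CARD('m) * real CARD('n) * K"
proof (rule onorm_bound)
  have K: "0 \<le> K" using assms norm_ge_zero order_trans by blast
  then show "0 \<le> real CARD('m) * real CARD('n) * K" by simp
  fix x
  have "norm (M *v x) \<le> (\<Sum>i\<in>UNIV. norm ((M *v x) $ i))"
    unfolding norm_vec_def by (rule L2_set_le_sum) simp
  also have "\<dots> \<le> (\<Sum>i\<in>(UNIV::'m set). \<Sum>j\<in>(UNIV::'n set). K * norm x)"
  proof (rule sum_mono)
    fix i
    have "norm ((M *v x) $ i) \<le> (\<Sum>j\<in>UNIV. norm (M $ i $ j * x $ j))"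
      by (simp add: matrix_vector_mult_def norm_sum)
    also have "\<dots> \<le> (\<Sum>j\<in>(UNIV::'n set). K * norm x)"
      unfolding norm_mult by (intro sum_mono mult_mono assms Finite_Cartesian_Product.norm_nth_le K) auto
    finally show "norm ((M *v x) $ i) \<le> (\<Sum>j\<in>(UNIV::'n set). K * norm x)" .
  qed
  also have "\<dots> = real CARD('m) * real CARD('n) * K * norm x" by simp
  finally show "norm (M *v x) \<le> real CARD('m) * real CARD('n) * K * norm x" .
qed

lemma cmod_entry_le_onorm:
  fixes M :: "complex^'n::finite^'m::finite"
  shows "cmod (M $ i $ j) \<le> onorm ((*v) M)"
proof -
  have "M $ i $ j = (M *v axis j 1) $ i"
    by (simp add: matrix_vector_mult_def axis_def if_distrib cong: if_cong)
  also have "cmod \<dots> \<le> norm (M *v axis j 1)" by (rule Finite_Cartesian_Product.norm_nth_le)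
  also have "\<dots> \<le> onorm ((*v) M) * norm (axis j (1::complex))"
    by (rule onorm) simp
  finally show ?thesis by (simp add: norm_axis_1)
qed

text \<open>For matrices of fixed size the operator norm and the largest entry agree up to a
  constant, which \<open>c\<close> absorbs. The decay estimates below are made entrywise.\<close>

lemma exp_local_iff:
  "exp_local (A :: 'n::finite lattice_op) \<longleftrightarrow> (\<exists>c \<mu>. \<mu> > 0 \<and>
    (\<forall>x y i j. cmod (A (ket (y, j)) $. (x, i)) \<le> c * exp (- \<mu> * \<bar>real_of_int (x - y)\<bar>)))"
  (is "_ \<longleftrightarrow> ?R")
proof
  assume "exp_local A"
  then obtain c \<mu> where "\<mu> > 0"
    and c: "\<And>x y. onorm ((*v) (hop A x y)) \<le> c * exp (- \<mu> * \<bar>real_of_int (x - y)\<bar>)"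
    by (auto simp: exp_local_def)
  moreover have "cmod (A (ket (y, j)) $. (x, i)) \<le> onorm ((*v) (hop A x y))" for x y i j
    using cmod_entry_le_onorm[of "hop A x y" i j] by (simp add: hop_def)
  ultimately show ?R using order_trans by blast
next
  assume ?R
  then obtain c \<mu> where "\<mu> > 0" and c: "\<And>x y i j. cmod (A (ket (y, j)) $. (x, i))
    \<le> c * exp (- \<mu> * \<bar>real_of_int (x - y)\<bar>)" by blast
  have "onorm ((*v) (hop A x y)) \<le> (real CARD('n) * real CARD('n) * c) * exp (- \<mu> * \<bar>real_of_int (x - y)\<bar>)" for x y
    using onorm_hop_le[of "hop A x y" "c * exp (- \<mu> * \<bar>real_of_int (x - y)\<bar>)"] c
    by (simp add: hop_def mult.assoc)
  then show "exp_local A" using \<open>\<mu> > 0\<close> unfolding exp_local_def by blast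
qed

lemma exp_local_bound:
  assumes "exp_local (A :: 'n::finite lattice_op)"
  obtains c \<mu> where "0 \<le> c" "0 < \<mu>"
    "\<And>x y i j. cmod (A (ket (y, j)) $. (x, i)) \<le> c * exp (- \<mu> * \<bar>real_of_int (x - y)\<bar>)"
proof -
  obtain c \<mu> where c: "0 < \<mu>"
    "\<And>x y i j. cmod (A (ket (y, j)) $. (x, i)) \<le> c * exp (- \<mu> * \<bar>real_of_int (x - y)\<bar>)"
    using assms unfolding exp_local_iff by blast
  moreover have "0 \<le> c"
    using order_trans[OF norm_ge_zero c(2)[where x = 0 and y = 0]] by simp
  ultimately show ?thesis using that by blast
qed

lemma exp_local_add:
  assumes "exp_local (A :: 'n::finite lattice_op)" "exp_local B"
  shows "exp_local (A + B)"
proof -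
  obtain c \<mu> where c: "0 \<le> c" "0 < \<mu>"
    "\<And>x y i j. cmod (A (ket (y, j)) $. (x, i)) \<le> c * exp (- \<mu> * \<bar>real_of_int (x - y)\<bar>)"
    using exp_local_bound[OF assms(1)] by blast
  obtain d \<nu> where d: "0 \<le> d" "0 < \<nu>"
    "\<And>x y i j. cmod (B (ket (y, j)) $. (x, i)) \<le> d * exp (- \<nu> * \<bar>real_of_int (x - y)\<bar>)"
    using exp_local_bound[OF assms(2)] by blast
  have "cmod ((A + B) (ket (y, j)) $. (x, i)) \<le> (c + d) * exp (- min \<mu> \<nu> * \<bar>real_of_int (x - y)\<bar>)" for x y i j
  proof -
    have "cmod ((A + B) (ket (y, j)) $. (x, i)) \<le> cmod (A (ket (y, j)) $. (x, i)) + cmod (B (ket (y, j)) $. (x, i))"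
      by (simp add: blinfun.add_left ell2_simps norm_triangle_ineq)
    also have "\<dots> \<le> c * exp (- \<mu> * \<bar>real_of_int (x - y)\<bar>) + d * exp (- \<nu> * \<bar>real_of_int (x - y)\<bar>)"
      by (intro add_mono c d)
    also have "\<dots> \<le> c * exp (- min \<mu> \<nu> * \<bar>real_of_int (x - y)\<bar>) + d * exp (- min \<mu> \<nu> * \<bar>real_of_int (x - y)\<bar>)"
      using c(1) d(1) by (intro add_mono mult_left_mono) (auto intro!: mult_right_mono)
    finally show ?thesis by (simp add: distrib_right)
  qed
  then show ?thesis unfolding exp_local_iff using c(2) d(2) by (intro exI[of _ "c + d"] exI[of _ "min \<mu> \<nu>"]) auto
qed

lemma exp_local_scaleR:
  assumes "exp_local (A :: 'n::finite lattice_op)"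
  shows "exp_local (r *\<^sub>R A)"
proof -
  obtain c \<mu> where c: "0 \<le> c" "0 < \<mu>"
    "\<And>x y i j. cmod (A (ket (y, j)) $. (x, i)) \<le> c * exp (- \<mu> * \<bar>real_of_int (x - y)\<bar>)"
    using exp_local_bound[OF assms(1)] by blast
  have "cmod ((r *\<^sub>R A) (ket (y, j)) $. (x, i)) \<le> (\<bar>r\<bar> * c) * exp (- \<mu> * \<bar>real_of_int (x - y)\<bar>)" for x y i j
    using mult_left_mono[OF c(3)[of y j x i], of "\<bar>r\<bar>"]
    by (simp add: blinfun.scaleR_left ell2_simps norm_mult mult.assoc)
  then show ?thesis unfolding exp_local_iff using c(2) by blast
qed

text \<open>Within the band the exponential of the width compensates the decay; any rate would do,
  and \<open>1\<close> is taken.\<close>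

lemma banded_exp_local:
  assumes "banded R (A :: 'n::finite lattice_op)"
  shows "exp_local A"
proof -
  have "cmod (A (ket (y, j)) $. (x, i)) \<le> (norm A * exp \<bar>real_of_int R\<bar>) * exp (- 1 * \<bar>real_of_int (x - y)\<bar>)" for x y i j
  proof (cases "\<bar>x - y\<bar> \<le> \<bar>R\<bar>")
    case True
    have "cmod (A (ket (y, j)) $. (x, i)) \<le> norm A * norm (ket (y, j))"
      by (rule order_trans[OF ell2_apply_le_norm norm_blinfun])
    moreover have "\<bar>real_of_int (x - y)\<bar> \<le> \<bar>real_of_int R\<bar>" using True by linarith
    then have "1 \<le> exp (\<bar>real_of_int R\<bar> - \<bar>real_of_int (x - y)\<bar>)" by simp
    then have "norm A * 1 \<le> norm A * exp (\<bar>real_of_int R\<bar> - \<bar>real_of_int (x - y)\<bar>)"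
      by (intro mult_left_mono) auto
    ultimately show ?thesis by (simp add: exp_diff exp_minus divide_inverse mult.assoc)
  next
    case False
    have "A (ket (y, j)) $. (x, i) = 0"
      by (rule bandedD[OF assms]) (use False in \<open>auto simp: ket.rep_eq\<close>)
    then show ?thesis by simp
  qed
  then show ?thesis unfolding exp_local_iff by (intro exI[of _ "norm A * exp \<bar>real_of_int R\<bar>"] exI[of _ 1]) auto
qed

section \<open>Approximation of exponentially local operators by banded ones\<close>

lemma bounded_linear_scaleC: "bounded_linear (scaleC c :: 'i ell2 \<Rightarrow> 'i ell2)"
  by (rule bounded_linear_intro[where K = "cmod c"])
    (simp_all add: ell2.scale_right_distrib scaleC_scaleR norm_scaleC mult.commute)

lemma clinear_op_limit:
  assumes "\<And>n. clinear_op (f n)" "f \<longlonglongrightarrow> L"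
  shows "clinear_op L"
  unfolding clinear_op_def
proof (intro allI)
  fix c x
  have lim: "(\<lambda>n. f n y) \<longlonglongrightarrow> L y" for y
    by (intro blinfun.tendsto assms(2) tendsto_const)
  have "(\<lambda>n. c *\<^sub>C f n x) \<longlonglongrightarrow> c *\<^sub>C L x"
    by (rule bounded_linear.tendsto[OF bounded_linear_scaleC lim])
  moreover have "(\<lambda>n. c *\<^sub>C f n x) \<longlonglongrightarrow> L (c *\<^sub>C x)"
    using lim[of "c *\<^sub>C x"] by (simp add: clinear_opD[OF assms(1)])
  ultimately show "L (c *\<^sub>C x) = c *\<^sub>C L x" by (rule LIMSEQ_unique[rotated])
qed

text \<open>The norm of the \<open>d\<close>-th diagonal of an exponentially local operator decays exponentially, so
  the operator is the norm convergent sum of its diagonals.\<close>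

lemma exp_local_diagonal:
  fixes S :: "'w::finite lattice_op"
  assumes c: "0 \<le> c" "\<And>x y i j. cmod (S (ket (y, j)) $. (x, i)) \<le> c * exp (- \<mu> * \<bar>real_of_int (x - y)\<bar>)"
  obtains T where "clinear_op T" "banded \<bar>d\<bar> T"
    "norm T \<le> real CARD('w) * real CARD('w) * (c * exp (- \<mu> * \<bar>real_of_int d\<bar>))"
    "\<And>x y i j. T (ket (y, j)) $. (x, i) = (if y = x + d then S (ket (y, j)) $. (x, i) else 0)"
proof -
  define M where "M = c * exp (- \<mu> * \<bar>real_of_int d\<bar>)"
  \<comment> \<open>The diagonal is split by source component \<open>j\<close> and target component
    \<open>i0\<close>, so that each piece moves basis vectors injectively.\<close>
  define a where "a i0 j k = (if snd k = i0 then S (ket (fst k + d, j)) $. k else 0)"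
    for i0 j :: 'w and k :: "int \<times> 'w"
  have "\<exists>T. clinear_op T \<and> (\<forall>x k. T x $. k = a i0 j k * x $. (fst k + d, j)) \<and> norm T \<le> M" for i0 j
  proof -
    have "inj_on (\<lambda>k. (fst k + d, j)) {k. a i0 j k \<noteq> 0}"
      by (rule inj_onI) (auto simp: a_def split: if_splits)
    moreover have "cmod (a i0 j k) \<le> M" for k
      using c(2)[of "fst k + d" j "fst k" "snd k"] c(1) by (auto simp: a_def M_def)
    ultimately show ?thesis
      using weighted_pull[of "\<lambda>k. (fst k + d, j)" "a i0 j" M] by metis
  qed
  then obtain D where D: "\<And>i0 j. clinear_op (D i0 j)"
    "\<And>i0 j x k. D i0 j x $. k = a i0 j k * x $. (fst k + d, j)" "\<And>i0 j. norm (D i0 j) \<le> M"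
    by metis
  define T where "T = (\<Sum>i0\<in>UNIV. \<Sum>j\<in>UNIV. D i0 j)"
  have Tx: "T x $. k = (\<Sum>j\<in>UNIV. S (ket (fst k + d, j)) $. k * x $. (fst k + d, j))" for x k
  proof -
    have "T x $. k = (\<Sum>i0\<in>UNIV. \<Sum>j\<in>UNIV. a i0 j k * x $. (fst k + d, j))"
      by (simp add: T_def blinfun.sum_left ell2_apply_sum D)
    also have "\<dots> = (\<Sum>i0\<in>UNIV. if i0 = snd k then \<Sum>j\<in>UNIV. S (ket (fst k + d, j)) $. k * x $. (fst k + d, j) else 0)"
      by (intro sum.cong) (auto simp: a_def)
    finally show ?thesis by simp
  qed
  show ?thesis
  proof
    show "clinear_op T" unfolding T_def by (intro clinear_op_sum D)
    show "banded \<bar>d\<bar> T"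
      unfolding banded_def local_in_def
    proof (intro allI impI)
      fix x :: "(int \<times> 'w) ell2" and k :: "int \<times> 'w"
      assume "\<forall>j. \<bar>fst k - fst j\<bar> \<le> \<bar>d\<bar> \<longrightarrow> x $. j = 0"
      then show "T x $. k = 0" by (simp add: Tx)
    qed
    have "norm T \<le> (\<Sum>i0\<in>(UNIV::'w set). \<Sum>j\<in>(UNIV::'w set). M)"
      unfolding T_def by (intro sum_norm_le D(3))
    then show "norm T \<le> real CARD('w) * real CARD('w) * (c * exp (- \<mu> * \<bar>real_of_int d\<bar>))"
      by (simp add: M_def)
    show "T (ket (y, j)) $. (x, i) = (if y = x + d then S (ket (y, j)) $. (x, i) else 0)" for x y i j
    proof -
      have "T (ket (y, j)) $. (x, i) = (\<Sum>j'\<in>UNIV. if j' = j then (if y = x + d then S (ket (y, j)) $. (x, i) else 0) else 0)"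
        unfolding Tx by (intro sum.cong) (auto simp: ket.rep_eq)
      then show ?thesis by simp
    qed
  qed
qed

lemma exp_local_truncation:
  fixes S :: "'w::finite lattice_op"
  assumes S: "clinear_op S" "exp_local S" and e: "0 < e"
  obtains S' R where "clinear_op S'" "banded R S'" "0 \<le> R" "norm (S' - S) < e"
proof -
  obtain c \<mu> where c: "0 \<le> c" "0 < \<mu>"
    "\<And>x y i j. cmod (S (ket (y, j)) $. (x, i)) \<le> c * exp (- \<mu> * \<bar>real_of_int (x - y)\<bar>)"
    using exp_local_bound[OF assms(2)] by blast
  define M where "M = real CARD('w) * real CARD('w) * c"
  have "\<exists>T. clinear_op T \<and> banded \<bar>d\<bar> T \<and> norm T \<le> M * exp (- \<mu> * \<bar>real_of_int d\<bar>) \<and>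
    (\<forall>x y i j. T (ket (y, j)) $. (x, i) = (if y = x + d then S (ket (y, j)) $. (x, i) else 0))" for d
    by (rule exp_local_diagonal[OF c(1,3), of d]) (auto simp: M_def mult.assoc)
  then obtain T where T: "\<And>d. clinear_op (T d)" "\<And>d. banded \<bar>d\<bar> (T d)"
    "\<And>d. norm (T d) \<le> M * exp (- \<mu> * \<bar>real_of_int d\<bar>)"
    "\<And>d x y i j. T d (ket (y, j)) $. (x, i) = (if y = x + d then S (ket (y, j)) $. (x, i) else 0)"
    by metis
  \<comment> \<open>The diagonals \<open>n\<close> and \<open>- n\<close> are paired to obtain a
    series over the natural numbers; at \<open>0\<close> they coincide and count once.\<close>
  define f where "f n = (if n = 0 then T 0 else T (int n) + T (- int n))" for n
  have cf: "clinear_op (f n)" for n using T(1) by (auto simp: f_def)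
  have bf: "banded (int n) (f n)" for n
    using T(2)[of 0] T(2)[of "int n"] T(2)[of "- int n"] by (auto simp: f_def intro: banded_linear)
  have M: "0 \<le> M" using c(1) by (simp add: M_def)
  have nf: "norm (f n) \<le> 2 * M * exp (- \<mu>) ^ n" for n
  proof -
    have ex: "exp (- \<mu> * real n) = exp (- \<mu>) ^ n" by (metis exp_of_nat_mult mult.commute)
    have "norm (f n) \<le> M * exp (- \<mu> * real n) + M * exp (- \<mu> * real n)"
    proof (cases "n = 0")
      case True
      then show ?thesis using T(3)[of 0] M by (simp add: f_def)
    next
      case False
      then show ?thesis
        using norm_triangle_mono[OF T(3)[of "int n"] T(3)[of "- int n"]] by (simp add: f_def)
    qed
    then show ?thesis unfolding ex by simp
  qed
  have "summable (\<lambda>n. 2 * M * exp (- \<mu>) ^ n)"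
    using c(2) by (intro summable_mult summable_geometric) simp
  then have sf: "summable f" by (rule summable_comparison_test[rotated]) (use nf in blast)
  define L where "L = suminf f"
  have lim: "(\<lambda>n. \<Sum>k<n. f k) \<longlonglongrightarrow> L" unfolding L_def by (rule summable_LIMSEQ[OF sf])
  have cL: "clinear_op L" by (rule clinear_op_limit[OF _ lim]) (intro clinear_op_sum cf)
  have fket: "f n (ket (y, j)) $. (x, i) = (if n = nat \<bar>x - y\<bar> then S (ket (y, j)) $. (x, i) else 0)" for n x y i j
    by (auto simp: f_def T(4) blinfun.add_left ell2_simps)
  \<comment> \<open>Complex-linear operators are determined by their matrix entries, and each entry
    of \<open>S\<close> occurs in exactly one term of the series.\<close>
  have "L = S"
  proof (rule clinear_op_ext[OF cL S(1)], rule ell2_eqI)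
    fix yj k :: "int \<times> 'w"
    obtain y j x i where yk: "yj = (y, j)" "k = (x, i)" by (metis surj_pair)
    have bl: "bounded_linear (\<lambda>A :: 'w lattice_op. cinner (ket k) (A (ket yj)))"
      by (intro bounded_linear_compose[OF bounded_linear_cinner_right] blinfun.bounded_linear_left)
    have "L (ket yj) $. k = (\<Sum>n. f n (ket yj) $. k)"
      using bounded_linear.suminf[OF bl sf] by (simp add: L_def)
    also have "\<dots> = (\<Sum>n\<in>{nat \<bar>x - y\<bar>}. f n (ket yj) $. k)"
      unfolding yk by (rule suminf_finite) (auto simp: fket)
    also have "\<dots> = S (ket yj) $. k" by (simp add: yk fket)
    finally show "L (ket yj) $. k = S (ket yj) $. k" .
  qed
  with lim have "(\<lambda>n. \<Sum>k<n. f k) \<longlonglongrightarrow> S" by simp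
  then obtain n where n: "norm ((\<Sum>k<n. f k) - S) < e"
    using e unfolding LIMSEQ_iff by blast
  have "banded (int n) (\<Sum>k<n. f k)"
    unfolding banded_def using banded_mono[OF bf, unfolded banded_def] by (intro local_in_sum) auto
  then show ?thesis using that[of "\<Sum>k<n. f k" "int n"] n cf by (auto intro: clinear_op_sum)
qed

subsection \<open>Path components of the exponentially local invertible operators\<close>

definition exp_local_GL :: "('w::finite) lattice_op set" where
  "exp_local_GL = {S. invertible_op S \<and> exp_local S}"

lemma banded_GL_subset: "banded_GL \<subseteq> exp_local_GL"
  using banded_exp_local by (auto simp: banded_GL_def exp_local_GL_def)

text \<open>With \<open>b\<close> the norm of the inverse of \<open>S\<close>, the radius solves
  \<open>4 * r * (2 * b + 1) = 1\<close>. Hence \<open>r * b \<le> 1 / 2\<close>, so the segment to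
  the truncation \<open>S'\<close> consists of invertible operators and the inverse of
  \<open>S'\<close> has norm at most \<open>2 * b\<close>. Any \<open>T\<close> within
  \<open>r\<close> of \<open>S\<close> is within \<open>2 * r\<close> of \<open>S'\<close>, where
  the index is still that of \<open>S'\<close>. One \<open>S'\<close> serves a whole ball, so the
  index is locally constant.\<close>

lemma exp_local_GL_near_banded:
  fixes S :: "'w::finite lattice_op"
  assumes S: "S \<in> exp_local_GL"
  obtains r S' B' R where "0 < r" "banded_invertible S' B' R" "path_component exp_local_GL S S'"
    "\<And>T. clinear_op T \<Longrightarrow> norm (T - S) < r \<Longrightarrow> fredholm (half_line_compression T)
      \<and> fredholm_index (half_line_compression T) = fredholm_index (half_line_compression S')"
proof -
  obtain B where B: "op_inverse S B" and eS: "exp_local S"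
    using S by (auto simp: exp_local_GL_def invertible_op_def)
  have cS: "clinear_op S" using B by (simp add: op_inverse_def)
  define b where "b = norm B"
  define r where "r = 1 / (4 * (2 * b + 1))"
  have b: "0 \<le> b" by (simp add: b_def)
  have r: "0 < r" using b by (simp add: r_def add_pos_nonneg)
  have rb: "4 * r * (2 * b + 1) = 1" using b by (simp add: r_def)
  then have "8 * (r * b) + 4 * r = 1" by (simp add: algebra_simps)
  then have rb': "r * b \<le> 1 / 2" using r by linarith
  obtain S' R where S': "clinear_op S'" "banded R S'" "0 \<le> R" "norm (S' - S) < r"
    using exp_local_truncation[OF cS eS r] .
  have seg: "invertible_op ((1 - t) *\<^sub>R S + t *\<^sub>R S')" if t: "0 \<le> t" "t \<le> 1" for t
  proof (rule op_inverse_perturb[OF B])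
    have "(1 - t) *\<^sub>R S + t *\<^sub>R S' - S = t *\<^sub>R (S' - S)" by (simp add: algebra_simps)
    then have "norm ((1 - t) *\<^sub>R S + t *\<^sub>R S' - S) * norm B = t * (norm (S' - S) * b)"
      using t by (simp add: b_def)
    also have "\<dots> \<le> 1 * (r * b)" using t S'(4) b r by (intro mult_mono) auto
    finally show "norm ((1 - t) *\<^sub>R S + t *\<^sub>R S' - S) * norm B < 1" using rb' by simp
  qed (use cS S' in auto)
  obtain B' where B': "op_inverse S' B'" using seg[of 1] by (auto simp: invertible_op_def)
  interpret banded_invertible S' B' R using B' S' by unfold_locales
  have nB': "norm B' \<le> 2 * b"
  proof (rule norm_blinfun_bound)
    fix x
    have "norm (S (B' x)) \<le> norm (S' (B' x)) + norm ((S' - S) (B' x))"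
      using norm_triangle_ineq4[of "S' (B' x)" "(S' - S) (B' x)"] by (simp add: blinfun.diff_left)
    also have "\<dots> \<le> norm x + r * norm (B' x)"
      using order_trans[OF norm_blinfun[of "S' - S" "B' x"] mult_right_mono[OF less_imp_le[OF S'(4)]]] by simp
    finally have "norm (S (B' x)) \<le> norm x + r * norm (B' x)" .
    then have "norm (B' x) \<le> b * (norm x + r * norm (B' x))"
      using op_inverse_lower_bound[OF B, of "B' x"] mult_left_mono[of "norm (S (B' x))" _ b] b
      unfolding b_def by (meson order_trans norm_ge_zero)
    also have "\<dots> = b * norm x + (r * b) * norm (B' x)" by (simp add: algebra_simps)
    also have "\<dots> \<le> b * norm x + 1 / 2 * norm (B' x)"
      using rb' by (intro add_left_mono mult_right_mono) auto
    finally show "norm (B' x) \<le> 2 * b * norm x" by simp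
  qed (use b in simp)
  have near: "fredholm (half_line_compression T)
      \<and> fredholm_index (half_line_compression T) = fredholm_index (half_line_compression S')"
    if T: "clinear_op T" "norm (T - S) < r" for T
  proof -
    have "norm (T - S') \<le> 2 * r"
      using norm_triangle_ineq4[of "T - S" "S' - S"] T(2) S'(4) by simp
    then have "norm (T - S') * (norm B' + 1) \<le> 2 * r * (2 * b + 1)"
      using nB' r by (intro mult_mono) auto
    then have "norm (T - S') * (norm B' + 1) < 1" using rb by simp
    from fredholm_half_line_near[OF T(1) this] fredholm_half_line_near(2)[of S' R]
    show ?thesis by simp
  qed
  have "path_component exp_local_GL S S'"
  proof (rule path_component_linepath, rule subsetI)
    fix Z assume "Z \<in> closed_segment S S'"
    then obtain t where t: "0 \<le> t" "t \<le> 1" "Z = (1 - t) *\<^sub>R S + t *\<^sub>R S'"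
      by (rule closed_segment_memE)
    have "exp_local Z"
      unfolding t(3) using eS banded_exp_local[OF S'(2)] by (intro exp_local_add exp_local_scaleR)
    then show "Z \<in> exp_local_GL" using seg[OF t(1,2)] t(3) by (simp add: exp_local_GL_def)
  qed
  then show ?thesis using that[OF r _ _ near] banded_invertible_axioms by blast
qed

abbreviation half_line_index :: "'w lattice_op \<Rightarrow> int" where
  "half_line_index S \<equiv> fredholm_index (half_line_compression S)"

lemma fredholm_exp_local_GL:
  assumes "S \<in> exp_local_GL"
  shows "fredholm (half_line_compression S)"
proof -
  obtain r S' B' R where r: "0 < r" "banded_invertible S' B' R" "path_component exp_local_GL S S'"
    "\<And>T. clinear_op T \<Longrightarrow> norm (T - S) < r \<Longrightarrow> fredholm (half_line_compression T)
      \<and> half_line_index T = half_line_index S'"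
    using exp_local_GL_near_banded[OF assms] by blast
  then show ?thesis using r(4)[of S] assms by (auto simp: exp_local_GL_def)
qed

lemma continuous_on_half_line_index: "continuous_on exp_local_GL half_line_index"
  unfolding continuous_on_def
proof
  fix S :: "'w::finite lattice_op" assume S: "S \<in> exp_local_GL"
  obtain r S' B' R where r: "0 < r" "banded_invertible S' B' R" "path_component exp_local_GL S S'"
    "\<And>T. clinear_op T \<Longrightarrow> norm (T - S) < r \<Longrightarrow> fredholm (half_line_compression T)
      \<and> half_line_index T = half_line_index S'"
    using exp_local_GL_near_banded[OF S] by blast
  have cl: "clinear_op T" if "T \<in> exp_local_GL" for T :: "'w lattice_op"
    using that by (auto simp: exp_local_GL_def)
  have "half_line_index S = half_line_index S'" using r(1) r(4)[of S] cl[OF S] by simp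
  then have "\<forall>\<^sub>F T in at S within exp_local_GL. half_line_index T = half_line_index S"
    unfolding eventually_at using r(1,4) cl by (auto simp: dist_norm intro!: exI[of _ r])
  then show "(half_line_index \<longlongrightarrow> half_line_index S) (at S within exp_local_GL)"
    by (rule tendsto_eventually)
qed

lemma banded_invertible_mono: "banded_invertible S B R \<Longrightarrow> R \<le> R' \<Longrightarrow> banded_invertible S B R'"
  unfolding banded_invertible_def by (auto intro: banded_mono)

text \<open>The operator shifting one of the internal degrees of freedom by \<open>m\<close> sites to the right.\<close>

lemma shift_op:
  obtains \<tau> :: "int \<times> 'w::finite \<Rightarrow> int \<times> 'w" and U Ui :: "'w lattice_op" where
    "bij \<tau>" "\<And>i. \<bar>fst (\<tau> i) - fst i\<bar> \<le> \<bar>m\<bar>" "\<And>x i. U x $. i = x $. \<tau> i"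
    "banded_invertible U Ui \<bar>m\<bar>" "half_line_index U = - m"
proof -
  define w0 :: 'w where "w0 = undefined"
  \<comment> \<open>The value at \<open>i\<close> is fetched from \<open>\<tau> i\<close>, so
    subtracting \<open>m\<close> moves vectors to the right by \<open>m\<close>.\<close>
  define \<tau> :: "int \<times> 'w \<Rightarrow> int \<times> 'w" where "\<tau> i = (if snd i = w0 then fst i - m else fst i, snd i)" for i
  define \<sigma> :: "int \<times> 'w \<Rightarrow> int \<times> 'w" where "\<sigma> i = (if snd i = w0 then fst i + m else fst i, snd i)" for i
  have st: "\<sigma> (\<tau> i) = i" "\<tau> (\<sigma> i) = i" for i by (cases i, simp add: \<sigma>_def \<tau>_def)+
  have bij: "bij \<tau>" by (rule bijI') (metis st, metis st)
  have bd: "\<bar>fst (\<tau> i) - fst i\<bar> \<le> \<bar>m\<bar>" for i by (simp add: \<tau>_def)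
  obtain U Ui where U: "banded_invertible U Ui \<bar>m\<bar>" "\<And>x i. U x $. i = x $. \<tau> i"
    using permutation_op[OF bij bd] by blast
  interpret banded_invertible U Ui "\<bar>m\<bar>" by (rule U(1))
  define l where "l = \<bar>m\<bar>"
  have l: "0 \<le> l" "m \<le> l" "- m \<le> l" by (auto simp: l_def)
  have img: "\<tau> ` up 0 = {j. 0 \<le> fst (\<sigma> j)}"
  proof (intro subset_antisym subsetI)
    fix j assume "j \<in> \<tau> ` up 0"
    then show "j \<in> {j. 0 \<le> fst (\<sigma> j)}" by (force simp: st simp del: split_paired_All)
  next
    fix j assume "j \<in> {j. 0 \<le> fst (\<sigma> j)}"
    then have "\<sigma> j \<in> up 0" by simp
    then have "\<tau> (\<sigma> j) \<in> \<tau> ` up 0" by (rule imageI)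
    then show "j \<in> \<tau> ` up 0" by (simp only: st)
  qed
  define X where "X = \<tau> ` up 0 \<inter> slab (0 - l) (0 + l)"
  \<comment> \<open>The shifted component contributes \<open>l + m\<close> coordinates and every
    other one \<open>l\<close>; the count exceeds \<open>l * CARD('w)\<close> by \<open>m\<close>,
    so the index is \<open>- m\<close>.\<close>
  have X: "X = {- m..<l} \<times> {w0} \<union> {0..<l} \<times> (UNIV - {w0})"
    unfolding X_def img using l by (auto simp: \<sigma>_def split: if_splits)
  have fX: "finite X" unfolding X by simp
  have "card X = card ({- m..<l} \<times> {w0}) + card ({0..<l} \<times> (UNIV - {w0}))"
    unfolding X by (rule card_Un_disjoint) auto
  also have "\<dots> = nat (l + m) + nat l * (CARD('w) - 1)"
    by (simp add: card_cartesian_product card_Diff_singleton)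
  finally have "int (card X) = (l + m) + l * (int CARD('w) - 1)"
    using l zero_less_card_finite[where 'a = 'w] by (simp add: of_nat_diff Suc_le_eq)
  then have cX: "int (card X) = l * int CARD('w) + m" by (simp add: algebra_simps)
  have "cut_space U 0 (0 + l) = coord_space X"
    unfolding X_def by (rule cut_space_permutation[OF bij U(2) bd]) (simp add: l_def)
  then have "half_line_index U = - m"
    using dim_cut_space[of l 0] cX fX by (simp add: l_def coord_space_finite)
  then show ?thesis using that[OF bij bd U(2,1)] by simp
qed

text \<open>Both operators are joined to the same shift, by way of banded operators of the same
  index; band widths are enlarged to a common value for this.\<close>

lemma path_component_exp_local_GL:
  fixes S T :: "'w::finite lattice_op"
  assumes S: "S \<in> exp_local_GL" and T: "T \<in> exp_local_GL" and eq: "half_line_index S = half_line_index T"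
  shows "path_component exp_local_GL S T"
proof -
  define m where "m = - half_line_index S"
  obtain \<tau> :: "int \<times> 'w \<Rightarrow> int \<times> 'w" and U Ui :: "'w lattice_op" where U:
    "bij \<tau>" "\<And>i. \<bar>fst (\<tau> i) - fst i\<bar> \<le> \<bar>m\<bar>" "\<And>x i. U x $. i = x $. \<tau> i"
    "banded_invertible U Ui \<bar>m\<bar>" "half_line_index U = - m"
    by (rule shift_op[of m]) blast
  have "path_component exp_local_GL Z U" if Z: "Z \<in> exp_local_GL" "half_line_index Z = - m" for Z
  proof -
    obtain r Z' B' R where Z': "0 < r" "banded_invertible Z' B' R" "path_component exp_local_GL Z Z'"
      "\<And>T. clinear_op T \<Longrightarrow> norm (T - Z) < r \<Longrightarrow> fredholm (half_line_compression T)
      \<and> half_line_index T = half_line_index Z'"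
      using exp_local_GL_near_banded[OF Z(1)] by blast
    have "half_line_index Z = half_line_index Z'"
      using Z'(1) Z'(4)[of Z] Z(1) by (auto simp: exp_local_GL_def)
    then have "path_component banded_GL Z' U"
      using U(2)[THEN order_trans, of "max R \<bar>m\<bar>"] Z(2) U(5)
      by (intro banded_invertible.connected_to_permutation[OF banded_invertible_mono[OF Z'(2)]
            banded_invertible_mono[OF U(4)] U(1,3), of "max R \<bar>m\<bar>"]) auto
    then show ?thesis
      using Z'(3) path_component_of_subset[OF banded_GL_subset] path_component_trans by blast
  qed
  from this[OF S] this[OF T] show ?thesis
    using eq path_component_sym path_component_trans by (metis m_def minus_minus)
qed

subsection \<open>Chiral insulators\<close>

lemma clinear_push_op: "inj f \<Longrightarrow> clinear_op (push_op f)"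
  unfolding clinear_op_def by (intro allI ell2_eqI) (simp add: ell2_apply_push_op scaleC.rep_eq)

lemma clinear_pull_op: "inj f \<Longrightarrow> clinear_op (pull_op f)"
  unfolding clinear_op_def by (intro allI ell2_eqI) (simp add: ell2_apply_pull_op scaleC.rep_eq)

lemmas clinear_sites = clinear_push_op[OF inj_sites(1)] clinear_push_op[OF inj_sites(2)]
  clinear_pull_op[OF inj_sites(1)] clinear_pull_op[OF inj_sites(2)]

lemma ell2_sum_eqI:
  fixes x y :: "(int \<times> ('w + 'w)) ell2"
  assumes "\<And>n i. x $. (n, Inl i) = y $. (n, Inl i)" "\<And>n i. x $. (n, Inr i) = y $. (n, Inr i)"
  shows "x = y"
proof (rule ell2_eqI)
  fix k show "x $. k = y $. k" by (cases k; cases "snd k") (auto simp: assms)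
qed

lemma pull_push_sites [simp]:
  "pull_op plus_site (push_op plus_site x) = x" "pull_op minus_site (push_op minus_site x) = x"
  "pull_op plus_site (push_op minus_site x) = 0" "pull_op minus_site (push_op plus_site x) = 0"
  by (rule ell2_eqI, auto simp: split_paired_all zero_ell2.rep_eq)+

lemma push_pull_sites: "push_op plus_site (pull_op plus_site x) + push_op minus_site (pull_op minus_site x) = x"
  by (rule ell2_sum_eqI) (simp_all add: ell2_simps)

lemma push_ket [simp]:
  "push_op plus_site (ket (n, i)) = ket (n, Inl i)" "push_op minus_site (ket (n, i)) = ket (n, Inr i)"
  by (rule ell2_sum_eqI, simp_all add: ket.rep_eq)+

lemma pull_ket [simp]:
  "pull_op plus_site (ket (n, Inl i)) = ket (n, i)" "pull_op plus_site (ket (n, Inr i)) = 0"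
  "pull_op minus_site (ket (n, Inr i)) = ket (n, i)" "pull_op minus_site (ket (n, Inl i)) = 0"
  by (rule ell2_eqI, auto simp: split_paired_all zero_ell2.rep_eq ket.rep_eq)+

lemma off_diagonal_apply:
  "off_diagonal S x = push_op plus_site (cadjoint S (pull_op minus_site x)) + push_op minus_site (S (pull_op plus_site x))"
  by (simp add: off_diagonal_def blinfun.add_left)

lemma lower_left_apply: "lower_left H x = pull_op minus_site (H (push_op plus_site x))"
  by (simp add: lower_left_def)

lemma diag_op_zero: "diag_op (\<lambda>_. 0) = 0"
  by (intro blinfun_eqI ell2_eqI) (simp add: ell2_apply_diag_op zero_ell2.rep_eq)

lemma zero_notin_spectrum: "clinear_op A \<Longrightarrow> 0 \<notin> spectrum A \<longleftrightarrow> invertible_op A"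
proof -
  have "B o\<^sub>L A = id_blinfun \<longleftrightarrow> (\<forall>x. B (A x) = x)" for A B :: "'a ell2 \<Rightarrow>\<^sub>L 'a ell2"
    by (metis blinfun_apply_blinfun_compose blinfun_eqI id_blinfun.rep_eq id_apply)
  then show "clinear_op A \<Longrightarrow> 0 \<notin> spectrum A \<longleftrightarrow> invertible_op A"
    by (auto simp: spectrum_def diag_op_zero invertible_op_def op_inverse_def)
qed

lemma cadjoint_entry: "clinear_op A \<Longrightarrow> cadjoint A (ket j) $. i = cnj (A (ket i) $. j)"
  using cinner_cadjoint'[of A "ket i" "ket j"] by simp

lemma lower_left_exp_local_GL:
  fixes H :: "('w::finite + 'w) lattice_op"
  assumes H: "H \<in> chiral_insulators"
  shows "lower_left H \<in> exp_local_GL"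
proof -
  define S where "S = lower_left H"
  have HS: "H = off_diagonal S" unfolding S_def by (rule off_diagonal_lower_left[OF H, symmetric])
  have cH: "clinear_op H" and eH: "exp_local H" and "invertible_op H"
    using H zero_notin_spectrum[of H]
    by (auto simp: chiral_insulators_def exp_local_insulators_def selfadjoint_def)
  then obtain B where B: "op_inverse H B" by (auto simp: invertible_op_def)
  \<comment> \<open>The upper right block of the inverse of \<open>H\<close>: for an off-diagonal
    operator it inverts the lower left block.\<close>
  define C where "C = pull_op plus_site o\<^sub>L B o\<^sub>L push_op minus_site"
  have cS: "clinear_op S" unfolding S_def lower_left_def by (intro clinear_op_intros clinear_sites cH)
  have "op_inverse S C"
    unfolding op_inverse_def
  proof (intro conjI allI)
    show "clinear_op C" unfolding C_def using B by (intro clinear_op_intros clinear_sites) (auto simp: op_inverse_def)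
    fix y
    have "H (B (push_op minus_site y)) = push_op minus_site y" using B by (simp add: op_inverse_def)
    from arg_cong[OF this, of "pull_op minus_site"] show "S (C y) = y"
      by (simp add: HS off_diagonal_apply C_def blinfun.add_right)
    have "push_op minus_site (S y) = H (push_op plus_site y)"
      by (simp add: HS off_diagonal_apply blinfun.zero_right)
    then show "C (S y) = y" using B by (simp add: C_def op_inverse_def)
  qed (rule cS)
  moreover have "exp_local S"
  proof -
    obtain c \<mu> where c: "0 < \<mu>"
      "\<And>x y i j. cmod (H (ket (y, j)) $. (x, i)) \<le> c * exp (- \<mu> * \<bar>real_of_int (x - y)\<bar>)"
      using eH unfolding exp_local_iff by blast
    have "cmod (S (ket (y, j)) $. (x, i)) \<le> c * exp (- \<mu> * \<bar>real_of_int (x - y)\<bar>)" for x y i j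
      using c(2)[of y "Inl j" x "Inr i"] by (simp add: S_def lower_left_apply)
    then show ?thesis unfolding exp_local_iff using c(1) by blast
  qed
  ultimately show ?thesis by (auto simp: exp_local_GL_def invertible_op_def S_def)
qed

lemma off_diagonal_chiral_insulators:
  fixes S :: "'w::finite lattice_op"
  assumes S: "S \<in> exp_local_GL"
  shows "off_diagonal S \<in> chiral_insulators"
proof -
  obtain B where B: "op_inverse S B" and eS: "exp_local S"
    using S by (auto simp: exp_local_GL_def invertible_op_def)
  have cS: "clinear_op S" "clinear_op B" using B by (auto simp: op_inverse_def)
  note cA = clinear_cadjoint[OF cS(1)] clinear_cadjoint[OF cS(2)]
  define H where "H = off_diagonal S"
  have Hx: "H x = push_op plus_site (cadjoint S (pull_op minus_site x)) + push_op minus_site (S (pull_op plus_site x))" for x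
    unfolding H_def by (rule off_diagonal_apply)
  have cH: "clinear_op H" unfolding H_def off_diagonal_def by (intro clinear_op_intros clinear_sites cS cA)
  have "cadjoint H = H"
    by (rule cadjoint_unique)
      (simp add: Hx cinner_add_left cinner_add_right cinner_push_pull inj_sites cinner_pull_push[symmetric]
        cinner_cadjoint[OF cS(1)] cinner_cadjoint'[OF cS(1)])
  then have "selfadjoint H" using cH by (simp add: selfadjoint_def)
  moreover have "exp_local H"
  proof -
    obtain c \<mu> where c: "0 \<le> c" "0 < \<mu>"
      "\<And>x y i j. cmod (S (ket (y, j)) $. (x, i)) \<le> c * exp (- \<mu> * \<bar>real_of_int (x - y)\<bar>)"
      using exp_local_bound[OF eS] by blast
    have "cmod (H (ket (y, j)) $. (x, i)) \<le> c * exp (- \<mu> * \<bar>real_of_int (x - y)\<bar>)" for x y i j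
    proof (cases j)
      case (Inl j')
      then show ?thesis using c(1) c(3)[of y j' x]
        by (cases i) (auto simp: Hx ell2_simps blinfun.zero_right)
    next
      case (Inr j')
      then show ?thesis using c(1) c(3)[of x _ y j']
        by (cases i) (auto simp: Hx ell2_simps blinfun.zero_right cadjoint_entry[OF cS(1)] abs_minus_commute)
    qed
    then show ?thesis unfolding exp_local_iff using c(2) by blast
  qed
  moreover have "0 \<notin> spectrum H"
    unfolding zero_notin_spectrum[OF cH] invertible_op_def
  proof
    \<comment> \<open>The inverse of an off-diagonal operator carries the inverses of the blocks in
      exchanged positions; that of \<open>cadjoint S\<close> is \<open>cadjoint B\<close>.\<close>
    define K where "K = (push_op plus_site o\<^sub>L B o\<^sub>L pull_op minus_site)
      + (push_op minus_site o\<^sub>L cadjoint B o\<^sub>L pull_op plus_site)"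
    have Kx: "K x = push_op plus_site (B (pull_op minus_site x)) + push_op minus_site (cadjoint B (pull_op plus_site x))" for x
      by (simp add: K_def blinfun.add_left)
    have cK: "clinear_op K" unfolding K_def by (intro clinear_op_intros clinear_sites cS cA)
    have SB: "S (B x) = x" "B (S x) = x" for x using B by (auto simp: op_inverse_def)
    have adj: "cadjoint S (cadjoint B x) = x" "cadjoint B (cadjoint S x) = x" for x
      by (rule cinner_ext, simp add: cinner_cadjoint cS SB)+
    show "op_inverse H K"
      unfolding op_inverse_def using cH cK push_pull_sites
      by (auto simp: Hx Kx blinfun.add_right SB adj add.commute)
  qed
  moreover have "H o\<^sub>L chiral_sym = - (chiral_sym o\<^sub>L H)"
  proof (rule blinfun_eqI)
    fix x :: "(int \<times> ('w + 'w)) ell2"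
    have "pull_op minus_site (chiral_sym x) = - pull_op minus_site x" "pull_op plus_site (chiral_sym x) = pull_op plus_site x"
      by (auto intro!: ell2_eqI simp: split_paired_all ell2_simps)
    then have "H (chiral_sym x) = - push_op plus_site (cadjoint S (pull_op minus_site x)) + push_op minus_site (S (pull_op plus_site x))"
      by (simp add: Hx blinfun.minus_right)
    also have "\<dots> = - chiral_sym (H x)"
      by (rule ell2_sum_eqI) (simp_all add: Hx ell2_simps)
    finally show "(H o\<^sub>L chiral_sym) x = (- (chiral_sym o\<^sub>L H)) x" by (simp add: blinfun.minus_left)
  qed
  ultimately show ?thesis by (simp add: chiral_insulators_def exp_local_insulators_def H_def)
qed

section \<open>Continuity of the block correspondence and classification of path components\<close>

lemma continuous_on_cadjoint: "continuous_on {S. clinear_op S} cadjoint"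
proof (rule continuous_onI)
  fix S :: "'i ell2 \<Rightarrow>\<^sub>L 'j ell2" and e :: real
  assume S: "S \<in> {S. clinear_op S}" and e: "0 < e"
  have "dist (cadjoint T) (cadjoint S) \<le> dist T S" if "clinear_op T" for T
    using norm_cadjoint_le[of "T - S"] that S by (simp add: dist_norm cadjoint_diff)
  then show "\<exists>d>0. \<forall>T\<in>{S. clinear_op S}. dist T S < d \<longrightarrow> dist (cadjoint T) (cadjoint S) \<le> e"
    using e by (intro exI[of _ e]) force
qed

lemma continuous_on_off_diagonal: "continuous_on exp_local_GL off_diagonal"
proof -
  have "continuous_on exp_local_GL (cadjoint :: 'w::finite lattice_op \<Rightarrow> _)"
    by (rule continuous_on_subset[OF continuous_on_cadjoint]) (auto simp: exp_local_GL_def)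
  then show ?thesis unfolding off_diagonal_def
    by (intro continuous_on_add bounded_bilinear.continuous_on[OF bounded_bilinear_blinfun_compose]
        continuous_on_const continuous_on_id)
qed

lemma continuous_on_lower_left: "continuous_on X lower_left"
  unfolding lower_left_def
  by (intro bounded_bilinear.continuous_on[OF bounded_bilinear_blinfun_compose]
      continuous_on_const continuous_on_id)

lemma continuous_on_chiral_index: "continuous_on chiral_insulators chiral_index"
proof -
  have "continuous_on chiral_insulators (half_line_index \<circ> lower_left)"
    by (rule continuous_on_compose[OF continuous_on_lower_left])
      (rule continuous_on_subset[OF continuous_on_half_line_index], auto intro: lower_left_exp_local_GL)
  then show ?thesis by (simp add: chiral_index_def[abs_def] o_def)
qed

text \<open>A continuous integer-valued map is constant on the connected image of a path.
  Conversely, \<open>off_diagonal\<close> turns a path of lower left blocks into a path of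
  insulators with the right endpoints.\<close>

lemma path_component_chiral_iff:
  fixes H K :: "('w::finite + 'w) lattice_op"
  assumes "H \<in> chiral_insulators" "K \<in> chiral_insulators"
  shows "path_component chiral_insulators H K \<longleftrightarrow> chiral_index H = chiral_index K"
proof
  assume "path_component chiral_insulators H K"
  then obtain g where g: "path g" "path_image g \<subseteq> chiral_insulators" "pathstart g = H" "pathfinish g = K"
    by (auto simp: path_component_def)
  have "connected (chiral_index ` path_image g)"
    by (intro connected_continuous_image connected_path_image g
        continuous_on_subset[OF continuous_on_chiral_index g(2)])
  then have "{chiral_index H} \<inter> chiral_index ` path_image g = {}
      \<or> (- {chiral_index H}) \<inter> chiral_index ` path_image g = {}"
    by (rule connectedD) (auto intro: open_discrete)
  moreover have "chiral_index H \<in> chiral_index ` path_image g" "chiral_index K \<in> chiral_index ` path_image g"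
    using g(3,4) pathstart_in_path_image[of g] pathfinish_in_path_image[of g] by auto
  ultimately have "chiral_index K \<notin> - {chiral_index H}" by (metis IntI empty_iff singletonI)
  then show "chiral_index H = chiral_index K" by simp
next
  assume "chiral_index H = chiral_index K"
  then have "path_component exp_local_GL (lower_left H) (lower_left K)"
    by (intro path_component_exp_local_GL lower_left_exp_local_GL assms) (simp add: chiral_index_def)
  then obtain g where g: "path g" "path_image g \<subseteq> exp_local_GL" "pathstart g = lower_left H" "pathfinish g = lower_left K"
    by (auto simp: path_component_def)
  have "path (off_diagonal \<circ> g)"
    by (intro path_continuous_image g(1) continuous_on_subset[OF continuous_on_off_diagonal g(2)])
  moreover have "path_image (off_diagonal \<circ> g) \<subseteq> chiral_insulators"
    using g(2) by (auto simp: path_image_compose intro: off_diagonal_chiral_insulators)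
  ultimately show "path_component chiral_insulators H K"
    unfolding path_component_def using g(3,4) assms
    by (intro exI[of _ "off_diagonal \<circ> g"])
      (auto simp: pathstart_compose pathfinish_compose off_diagonal_lower_left)
qed

lemma chiral_index_surj:
  "\<exists>H \<in> (chiral_insulators :: ('w::finite + 'w) lattice_op set). chiral_index H = m"
proof -
  obtain \<tau> :: "int \<times> 'w \<Rightarrow> int \<times> 'w" and U Ui :: "'w lattice_op" where U:
    "bij \<tau>" "\<And>i. \<bar>fst (\<tau> i) - fst i\<bar> \<le> \<bar>- m\<bar>" "\<And>x i. U x $. i = x $. \<tau> i"
    "banded_invertible U Ui \<bar>- m\<bar>" "half_line_index U = - (- m)"
    by (rule shift_op[of "- m"]) blast
  have "U \<in> banded_GL"
    using U(4) by (auto simp: banded_GL_def banded_invertible_def invertible_op_def)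
  then have "off_diagonal U \<in> chiral_insulators"
    using banded_GL_subset by (intro off_diagonal_chiral_insulators) blast
  moreover have "chiral_index (off_diagonal U) = m"
    using U(5) by (simp add: chiral_index_def lower_left_off_diagonal)
  ultimately show ?thesis by blast
qed

theorem theorem5p17:
  shows "(\<forall>H \<in> (chiral_insulators :: ('w::finite + 'w) lattice_op set).
            fredholm (half_line_compression (lower_left H)))
    \<and> continuous_on (chiral_insulators :: ('w + 'w) lattice_op set) chiral_index
    \<and> (\<exists>\<phi>. bij_betw \<phi>
              (path_components_of (top_of_set (chiral_insulators :: ('w + 'w) lattice_op set)))
              (UNIV :: int set)
          \<and> (\<forall>H \<in> (chiral_insulators :: ('w + 'w) lattice_op set).
                \<phi> (path_component_of_set (top_of_set chiral_insulators) H) = chiral_index H))"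
proof (intro conjI ballI)
  let ?X = "chiral_insulators :: ('w + 'w) lattice_op set"
  let ?c = "path_component_of_set (top_of_set ?X)"
  show "fredholm (half_line_compression (lower_left H))" if "H \<in> ?X" for H
    by (rule fredholm_exp_local_GL[OF lower_left_exp_local_GL[OF that]])
  show "continuous_on ?X chiral_index" by (rule continuous_on_chiral_index)
  \<comment> \<open>The index of an arbitrarily chosen member; on a path component the choice does
    not matter.\<close>
  define \<phi> where "\<phi> C = chiral_index (SOME H. H \<in> C)" for C :: "('w + 'w) lattice_op set"
  have mem: "K \<in> ?c H \<longleftrightarrow> path_component ?X H K" for H K by simp
  have \<phi>: "\<phi> (?c H) = chiral_index H" if H: "H \<in> ?X" for H
  proof -
    have "H \<in> ?c H" using H by (simp add: path_component_refl)
    then have "(SOME K. K \<in> ?c H) \<in> ?c H" by (rule someI)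
    then have "path_component ?X H (SOME K. K \<in> ?c H)" by (simp only: mem)
    then show ?thesis
      unfolding \<phi>_def using path_component_chiral_iff[OF H] path_component_mem(2) by metis
  qed
  have "bij_betw \<phi> (path_components_of (top_of_set ?X)) UNIV"
    unfolding bij_betw_def
  proof
    show "inj_on \<phi> (path_components_of (top_of_set ?X))"
    proof (rule inj_onI)
      fix C D assume "C \<in> path_components_of (top_of_set ?X)" "D \<in> path_components_of (top_of_set ?X)"
        and eq: "\<phi> C = \<phi> D"
      then obtain H K where HK: "H \<in> ?X" "K \<in> ?X" "C = ?c H" "D = ?c K"
        by (auto simp: path_components_of_def)
      then have "K \<in> path_component_set ?X H" using eq \<phi> path_component_chiral_iff[OF HK(1,2)] by simp
      from path_component_eq[OF this] show "C = D"
        unfolding HK(3,4) path_component_of_canon_iff by (rule sym)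
    qed
    show "\<phi> ` path_components_of (top_of_set ?X) = UNIV"
    proof (rule subset_antisym[OF subset_UNIV], rule subsetI)
      fix m :: int
      obtain H where "H \<in> ?X" "chiral_index H = m" using chiral_index_surj by blast
      then show "m \<in> \<phi> ` path_components_of (top_of_set ?X)"
        using \<phi> by (auto simp: path_components_of_def image_image intro: rev_image_eqI)
    qed
  qed
  then show "\<exists>\<phi>. bij_betw \<phi> (path_components_of (top_of_set ?X)) UNIV
      \<and> (\<forall>H\<in>?X. \<phi> (?c H) = chiral_index H)"
    using \<phi> by blast
qed

end
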